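(* Consider the following testing problem with parameters $\eta\in(0,1/2)$, $\alpha>0$, $n,d\in\mathbb N$, input $y=(y_1,\dots,y_n)\in(\mathbb R^d)^n$: under $H_0$, $y_1,\dots,y_n$ are i.i.d. $\mathcal N(0,I_d)$; under $H_1$, a unit vector $v$ is drawn uniformly from $\mathcal S^{d-1}$ and then $y_1,\dots,y_n$ are i.i.d. from $(1-\eta)\mathcal N(\mu_v,\Sigma_v)+\eta Q_v$, where $Q_v$ are arbitrary distributions and $\|\Sigma_v^{-1/2}\mu_v\|_2\ge\alpha$. If $\eta\gg1/\sqrt d$, then for every $\alpha>0$ there exists a choice of $\mu_v,\Sigma_v,Q_v$ such that the degree-$D$ advantage of this problem is $O(1)$ for any $n$ with $n\gg d$ and $n\ll\frac{d^2\eta^2}{\mathrm{poly}(D)}$. In fact, the conclusion holds even with the minimum eigenvalue of $\Sigma_v$ at least $\Omega(\min(\eta/\alpha^2,0.5))$.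
   Context: For a testing problem $H_0:y\sim\mathcal Q$ versus $H_1:y\sim\mathcal P$ with $y\in(\mathbb R^d)^n$, the degree-$D$ advantage is $\max_f\frac{\mathbb E_{\mathcal P}[f(y)]}{\sqrt{\mathbb E_{\mathcal Q}[f(y)^2]}}$ over real polynomials $f$ of degree at most $D$ in the $nd$ coordinates of $y$; under $H_1$, $\mathcal P$ is the mixture over the random $v$. The symbols $\ll,\gg$ denote inequalities up to constant/polylogarithmic factors. *)

theory Defs
  imports
    "HOL-Probability.Probability"
    "Jordan_Normal_Form.Gauss_Jordan_Elimination"
    "Jordan_Normal_Form.Char_Poly"
begin

(* HOL-Analysis and Jordan_Normal_Form share several names; here R^d is carrier_vec d, because
   the constants in the theorem are uniform in the dimension d, which therefore has to be
   a quantified natural number. *)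
no_notation inner (infix "\<bullet>" 70)
no_notation vec_nth (infixl "$" 90)
hide_const (open) Finite_Cartesian_Product.vec Finite_Cartesian_Product.mat
  Finite_Cartesian_Product.row Determinants.det Finite_Cartesian_Product.transpose
hide_type (open) Finite_Cartesian_Product.vec

section \<open>Vectors and matrices\<close>

definition l2norm :: "real vec \<Rightarrow> real" where
  "l2norm x = sqrt (x \<bullet> x)"

definition unit_sphere :: "nat \<Rightarrow> real vec set" where
  "unit_sphere d = {v \<in> carrier_vec d. l2norm v = 1}"

definition psd :: "nat \<Rightarrow> real mat \<Rightarrow> bool" where
  "psd d A \<longleftrightarrow> A \<in> carrier_mat d d \<and> transpose_mat A = A \<and>
     (\<forall>x\<in>carrier_vec d. x \<bullet> (A *\<^sub>v x) \<ge> 0)"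

definition pos_def :: "nat \<Rightarrow> real mat \<Rightarrow> bool" where
  "pos_def d A \<longleftrightarrow> A \<in> carrier_mat d d \<and> transpose_mat A = A \<and>
     (\<forall>x\<in>carrier_vec d. x \<noteq> 0\<^sub>v d \<longrightarrow> x \<bullet> (A *\<^sub>v x) > 0)"

(* Only used for positive semidefinite A, where the positive semidefinite root exists
   and is unique. *)
definition mat_sqrt :: "real mat \<Rightarrow> real mat" where
  "mat_sqrt A = (THE B. psd (dim_row A) B \<and> B * B = A)"

definition mat_inv_sqrt :: "real mat \<Rightarrow> real mat" where
  "mat_inv_sqrt A = the (mat_inverse (mat_sqrt A))"

(* The set of real eigenvalues is finite, and nonempty when A is symmetric of dimension \<ge> 1. *)
definition min_eigenvalue :: "real mat \<Rightarrow> real" where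
  "min_eigenvalue A = Min {l. eigenvalue A l}"

section \<open>Distributions on R^d\<close>

definition Rd :: "nat \<Rightarrow> real vec measure" where
  "Rd d = vimage_algebra (carrier_vec d) (\<lambda>v. \<lambda>i\<in>{..<d}. v $ i) (PiM {..<d} (\<lambda>_. borel))"

definition std_gaussian :: "nat \<Rightarrow> real vec measure" where
  "std_gaussian d = distr (PiM {..<d} (\<lambda>_. density lborel std_normal_density)) (Rd d) (vec d)"

definition gaussian :: "nat \<Rightarrow> real vec \<Rightarrow> real mat \<Rightarrow> real vec measure" where
  "gaussian d \<mu> \<Sigma> = distr (std_gaussian d) (Rd d) (\<lambda>x. \<mu> + mat_sqrt \<Sigma> *\<^sub>v x)"

(* The rotation-invariant probability measure on the sphere, obtained as the law of g / |g|
   for a standard Gaussian g; the Gaussian null event g = 0 is cut off by the restriction. *)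
definition uniform_sphere :: "nat \<Rightarrow> real vec measure" where
  "uniform_sphere d = restrict_space
     (distr (std_gaussian d) (Rd d) (\<lambda>x. (1 / l2norm x) \<cdot>\<^sub>v x)) (unit_sphere d)"

(* The mixture (1 - \<eta>) G + \<eta> Q; see emeasure_contaminate. *)
definition contaminate :: "real \<Rightarrow> 'a measure \<Rightarrow> 'a measure \<Rightarrow> 'a measure" where
  "contaminate \<eta> G Q = measure_pmf (bernoulli_pmf \<eta>) \<bind> (\<lambda>b. if b then Q else G)"

section \<open>The testing problem\<close>

definition null_law :: "nat \<Rightarrow> nat \<Rightarrow> (nat \<Rightarrow> real vec) measure" where
  "null_law n d = PiM {..<n} (\<lambda>_. std_gaussian d)"

definition sample_law ::
  "nat \<Rightarrow> real \<Rightarrow> (real vec \<Rightarrow> real vec) \<Rightarrow> (real vec \<Rightarrow> real mat) \<Rightarrow> (real vec \<Rightarrow> real vec measure)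
    \<Rightarrow> real vec \<Rightarrow> real vec measure" where
  "sample_law d \<eta> \<mu> \<Sigma> Q v = contaminate \<eta> (gaussian d (\<mu> v) (\<Sigma> v)) (Q v)"

definition planted_law ::
  "nat \<Rightarrow> nat \<Rightarrow> real \<Rightarrow> (real vec \<Rightarrow> real vec) \<Rightarrow> (real vec \<Rightarrow> real mat) \<Rightarrow> (real vec \<Rightarrow> real vec measure)
    \<Rightarrow> (nat \<Rightarrow> real vec) measure" where
  "planted_law n d \<eta> \<mu> \<Sigma> Q =
     uniform_sphere d \<bind> (\<lambda>v. PiM {..<n} (\<lambda>_. sample_law d \<eta> \<mu> \<Sigma> Q v))"

(* The measurability requirement on the sample law says that the mixture over the random v
   defining planted_law makes sense. *)
definition valid_choice ::
  "nat \<Rightarrow> real \<Rightarrow> real \<Rightarrow> (real vec \<Rightarrow> real vec) \<Rightarrow> (real vec \<Rightarrow> real mat)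
    \<Rightarrow> (real vec \<Rightarrow> real vec measure) \<Rightarrow> bool" where
  "valid_choice d \<eta> \<alpha> \<mu> \<Sigma> Q \<longleftrightarrow>
     (\<forall>v\<in>unit_sphere d.
        \<mu> v \<in> carrier_vec d \<and> pos_def d (\<Sigma> v) \<and> Q v \<in> space (prob_algebra (Rd d)) \<and>
        l2norm (mat_inv_sqrt (\<Sigma> v) *\<^sub>v \<mu> v) \<ge> \<alpha>) \<and>
     sample_law d \<eta> \<mu> \<Sigma> Q \<in> uniform_sphere d \<rightarrow>\<^sub>M prob_algebra (Rd d)"

section \<open>Low-degree advantage\<close>

(* e i j is the exponent of the coordinate (y i) $ j *)
definition exponents :: "nat \<Rightarrow> nat \<Rightarrow> nat \<Rightarrow> (nat \<Rightarrow> nat \<Rightarrow> nat) set" where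
  "exponents n d D = {e. (\<forall>i j. \<not> (i < n \<and> j < d) \<longrightarrow> e i j = 0) \<and> (\<Sum>i<n. \<Sum>j<d. e i j) \<le> D}"

definition poly_funs :: "nat \<Rightarrow> nat \<Rightarrow> nat \<Rightarrow> ((nat \<Rightarrow> real vec) \<Rightarrow> real) set" where
  "poly_funs n d D =
     range (\<lambda>c y. \<Sum>e\<in>exponents n d D. c e * (\<Prod>i<n. \<Prod>j<d. (y i $ j) ^ e i j))"

(* Only meaningful if P integrates all polynomials of degree at most D, since the Bochner
   integral is 0 on non-integrable functions. *)
definition advantage ::
  "nat \<Rightarrow> nat \<Rightarrow> nat \<Rightarrow> (nat \<Rightarrow> real vec) measure \<Rightarrow> (nat \<Rightarrow> real vec) measure \<Rightarrow> ereal" where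
  "advantage n d D P Q =
     (SUP f\<in>{f \<in> poly_funs n d D. (\<integral>y. (f y)\<^sup>2 \<partial>Q) > 0}.
        ereal ((\<integral>y. f y \<partial>P) / sqrt (\<integral>y. (f y)\<^sup>2 \<partial>Q)))"

section \<open>Inequalities up to constant and polylogarithmic factors\<close>

(* a \<lless> b with hidden factor C polylog(d). The term 1 + ln d keeps the factor at least C,
   also for d = 1. *)
definition much_less :: "real \<Rightarrow> nat \<Rightarrow> nat \<Rightarrow> real \<Rightarrow> real \<Rightarrow> bool" where
  "much_less C k d a b \<longleftrightarrow> C * (1 + ln (real d)) ^ k * a \<le> b"

section \<open>Well-definedness\<close>

lemma finite_exponents: "finite (exponents n d D)"
proof -
  let ?F = "PiE ({..<n} \<times> {..<d}) (\<lambda>_. {..D})"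
  let ?g = "\<lambda>f i j. if i < n \<and> j < d then f (i, j) else (0::nat)"
  have "exponents n d D \<subseteq> ?g ` ?F"
  proof
    fix e assume e: "e \<in> exponents n d D"
    have le: "e i j \<le> D" if "i < n" "j < d" for i j
    proof -
      have "e i j \<le> (\<Sum>j<d. e i j)"
        using that by (intro member_le_sum) auto
      also have "\<dots> \<le> (\<Sum>i<n. \<Sum>j<d. e i j)"
        using that by (intro member_le_sum[where f = "\<lambda>i. \<Sum>j<d. e i j"]) auto
      finally show ?thesis using e by (simp add: exponents_def)
    qed
    let ?f = "\<lambda>p\<in>{..<n} \<times> {..<d}. e (fst p) (snd p)"
    have "e = ?g ?f" using e by (auto simp: exponents_def fun_eq_iff)
    moreover have "?f \<in> ?F" using le by auto
    ultimately show "e \<in> ?g ` ?F" by blast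
  qed
  moreover have "finite ?F" by (intro finite_PiE) auto
  ultimately show ?thesis by (meson finite_imageI finite_subset)
qed

lemma space_Rd [simp]: "space (Rd d) = carrier_vec d"
  by (simp add: Rd_def)

lemma measurable_vec_Rd: "vec d \<in> PiM {..<d} (\<lambda>_. borel) \<rightarrow>\<^sub>M Rd d"
  unfolding Rd_def
proof (rule measurable_vimage_algebra2)
  have "(\<lambda>x. \<lambda>i\<in>{..<d}. vec d x $ i) \<in> PiM {..<d} (\<lambda>_. borel) \<rightarrow>\<^sub>M PiM {..<d} (\<lambda>_. borel :: real measure)
     \<longleftrightarrow> (\<lambda>x. \<lambda>i\<in>{..<d}. x i) \<in> PiM {..<d} (\<lambda>_. borel) \<rightarrow>\<^sub>M PiM {..<d} (\<lambda>_. borel :: real measure)"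
    by (intro measurable_cong) (auto simp: restrict_def fun_eq_iff)
  then show "(\<lambda>x. \<lambda>i\<in>{..<d}. vec d x $ i) \<in> PiM {..<d} (\<lambda>_. borel) \<rightarrow>\<^sub>M PiM {..<d} (\<lambda>_. borel :: real measure)"
    by simp
qed auto

lemma prob_space_std_gaussian: "prob_space (std_gaussian d)"
proof -
  interpret product_prob_space "\<lambda>_. density lborel std_normal_density" "{..<d}"
    by (intro product_prob_spaceI prob_space_normal_density) simp
  have "sets (PiM {..<d} (\<lambda>_. density lborel std_normal_density)) = sets (PiM {..<d} (\<lambda>_. borel))"
    by (intro sets_PiM_cong) auto
  then have "vec d \<in> PiM {..<d} (\<lambda>_. density lborel std_normal_density) \<rightarrow>\<^sub>M Rd d"
    using measurable_vec_Rd measurable_cong_sets by blast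
  then show ?thesis unfolding std_gaussian_def by (rule prob_space_distr)
qed

lemma emeasure_contaminate:
  assumes "0 \<le> \<eta>" "\<eta> \<le> 1" "G \<in> space (prob_algebra M)" "Q \<in> space (prob_algebra M)" "A \<in> sets M"
  shows "emeasure (contaminate \<eta> G Q) A
           = ennreal (1 - \<eta>) * emeasure G A + ennreal \<eta> * emeasure Q A"
proof -
  have "(\<lambda>b. if b then Q else G) \<in> measure_pmf (bernoulli_pmf \<eta>) \<rightarrow>\<^sub>M subprob_algebra M"
    using assms(3,4)
    by (auto simp: space_prob_algebra space_subprob_algebra split: if_splits
        intro: prob_space_imp_subprob_space)
  then show ?thesis
    unfolding contaminate_def using assms
    by (subst emeasure_bind) (auto simp: mult.commute add.commute)
qed

end

theory Submission
  imports Defs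
begin

text \<open>Along the hidden direction \<open>v\<close> the planted sample has a one-dimensional law whose first three
  Hermite moments vanish: the Gaussian component sits at distance of order \<open>\<surd>\<eta>\<close> from the origin, and
  the noise, living at scale \<open>1/\<surd>\<eta>\<close>, compensates it. Its \<open>k\<close>-th Hermite moment \<open>\<lambda>\<^sub>k\<close> then satisfies
  \<open>\<lambda>\<^sub>k\<^sup>2/k! \<le> 4 \<eta>\<^sup>2 (9/\<eta>)^k\<close> for \<open>k \<ge> 4\<close>. Against polynomials of degree at most \<open>D\<close> the planted law acts
  as the function \<open>E\<^sub>v \<Sum>\<^sub>k \<Prod>\<^sub>i (\<lambda>\<^sub>k\<^sub>i/k\<^sub>i!) He\<^sub>k\<^sub>i (v \<bullet> y\<^sub>i)\<close>, the sum being over degree vectors \<open>k\<close> with \<open>|k| \<le> D\<close>;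
  by Cauchy-Schwarz and orthogonality of Hermite polynomials the squared advantage is at most
  \<open>E \<Sum>\<^sub>k \<Prod>\<^sub>i (\<lambda>\<^sub>k\<^sub>i\<^sup>2/k\<^sub>i!) (v \<bullet> w)^k\<^sub>i\<close> for independent \<open>v\<close>, \<open>w\<close>. As \<open>E |v \<bullet> w|^s\<close> is at most \<open>2 r^s\<close> with
  \<open>r = \<surd>(8D/d)\<close>, this is at most \<open>2 (1 + 8 \<eta>\<^sup>2 (9r/\<eta>)^4)^n\<close>, which is bounded since
  \<open>n D\<^sup>2\<close> is small compared with \<open>d\<^sup>2 \<eta>\<^sup>2\<close>; the assumption \<open>n \<ge> C d\<close> enters only to make \<open>9r/\<eta> \<le> 1/2\<close>.\<close>

section \<open>Measurability of vector-valued maps\<close>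

text \<open>Three moments are matched because moment \<open>k\<close> enters the exponent as about
  \<open>n \<eta>\<^sup>2 (r/\<eta>)^k\<close>. For k = 2 this is of order n D / d, which is not
  small once n >= C d; for k = 3 it is of order n D^(3/2) / (d^(3/2) \<eta>), bounded only for n up
  to about d^(3/2) \<eta>, short of \<open>d\<^sup>2 \<eta>\<^sup>2\<close> when \<eta> is far above
  1/sqrt d. At k = 4 it is \<open>n D\<^sup>2 / (d\<^sup>2 \<eta>\<^sup>2)\<close>, the claimed
  threshold. A large \<alpha> is reached by thinning the Gaussian along \<open>v\<close>, not by
  moving it away. Its mean m has to stay O(sqrt \<eta>): the thin component lacks second moment of
  order 1, which noise of mass \<eta> repays with second moment of order 1/\<eta>, and the noise
  mean -(1 - \<eta>) m / \<eta> is at most the root of that. Gaussian expectations of polynomials go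
  through Stein's identity E g_a F(g) = E (dF/dx_a)(g) in the given coordinates; it yields both the
  pairing of two directions \<open>v\<close>, \<open>w\<close> and the Hermite expansion of the
  planted law, without rotations or density ratios.\<close>

lemma measurable_Rd_component: "i < d \<Longrightarrow> (\<lambda>v. v $ i) \<in> borel_measurable (Rd d)"
proof -
  assume i: "i < d"
  have "(\<lambda>v. \<lambda>i\<in>{..<d}. v $ i) \<in> Rd d \<rightarrow>\<^sub>M PiM {..<d} (\<lambda>_. borel)"
    unfolding Rd_def by (rule measurable_vimage_algebra1) (auto simp: space_PiM)
  from measurable_compose[OF this measurable_component_singleton[of i "{..<d}"]]
  have "(\<lambda>v. (\<lambda>i\<in>{..<d}. v $ i) i) \<in> borel_measurable (Rd d)"
    using i by simp
  then show ?thesis using i by simp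
qed

lemma measurable_RdI:
  assumes "\<And>x. x \<in> space M \<Longrightarrow> f x \<in> carrier_vec d"
    and "\<And>i. i < d \<Longrightarrow> (\<lambda>x. f x $ i) \<in> borel_measurable M"
  shows "f \<in> M \<rightarrow>\<^sub>M Rd d"
  unfolding Rd_def
  using assms by (intro measurable_vimage_algebra2 measurable_restrict) auto

lemma measurable_Rd_component_comp:
  "f \<in> M \<rightarrow>\<^sub>M Rd d \<Longrightarrow> i < d \<Longrightarrow> (\<lambda>x. f x $ i) \<in> borel_measurable M"
  by (rule measurable_compose[OF _ measurable_Rd_component])

lemma measurable_Rd_carrier: "f \<in> M \<rightarrow>\<^sub>M Rd d \<Longrightarrow> x \<in> space M \<Longrightarrow> f x \<in> carrier_vec d"
  by (metis measurable_space space_Rd)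

lemma measurable_scalar_prod:
  assumes f: "f \<in> M \<rightarrow>\<^sub>M Rd d" and g: "g \<in> M \<rightarrow>\<^sub>M Rd d"
  shows "(\<lambda>x. f x \<bullet> g x) \<in> borel_measurable M"
proof -
  have "(\<lambda>x. \<Sum>i<d. f x $ i * g x $ i) \<in> borel_measurable M"
    by (intro borel_measurable_sum borel_measurable_times measurable_Rd_component_comp[OF f]
        measurable_Rd_component_comp[OF g]) auto
  moreover have "f x \<bullet> g x = (\<Sum>i<d. f x $ i * g x $ i)" if "x \<in> space M" for x
    using measurable_Rd_carrier[OF g that] by (simp add: scalar_prod_def lessThan_atLeast0)
  ultimately show ?thesis by (simp cong: measurable_cong)
qed

lemma scalar_prod_sum: "y \<in> carrier_vec d \<Longrightarrow> x \<bullet> y = (\<Sum>i<d. x $ i * y $ i)"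
  by (simp add: scalar_prod_def lessThan_atLeast0)

section \<open>Gaussian integration by parts for polynomials\<close>

abbreviation std_normal :: "real measure" where
  "std_normal \<equiv> density lborel std_normal_density"

lemma sets_std_gaussian [simp, measurable_cong]: "sets (std_gaussian d) = sets (Rd d)"
  by (simp add: std_gaussian_def)

lemma space_std_gaussian [simp]: "space (std_gaussian d) = carrier_vec d"
  by (simp add: std_gaussian_def)

lemma measurable_vec_std_normal: "vec d \<in> PiM {..<d} (\<lambda>_. std_normal) \<rightarrow>\<^sub>M Rd d"
proof -
  have "sets (PiM {..<d} (\<lambda>_. std_normal)) = sets (PiM {..<d} (\<lambda>_. borel))"
    by (intro sets_PiM_cong) auto
  then show ?thesis using measurable_vec_Rd measurable_cong_sets by blast
qed

lemma std_gaussian_prod: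
  fixes h :: "nat \<Rightarrow> real \<Rightarrow> real"
  assumes h: "\<And>j. j < d \<Longrightarrow> integrable std_normal (h j)"
  shows "integrable (std_gaussian d) (\<lambda>g. \<Prod>j<d. h j (g $ j))"
    and "(\<integral>g. (\<Prod>j<d. h j (g $ j)) \<partial>std_gaussian d) = (\<Prod>j<d. \<integral>x. h j x \<partial>std_normal)"
proof -
  interpret product_prob_space "\<lambda>_. std_normal" "{..<d}"
    by (intro product_prob_spaceI prob_space_normal_density) simp
  have hm: "h j \<in> borel_measurable borel" if "j < d" for j
    using borel_measurable_integrable[OF h[OF that]] by simp
  have m: "(\<lambda>g. \<Prod>j<d. h j (g $ j)) \<in> borel_measurable (Rd d)"
    by (intro borel_measurable_prod measurable_compose[OF measurable_Rd_component hm]) auto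
  have eq: "(\<Prod>j<d. h j (vec d x $ j)) = (\<Prod>j<d. h j (x j))" for x by simp
  show "integrable (std_gaussian d) (\<lambda>g. \<Prod>j<d. h j (g $ j))"
    unfolding std_gaussian_def
    by (subst integrable_distr_eq[OF measurable_vec_std_normal m])
       (unfold eq, intro product_integrable_prod, auto intro: h)
  show "(\<integral>g. (\<Prod>j<d. h j (g $ j)) \<partial>std_gaussian d) = (\<Prod>j<d. \<integral>x. h j x \<partial>std_normal)"
    unfolding std_gaussian_def
    by (subst integral_distr[OF measurable_vec_std_normal m])
       (unfold eq, intro product_integral_prod, auto intro: h)
qed

section \<open>Stein's identity, from powers through monomials to polynomials\<close>

lemma integrable_std_normal_power: "integrable std_normal (\<lambda>x. x ^ k)"
  by (subst integrable_density) (use integrable_std_normal_moment[of k] in auto)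

text \<open>One-dimensional integration by parts on powers, read off from the closed forms of the
  moments: odd ones vanish, and the even ones (2j)!/(2^j j!) gain a factor 2j + 1 at each step. At k
  = 0 the truncated \<open>k - 1\<close> is harmless, its coefficient being 0.\<close>

lemma integral_std_normal_power_Suc:
  "(\<integral>x. x ^ Suc k \<partial>std_normal) = real k * (\<integral>x. x ^ (k - 1) \<partial>std_normal)"
proof -
  have I: "(\<integral>x. x ^ k \<partial>std_normal) = (\<integral>x. std_normal_density x * x ^ k \<partial>lborel)" for k
    by (subst integral_density) auto
  show ?thesis
  proof (cases "even k")
    case True
    then obtain j where k: "k = 2 * j" by auto
    have "(\<integral>x. x ^ Suc k \<partial>std_normal) = 0"
      unfolding I using integral_std_normal_moment_odd[of j] k by simp
    moreover have "real k * (\<integral>x. x ^ (k - 1) \<partial>std_normal) = 0"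
    proof (cases j)
      case (Suc i)
      then have "k - 1 = 2 * i + 1" using k by simp
      then show ?thesis unfolding I using integral_std_normal_moment_odd[of i] by simp
    qed (simp add: k)
    ultimately show ?thesis by simp
  next
    case False
    then obtain j where k: "k = 2 * j + 1" using oddE by blast
    have "(\<integral>x. x ^ Suc k \<partial>std_normal) = fact (2 * Suc j) / (2 ^ Suc j * fact (Suc j))"
      unfolding I using integral_std_normal_moment_even[of "Suc j"] k by simp
    moreover have "(\<integral>x. x ^ (k - 1) \<partial>std_normal) = fact (2 * j) / (2 ^ j * fact j)"
      unfolding I using integral_std_normal_moment_even[of j] k by simp
    moreover have "fact (2 * Suc j) / (2 ^ Suc j * fact (Suc j))
      = (2 * real j + 1) * (fact (2 * j) / (2 ^ j * fact j))"
    proof -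
      have "(fact (2 * Suc j) :: real) = (2 * (real j + 1)) * ((2 * real j + 1) * fact (2 * j))"
        by (simp add: algebra_simps)
      moreover have "(2 ^ Suc j * fact (Suc j) :: real) = (2 * (real j + 1)) * (2 ^ j * fact j)"
        by (simp add: algebra_simps)
      moreover have "2 * (real j + 1) \<noteq> 0" using of_nat_0_le_iff[where 'a = real, of j] by auto
      ultimately show ?thesis by (metis mult_divide_mult_cancel_left times_divide_eq_right)
    qed
    ultimately show ?thesis
      by (simp add: k)
  qed
qed

definition mon :: "nat \<Rightarrow> (nat \<Rightarrow> nat) \<Rightarrow> real vec \<Rightarrow> real" where
  "mon d e x = (\<Prod>j<d. (x $ j) ^ e j)"

lemma integrable_mon: "integrable (std_gaussian d) (mon d e)"
  unfolding mon_def by (rule std_gaussian_prod) (rule integrable_std_normal_power)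

lemma integral_mon: "(\<integral>g. mon d e g \<partial>std_gaussian d) = (\<Prod>j<d. \<integral>x. x ^ e j \<partial>std_normal)"
  unfolding mon_def by (rule std_gaussian_prod) (rule integrable_std_normal_power)

lemma coord_mon: "j < d \<Longrightarrow> x $ j * mon d e x = mon d (e(j := Suc (e j))) x"
  by (simp add: mon_def prod.remove[of "{..<d}" j] mult.assoc)

lemma mon_0: "mon d (\<lambda>_. 0) x = 1"
  by (simp add: mon_def)

lemma stein_mon:
  assumes "a < d"
  shows "(\<integral>g. g $ a * mon d e g \<partial>std_gaussian d)
    = real (e a) * (\<integral>g. mon d (e(a := e a - 1)) g \<partial>std_gaussian d)"
proof -
  have "(\<integral>g. g $ a * mon d e g \<partial>std_gaussian d)
      = (\<integral>x. x ^ Suc (e a) \<partial>std_normal) * (\<Prod>j\<in>{..<d} - {a}. \<integral>x. x ^ e j \<partial>std_normal)"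
    using assms by (simp add: coord_mon integral_mon prod.remove[of "{..<d}" a])
  also have "\<dots> = real (e a) * (\<integral>g. mon d (e(a := e a - 1)) g \<partial>std_gaussian d)"
    using assms unfolding integral_std_normal_power_Suc
    by (simp add: integral_mon prod.remove[of "{..<d}" a])
  finally show ?thesis .
qed

text \<open>\<open>F\<close> is a polynomial function with gradient \<open>F'\<close>, both considered on \<open>carrier_vec d\<close> only.\<close>

inductive poly_grad :: "nat \<Rightarrow> (real vec \<Rightarrow> real) \<Rightarrow> (nat \<Rightarrow> real vec \<Rightarrow> real) \<Rightarrow> bool" for d where
  const: "poly_grad d (\<lambda>_. c) (\<lambda>_ _. 0)"
| coord: "poly_grad d F F' \<Longrightarrow> j < d \<Longrightarrow>
    poly_grad d (\<lambda>x. x $ j * F x) (\<lambda>a x. (if a = j then F x else 0) + x $ j * F' a x)"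
| add: "poly_grad d F F' \<Longrightarrow> poly_grad d H H' \<Longrightarrow>
    poly_grad d (\<lambda>x. F x + H x) (\<lambda>a x. F' a x + H' a x)"
| cong: "poly_grad d F F' \<Longrightarrow> (\<And>x. x \<in> carrier_vec d \<Longrightarrow> H x = F x) \<Longrightarrow>
    (\<And>a x. a < d \<Longrightarrow> x \<in> carrier_vec d \<Longrightarrow> H' a x = F' a x) \<Longrightarrow> poly_grad d H H'"

text \<open>The monomial factor is the induction strengthening: in the \<open>coord\<close> case the
  extra coordinate moves from \<open>F\<close> into the exponent vector, and the hypothesis, holding
  for all \<open>e\<close>, absorbs it.\<close>

lemma poly_grad_integrable_mon:
  assumes "poly_grad d F F'"
  shows "integrable (std_gaussian d) (\<lambda>x. mon d e x * F x)"
    and "a < d \<Longrightarrow> integrable (std_gaussian d) (\<lambda>x. mon d e x * F' a x)"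
  using assms
proof (induction arbitrary: e and e a)
  case (const c)
  { case 1 show ?case using integrable_mon by simp }
  { case 2 show ?case by simp }
next
  case (coord F F' j)
  have eq: "mon d e x * (x $ j * y) = mon d (e(j := Suc (e j))) x * y" for e x y
    using coord_mon[OF \<open>j < d\<close>, of x e] by (simp add: ac_simps)
  { case 1 show ?case unfolding eq by (rule coord.IH) }
  { case 2
    have "integrable (std_gaussian d) (\<lambda>x. mon d e x * (if a = j then F x else 0))"
      using coord.IH(1)[of e] by (cases "a = j") auto
    then show ?case unfolding distrib_left eq
      by (rule Bochner_Integration.integrable_add) (rule coord.IH(2)[OF 2]) }
next
  case (add F F' H H')
  { case 1 show ?case unfolding distrib_left by (intro Bochner_Integration.integrable_add add.IH) }
  { case 2 show ?case unfolding distrib_left by (intro Bochner_Integration.integrable_add add.IH 2) }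
next
  case (cong F F' H H')
  { case 1
    show ?case
      by (rule Bochner_Integration.integrable_cong[THEN iffD1, OF refl _ cong.IH(1)[of e]])
         (simp add: cong.hyps) }
  { case 2
    show ?case
      by (rule Bochner_Integration.integrable_cong[THEN iffD1, OF refl _ cong.IH(2)[OF 2, of e]])
         (simp add: cong.hyps 2) }
qed

lemma poly_grad_integrable:
  assumes "poly_grad d F F'"
  shows "integrable (std_gaussian d) F" and "a < d \<Longrightarrow> integrable (std_gaussian d) (F' a)"
  using poly_grad_integrable_mon[OF assms, where e = "\<lambda>_. 0"] by (simp_all add: mon_0)

text \<open>Again a monomial is carried along: \<open>coord\<close> only trades a coordinate of
  \<open>F\<close> for one of the monomial, so the induction rests on the constant case, where
  \<open>stein_mon\<close> reduces everything to one dimension.\<close>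

lemma stein_mon_mult:
  assumes "poly_grad d F F'" "a < d"
  shows "(\<integral>g. g $ a * mon d e g * F g \<partial>std_gaussian d)
    = real (e a) * (\<integral>g. mon d (e(a := e a - 1)) g * F g \<partial>std_gaussian d)
      + (\<integral>g. mon d e g * F' a g \<partial>std_gaussian d)"
  using assms(1)
proof (induction arbitrary: e)
  case (const c)
  show ?case
    by (simp only: integral_mult_left_zero stein_mon[OF \<open>a < d\<close>] mult_zero_right
        Bochner_Integration.integral_zero add_0_right)
next
  case (coord F F' j)
  note int = poly_grad_integrable_mon[OF coord.hyps(1)]
  let ?e = "e(j := Suc (e j))"
  have eq: "mon d e x * (x $ j * y) = mon d (e(j := Suc (e j))) x * y" for e x y
    using coord_mon[OF \<open>j < d\<close>, of x e] by (simp add: ac_simps)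
  have "(\<integral>g. g $ a * mon d e g * (g $ j * F g) \<partial>std_gaussian d)
      = (\<integral>g. g $ a * mon d ?e g * F g \<partial>std_gaussian d)"
    unfolding mult.assoc eq ..
  also have "\<dots> = real (?e a) * (\<integral>g. mon d (?e(a := ?e a - 1)) g * F g \<partial>std_gaussian d)
      + (\<integral>g. mon d ?e g * F' a g \<partial>std_gaussian d)"
    by (rule coord.IH)
  \<comment> \<open>For a = j the exponent \<open>e j + 1\<close> splits: \<open>e j\<close> belongs
    to the monomial, 1 is the derivative of the factor \<open>g $ j\<close>.\<close>
  also have "real (?e a) * (\<integral>g. mon d (?e(a := ?e a - 1)) g * F g \<partial>std_gaussian d)
     = real (e a) * (\<integral>g. mon d (e(a := e a - 1)) g * (g $ j * F g) \<partial>std_gaussian d)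
       + (\<integral>g. mon d e g * (if a = j then F g else 0) \<partial>std_gaussian d)"
  proof (cases "a = j")
    case True
    then show ?thesis unfolding eq by (cases "e j") (auto simp: algebra_simps fun_upd_idem)
  next
    case False
    then show ?thesis unfolding eq by (simp add: fun_upd_twist)
  qed
  also have "\<dots> + (\<integral>g. mon d ?e g * F' a g \<partial>std_gaussian d)
     = real (e a) * (\<integral>g. mon d (e(a := e a - 1)) g * (g $ j * F g) \<partial>std_gaussian d)
      + (\<integral>g. mon d e g * ((if a = j then F g else 0) + g $ j * F' a g) \<partial>std_gaussian d)"
  proof -
    have "integrable (std_gaussian d) (\<lambda>g. mon d e g * (if a = j then F g else 0))"
      using int(1)[of e] by (cases "a = j") auto
    from Bochner_Integration.integral_add[OF this int(2)[OF \<open>a < d\<close>, of ?e]]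
    show ?thesis unfolding distrib_left eq by simp
  qed
  finally show ?case .
next
  case (add F F' H H')
  note iF = poly_grad_integrable_mon[OF add.hyps(1)]
  note iH = poly_grad_integrable_mon[OF add.hyps(2)]
  have 1: "(\<integral>g. g $ a * mon d e g * (F g + H g) \<partial>std_gaussian d)
     = (\<integral>g. g $ a * mon d e g * F g \<partial>std_gaussian d) + (\<integral>g. g $ a * mon d e g * H g \<partial>std_gaussian d)"
    unfolding distrib_left coord_mon[OF \<open>a < d\<close>]
    by (rule Bochner_Integration.integral_add) (rule iF iH)+
  have 2: "(\<integral>g. mon d e g * (F g + H g) \<partial>std_gaussian d)
     = (\<integral>g. mon d e g * F g \<partial>std_gaussian d) + (\<integral>g. mon d e g * H g \<partial>std_gaussian d)" for e
    unfolding distrib_left by (rule Bochner_Integration.integral_add) (rule iF iH)+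
  have 3: "(\<integral>g. mon d e g * (F' a g + H' a g) \<partial>std_gaussian d)
     = (\<integral>g. mon d e g * F' a g \<partial>std_gaussian d) + (\<integral>g. mon d e g * H' a g \<partial>std_gaussian d)"
    unfolding distrib_left by (rule Bochner_Integration.integral_add) (rule iF iH \<open>a < d\<close>)+
  show ?case unfolding 1 2 3 add.IH by (simp only: distrib_left add_ac)
next
  case (cong F F' H H')
  have "(\<integral>g. g $ a * mon d e g * H g \<partial>std_gaussian d) = (\<integral>g. g $ a * mon d e g * F g \<partial>std_gaussian d)"
    "(\<integral>g. mon d (e(a := e a - 1)) g * H g \<partial>std_gaussian d)
      = (\<integral>g. mon d (e(a := e a - 1)) g * F g \<partial>std_gaussian d)"
    "(\<integral>g. mon d e g * H' a g \<partial>std_gaussian d) = (\<integral>g. mon d e g * F' a g \<partial>std_gaussian d)"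
    using cong.hyps \<open>a < d\<close> by (auto intro!: Bochner_Integration.integral_cong)
  then show ?case using cong.IH[of e] by (simp only:)
qed

lemma stein:
  assumes "poly_grad d F F'" "a < d"
  shows "(\<integral>g. g $ a * F g \<partial>std_gaussian d) = (\<integral>g. F' a g \<partial>std_gaussian d)"
  using stein_mon_mult[OF assms, of "\<lambda>_. 0"] by (simp add: mon_0)

section \<open>Closure of polynomial functions under the rules of differentiation\<close>

lemma poly_grad_cmult: "poly_grad d F F' \<Longrightarrow> poly_grad d (\<lambda>x. c * F x) (\<lambda>a x. c * F' a x)"
proof (induction rule: poly_grad.induct)
  case (const c')
  show ?case using poly_grad.const[of d "c * c'"] by simp
next
  case (coord F F' j)
  show ?case by (rule poly_grad.cong[OF poly_grad.coord[OF coord.IH \<open>j < d\<close>]]) (auto simp: algebra_simps)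
next
  case (add F F' H H')
  show ?case by (rule poly_grad.cong[OF poly_grad.add[OF add.IH]]) (auto simp: algebra_simps)
next
  case (cong F F' H H')
  show ?case by (rule poly_grad.cong[OF cong.IH]) (auto simp: cong.hyps)
qed

lemma poly_grad_mult:
  assumes H: "poly_grad d H H'"
  shows "poly_grad d F F' \<Longrightarrow>
    poly_grad d (\<lambda>x. F x * H x) (\<lambda>a x. F' a x * H x + F x * H' a x)"
proof (induction rule: poly_grad.induct)
  case (const c')
  show ?case using poly_grad_cmult[OF H, of c'] by simp
next
  case (coord F F' j)
  show ?case by (rule poly_grad.cong[OF poly_grad.coord[OF coord.IH \<open>j < d\<close>]]) (auto simp: algebra_simps)
next
  case (add F F' H H')
  show ?case by (rule poly_grad.cong[OF poly_grad.add[OF add.IH]]) (auto simp: algebra_simps)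
next
  case (cong F F' H H')
  show ?case by (rule poly_grad.cong[OF cong.IH]) (auto simp: cong.hyps)
qed

lemma poly_grad_sum:
  "finite I \<Longrightarrow> (\<And>i. i \<in> I \<Longrightarrow> poly_grad d (F i) (F' i)) \<Longrightarrow>
    poly_grad d (\<lambda>x. \<Sum>i\<in>I. F i x) (\<lambda>a x. \<Sum>i\<in>I. F' i a x)"
proof (induction rule: finite_induct)
  case empty
  show ?case using poly_grad.const[of d 0] by simp
next
  case (insert i I)
  then show ?case by (auto intro!: poly_grad.add)
qed

lemma poly_grad_coord: "j < d \<Longrightarrow> poly_grad d (\<lambda>x. x $ j) (\<lambda>a x. if a = j then 1 else 0)"
  by (rule poly_grad.cong[OF poly_grad.coord[OF poly_grad.const[of d 1]]]) auto

lemma poly_grad_linear: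
  shows "poly_grad d (\<lambda>x. w \<bullet> x) (\<lambda>a x. w $ a)"
proof -
  have "poly_grad d (\<lambda>x. \<Sum>j<d. w $ j * x $ j) (\<lambda>a x. \<Sum>j<d. w $ j * (if a = j then 1 else 0))"
    by (intro poly_grad_sum poly_grad_cmult poly_grad_coord) auto
  then show ?thesis
    by (rule poly_grad.cong) (auto simp: scalar_prod_sum if_distrib cong: if_cong)
qed

lemma poly_grad_mon:
  "poly_grad d (mon d e) (\<lambda>a x. real (e a) * mon d (e(a := e a - 1)) x)"
proof (induction "\<Sum>j<d. e j" arbitrary: e)
  case 0
  then have "e j = 0" if "j < d" for j using that by simp
  then show ?case
    by (intro poly_grad.cong[OF poly_grad.const[of d 1]]) (auto simp: mon_def)
next
  case (Suc s)
  from Suc.hyps(2) have "\<exists>j<d. e j \<noteq> 0"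
    by (metis Zero_not_Suc lessThan_iff sum.neutral)
  then obtain j where j: "j < d" "e j \<noteq> 0" by blast
  define e' where "e' = e(j := e j - 1)"
  have e: "e = e'(j := Suc (e' j))" using j by (auto simp: e'_def)
  have "(\<Sum>i<d. e i) = Suc (\<Sum>i<d. e' i)"
    unfolding e using j(1) by (simp add: sum.remove[of "{..<d}" j])
  then have IH: "poly_grad d (mon d e') (\<lambda>a x. real (e' a) * mon d (e'(a := e' a - 1)) x)"
    using Suc by simp
  show ?case
  proof (rule poly_grad.cong[OF poly_grad.coord[OF IH j(1)]])
    fix x :: "real vec"
    show "mon d e x = x $ j * mon d e' x" using coord_mon[OF j(1), of x e'] e by simp
  next
    fix a x
    show "real (e a) * mon d (e(a := e a - 1)) x
      = (if a = j then mon d e' x else 0) + x $ j * (real (e' a) * mon d (e'(a := e' a - 1)) x)"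
    proof (cases "a = j")
      case True
      then have "x $ j * mon d (e'(a := e' a - 1)) x = mon d e' x" if "e' j \<noteq> 0"
        using coord_mon[OF j(1), of x "e'(j := e' j - 1)"] that by simp
      then have "x $ j * (real (e' j) * mon d (e'(j := e' j - 1)) x) = real (e' j) * mon d e' x"
        using True by (cases "e' j = 0") (auto simp: mult.left_commute)
      moreover have "real (e j) = 1 + real (e' j)" using e by (metis fun_upd_same of_nat_Suc)
      ultimately show ?thesis
        by (simp only: True e'_def[symmetric] distrib_right mult_1) simp
    next
      case False
      have "x $ j * mon d (e'(a := e' a - 1)) x = mon d (e(a := e a - 1)) x"
        using coord_mon[OF j(1), of x "e'(a := e' a - 1)"] False e
        by (metis fun_upd_other fun_upd_twist)
      then show ?thesis using False by (simp add: e'_def mult.left_commute)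
    qed
  qed
qed

section \<open>Hermite polynomials along a direction\<close>

text \<open>The probabilists' normalization: leading coefficient 1, derivative k He_(k-1), and
  squared norm k! under the standard normal law.\<close>

fun hermite :: "nat \<Rightarrow> real \<Rightarrow> real" where
  "hermite 0 x = 1"
| "hermite (Suc 0) x = x"
| "hermite (Suc (Suc k)) x = x * hermite (Suc k) x - real (Suc k) * hermite k x"

lemma hermite_Suc: "hermite (Suc k) x = x * hermite k x - real k * hermite (k - 1) x"
  by (cases k) auto

lemma poly_grad_hermite:
  "poly_grad d (\<lambda>x. hermite k (v \<bullet> x)) (\<lambda>a x. real k * hermite (k - 1) (v \<bullet> x) * v $ a)"
proof (induction k rule: induct_nat_012)
  case 0
  show ?case by (rule poly_grad.cong[OF poly_grad.const[of d 1]]) auto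
next
  case 1
  show ?case by (rule poly_grad.cong[OF poly_grad_linear[of d v]]) auto
next
  case (ge2 k)
  show ?case
  proof (rule poly_grad.cong[OF poly_grad.add[OF poly_grad_mult[OF ge2(2) poly_grad_linear[of d v]]
        poly_grad_cmult[OF ge2(1), of "- real (Suc k)"]]])
    fix x :: "real vec"
    show "hermite (Suc (Suc k)) (v \<bullet> x)
      = v \<bullet> x * hermite (Suc k) (v \<bullet> x) + - real (Suc k) * hermite k (v \<bullet> x)"
      by (simp add: algebra_simps)
  next
    fix a x
    show "real (Suc (Suc k)) * hermite (Suc (Suc k) - 1) (v \<bullet> x) * v $ a
     = v $ a * hermite (Suc k) (v \<bullet> x)
       + v \<bullet> x * (real (Suc k) * hermite (Suc k - 1) (v \<bullet> x) * v $ a)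
       + - real (Suc k) * (real k * hermite (k - 1) (v \<bullet> x) * v $ a)"
      \<comment> \<open>Read backwards, the recurrence turns the last two summands into (k + 1)
        He_(k+1); the first summand supplies the missing copy.\<close>
      unfolding diff_Suc_1 hermite_Suc[of k] by (simp add: algebra_simps)
  qed
qed

section \<open>Hermite polynomials as adjoints of directional derivatives\<close>

lemma stein_direction:
  assumes F: "poly_grad d F F'"
  shows "(\<integral>g. (v \<bullet> g) * F g \<partial>std_gaussian d) = (\<Sum>a<d. v $ a * (\<integral>g. F' a g \<partial>std_gaussian d))"
proof -
  have "(\<integral>g. (v \<bullet> g) * F g \<partial>std_gaussian d) = (\<integral>g. (\<Sum>a<d. v $ a * (g $ a * F g)) \<partial>std_gaussian d)"
    by (intro Bochner_Integration.integral_cong) (auto simp: scalar_prod_sum sum_distrib_right mult.assoc)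
  also have "\<dots> = (\<Sum>a<d. v $ a * (\<integral>g. g $ a * F g \<partial>std_gaussian d))"
    by (subst Bochner_Integration.integral_sum)
       (auto intro!: integrable_mult_right poly_grad_integrable[OF poly_grad.coord[OF F]])
  also have "\<dots> = (\<Sum>a<d. v $ a * (\<integral>g. F' a g \<partial>std_gaussian d))"
    by (intro sum.cong) (auto simp: stein[OF F])
  finally show ?thesis .
qed

text \<open>In He_(k+1) = x He_k - k He_(k-1), Stein's identity applied to x He_k F differentiates
  \<open>F\<close> and also He_k; since |v| = 1, the second term cancels k He_(k-1). This lowering
  step, trading a degree of the Hermite polynomial for a derivative of \<open>F\<close> along
  \<open>v\<close>, drives every Hermite computation below.\<close>

lemma integral_mult_hermite_Suc:
  assumes F: "poly_grad d F F'" and v: "v \<in> carrier_vec d" "v \<bullet> v = 1"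
  shows "(\<integral>g. F g * hermite (Suc k) (v \<bullet> g) \<partial>std_gaussian d)
    = (\<Sum>a<d. v $ a * (\<integral>g. F' a g * hermite k (v \<bullet> g) \<partial>std_gaussian d))"
proof -
  let ?E = "\<lambda>h. \<integral>g. h g \<partial>std_gaussian d"
  let ?h = "\<lambda>k g. hermite k (v \<bullet> g)"
  note FH = poly_grad_mult[OF poly_grad_hermite F]
  have iF: "integrable (std_gaussian d) (\<lambda>g. F g * ?h k g)" for k
    by (rule poly_grad_integrable[OF poly_grad_mult[OF poly_grad_hermite F]])
  \<comment> \<open>\<open>poly_grad\<close> does not say that \<open>F'\<close> is itself a
    polynomial with a gradient, so integrability is extracted from the gradient of the product,
    minus a term already known to be integrable.\<close>
  have iF': "integrable (std_gaussian d) (\<lambda>g. F' a g * ?h k g)" if "a < d" for a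
  proof -
    have "integrable (std_gaussian d)
      (\<lambda>g. (F' a g * ?h k g + F g * (real k * ?h (k - 1) g * v $ a)) - real k * v $ a * (F g * ?h (k - 1) g))"
      by (intro Bochner_Integration.integrable_diff integrable_mult_right iF
          poly_grad_integrable(2)[OF FH that])
    then show ?thesis by (simp add: algebra_simps)
  qed
  have "?E (\<lambda>g. F g * ?h (Suc k) g) = ?E (\<lambda>g. (v \<bullet> g) * (F g * ?h k g) - real k * (F g * ?h (k - 1) g))"
    by (simp add: hermite_Suc algebra_simps)
  also have "\<dots> = ?E (\<lambda>g. (v \<bullet> g) * (F g * ?h k g)) - ?E (\<lambda>g. real k * (F g * ?h (k - 1) g))"
    by (intro Bochner_Integration.integral_diff integrable_mult_right iF
        poly_grad_integrable(1)[OF poly_grad_mult[OF poly_grad_mult[OF poly_grad_hermite F] poly_grad_linear]])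
  also have "?E (\<lambda>g. (v \<bullet> g) * (F g * ?h k g))
     = (\<Sum>a<d. v $ a * ?E (\<lambda>g. F' a g * ?h k g + F g * (real k * ?h (k - 1) g * v $ a)))"
    by (rule stein_direction[OF FH])
  also have "\<dots> = (\<Sum>a<d. v $ a * (?E (\<lambda>g. F' a g * ?h k g) + real k * v $ a * ?E (\<lambda>g. F g * ?h (k - 1) g)))"
  proof (intro sum.cong refl)
    fix a assume "a \<in> {..<d}"
    have "?E (\<lambda>g. F' a g * ?h k g + F g * (real k * ?h (k - 1) g * v $ a))
      = ?E (\<lambda>g. F' a g * ?h k g + real k * v $ a * (F g * ?h (k - 1) g))"
      by (simp add: ac_simps)
    also from \<open>a \<in> {..<d}\<close> have "\<dots>
      = ?E (\<lambda>g. F' a g * ?h k g) + ?E (\<lambda>g. real k * v $ a * (F g * ?h (k - 1) g))"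
      by (intro Bochner_Integration.integral_add integrable_mult_right iF iF') auto
    also have "?E (\<lambda>g. real k * v $ a * (F g * ?h (k - 1) g)) = real k * v $ a * ?E (\<lambda>g. F g * ?h (k - 1) g)"
      by (rule integral_mult_right_zero)
    finally show "v $ a * ?E (\<lambda>g. F' a g * ?h k g + F g * (real k * ?h (k - 1) g * v $ a))
      = v $ a * (?E (\<lambda>g. F' a g * ?h k g) + real k * v $ a * ?E (\<lambda>g. F g * ?h (k - 1) g))"
      by (simp only:)
  qed
  also have "\<dots> = (\<Sum>a<d. v $ a * ?E (\<lambda>g. F' a g * ?h k g))
      + (v \<bullet> v) * (real k * ?E (\<lambda>g. F g * ?h (k - 1) g))"
    unfolding scalar_prod_sum[OF v(1)] sum_distrib_right sum.distrib[symmetric]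
    by (intro sum.cong) (auto simp: algebra_simps)
  finally show ?thesis by (simp add: v)
qed

lemma measure_std_gaussian [simp]: "measure (std_gaussian d) (carrier_vec d) = 1"
  using prob_space.prob_space[OF prob_space_std_gaussian[of d]] by simp

text \<open>The derivative of He_l(w \<bullet> g) along \<open>v\<close> is l (v \<bullet> w)
  He_(l-1)(w \<bullet> g), so each lowering step costs a factor l (v \<bullet> w). Two directions
  are treated at once because the second moment pairs the ratios of independent \<open>v\<close> and
  \<open>w\<close>.\<close>

lemma hermite_orthogonal:
  assumes v: "v \<in> carrier_vec d" "v \<bullet> v = 1" and w: "w \<in> carrier_vec d" "w \<bullet> w = 1"
  shows "(\<integral>g. hermite l (w \<bullet> g) * hermite k (v \<bullet> g) \<partial>std_gaussian d)
    = (if k = l then fact k * (v \<bullet> w) ^ k else 0)"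
proof (induction k arbitrary: l)
  case 0
  show ?case
  proof (cases l)
    case 0
    then show ?thesis by (simp)
  next
    case (Suc l')
    have "(\<integral>g. 1 * hermite (Suc l') (w \<bullet> g) \<partial>std_gaussian d) = 0"
      by (subst integral_mult_hermite_Suc[OF poly_grad.const w]) simp
    then show ?thesis using Suc by simp
  qed
next
  case (Suc k)
  have "(\<integral>g. hermite l (w \<bullet> g) * hermite (Suc k) (v \<bullet> g) \<partial>std_gaussian d)
      = (\<Sum>a<d. v $ a * (\<integral>g. real l * hermite (l - 1) (w \<bullet> g) * w $ a * hermite k (v \<bullet> g) \<partial>std_gaussian d))"
    by (rule integral_mult_hermite_Suc[OF poly_grad_hermite v])
  also have "\<dots> = (\<Sum>a<d. v $ a * w $ a * (real l *
        (\<integral>g. hermite (l - 1) (w \<bullet> g) * hermite k (v \<bullet> g) \<partial>std_gaussian d)))"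
  proof (intro sum.cong refl)
    fix a
    have "(\<integral>g. real l * hermite (l - 1) (w \<bullet> g) * w $ a * hermite k (v \<bullet> g) \<partial>std_gaussian d)
      = (\<integral>g. (real l * w $ a) * (hermite (l - 1) (w \<bullet> g) * hermite k (v \<bullet> g)) \<partial>std_gaussian d)"
      by (simp add: ac_simps)
    then show "v $ a * (\<integral>g. real l * hermite (l - 1) (w \<bullet> g) * w $ a * hermite k (v \<bullet> g) \<partial>std_gaussian d)
       = v $ a * w $ a * (real l * (\<integral>g. hermite (l - 1) (w \<bullet> g) * hermite k (v \<bullet> g) \<partial>std_gaussian d))"
      by simp
  qed
  also have "\<dots> = (v \<bullet> w) * (real l * (if k = l - 1 then fact k * (v \<bullet> w) ^ k else 0))"
    by (simp add: Suc sum_distrib_right[symmetric] scalar_prod_sum[OF w(1)])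
  also have "\<dots> = (if Suc k = l then fact (Suc k) * (v \<bullet> w) ^ Suc k else 0)"
    by (cases l) (auto simp: algebra_simps)
  finally show ?case .
qed

lemma integral_mon_hermite_Suc:
  assumes v: "v \<in> carrier_vec d" "v \<bullet> v = 1"
  shows "(\<integral>g. mon d e g * hermite (Suc k) (v \<bullet> g) \<partial>std_gaussian d)
    = (\<Sum>a<d. v $ a * (real (e a) * (\<integral>g. mon d (e(a := e a - 1)) g * hermite k (v \<bullet> g) \<partial>std_gaussian d)))"
  unfolding integral_mult_hermite_Suc[OF poly_grad_mon v] mult.assoc integral_mult_right_zero ..

text \<open>Each lowering step takes one degree off the monomial, which is exhausted before the
  Hermite polynomial is. This is what truncates the expansion against polynomials of degree at most
  D.\<close>

lemma integral_mon_hermite_eq_0: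
  assumes v: "v \<in> carrier_vec d" "v \<bullet> v = 1"
  shows "(\<Sum>j<d. e j) < k \<Longrightarrow> (\<integral>g. mon d e g * hermite k (v \<bullet> g) \<partial>std_gaussian d) = 0"
proof (induction k arbitrary: e)
  case (Suc k)
  show ?case unfolding integral_mon_hermite_Suc[OF v]
  proof (intro sum.neutral ballI)
    fix a assume a: "a \<in> {..<d}"
    show "v $ a * (real (e a) * (\<integral>g. mon d (e(a := e a - 1)) g * hermite k (v \<bullet> g) \<partial>std_gaussian d)) = 0"
    proof (cases "e a = 0")
      case False
      have "(\<Sum>j<d. e j) = Suc (\<Sum>j<d. (e(a := e a - 1)) j)"
        using a False by (simp add: sum.remove[of "{..<d}" a])
      then have "(\<Sum>j<d. (e(a := e a - 1)) j) < k" using Suc.prems by simp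
      from Suc.IH[OF this] show ?thesis by (simp only: mult_zero_right)
    qed simp
  qed
qed simp

text \<open>For unit \<open>v\<close> and standard Gaussian \<open>g\<close>, \<open>spike m s v g\<close> has the law \<open>N(m, s\<^sup>2)\<close> along \<open>v\<close> and is
  standard Gaussian orthogonally to \<open>v\<close>.\<close>

definition spike :: "real \<Rightarrow> real \<Rightarrow> real vec \<Rightarrow> real vec \<Rightarrow> real vec" where
  "spike m s v g = g + (m + (s - 1) * (v \<bullet> g)) \<cdot>\<^sub>v v"

lemma spike_carrier [simp]: "v \<in> carrier_vec d \<Longrightarrow> g \<in> carrier_vec d \<Longrightarrow> spike m s v g \<in> carrier_vec d"
  by (simp add: spike_def)

lemma spike_index: "v \<in> carrier_vec d \<Longrightarrow> g \<in> carrier_vec d \<Longrightarrow> j < d \<Longrightarrow>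
   spike m s v g $ j = g $ j + (m + (s - 1) * (v \<bullet> g)) * v $ j"
  by (simp add: spike_def)

text \<open>Chain rule: \<open>spike m s v\<close> is affine with the symmetric Jacobian I + (s - 1)
  v v^T.\<close>

lemma poly_grad_spike:
  assumes v: "v \<in> carrier_vec d"
  shows "poly_grad d F F' \<Longrightarrow> poly_grad d (\<lambda>g. F (spike m s v g))
    (\<lambda>a g. \<Sum>b<d. ((if a = b then 1 else 0) + (s - 1) * v $ a * v $ b) * F' b (spike m s v g))"
proof (induction rule: poly_grad.induct)
  case (const c)
  show ?case using poly_grad.const[of d c] by simp
next
  case (coord F F' j)
  let ?A = "\<lambda>a b. (if a = b then 1 else 0) + (s - 1) * v $ a * v $ b"
  have L: "poly_grad d (\<lambda>g. g $ j + (m * v $ j + (s - 1) * v $ j * (v \<bullet> g)))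
      (\<lambda>a g. (if a = j then 1 else 0) + (0 + (s - 1) * v $ j * v $ a))"
    using \<open>j < d\<close>
    by (intro poly_grad.add poly_grad_coord poly_grad.const poly_grad_cmult poly_grad_linear)
  show ?case
  proof (rule poly_grad.cong[OF poly_grad_mult[OF coord.IH L]])
    fix g :: "real vec" assume g: "g \<in> carrier_vec d"
    then have sj: "spike m s v g $ j = g $ j + (m * v $ j + (s - 1) * v $ j * (v \<bullet> g))"
      using v \<open>j < d\<close> by (simp add: spike_index algebra_simps)
    then show "spike m s v g $ j * F (spike m s v g)
       = (g $ j + (m * v $ j + (s - 1) * v $ j * (v \<bullet> g))) * F (spike m s v g)" by simp
    fix a assume "a < d"
    have "(\<Sum>b<d. ?A a b * ((if b = j then F (spike m s v g) else 0) + spike m s v g $ j * F' b (spike m s v g)))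
       = (\<Sum>b<d. if b = j then ?A a b * F (spike m s v g) else 0)
         + spike m s v g $ j * (\<Sum>b<d. ?A a b * F' b (spike m s v g))"
      unfolding sum_distrib_left sum.distrib[symmetric]
      by (intro sum.cong) (auto simp: algebra_simps)
    also have "(\<Sum>b<d. if b = j then ?A a b * F (spike m s v g) else 0) = ?A a j * F (spike m s v g)"
      using \<open>j < d\<close> by simp
    finally show "(\<Sum>b<d. ?A a b * ((if b = j then F (spike m s v g) else 0)
          + spike m s v g $ j * F' b (spike m s v g)))
      = ((if a = j then 1 else 0) + (0 + (s - 1) * v $ j * v $ a)) * F (spike m s v g)
        + (g $ j + (m * v $ j + (s - 1) * v $ j * (v \<bullet> g))) * (\<Sum>b<d. ?A a b * F' b (spike m s v g))"
      by (simp add: sj ac_simps)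
  qed
next
  case (add F F' H H')
  show ?case
    by (rule poly_grad.cong[OF poly_grad.add[OF add.IH]])
       (auto simp: distrib_left sum.distrib)
next
  case (cong F F' H H')
  show ?case
    by (rule poly_grad.cong[OF cong.IH]) (auto simp: cong.hyps v)
qed

text \<open>The expectation of \<open>He\<^sub>k\<close> under \<open>N(m, s\<^sup>2)\<close>, given by the recurrence that Stein's identity yields.\<close>

fun hermite_coeff :: "real \<Rightarrow> real \<Rightarrow> nat \<Rightarrow> real" where
  "hermite_coeff m s 0 = 1"
| "hermite_coeff m s (Suc 0) = m"
| "hermite_coeff m s (Suc (Suc k)) = m * hermite_coeff m s (Suc k) + (s\<^sup>2 - 1) * real (Suc k) * hermite_coeff m s k"

lemma hermite_coeff_Suc:
  "hermite_coeff m s (Suc k) = m * hermite_coeff m s k + (s\<^sup>2 - 1) * real k * hermite_coeff m s (k - 1)"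
  by (cases k) auto

text \<open>The recurrence of \<open>hermite_coeff\<close> under a sum, where k/k! = 1/(k-1)! shifts
  the index. It is applied with \<open>\<rho> k\<close> the pairing of a monomial with He_k, which
  vanishes above the degree.\<close>

lemma hermite_coeff_sum:
  fixes \<rho> :: "nat \<Rightarrow> real" and m s :: real
  assumes \<rho>: "\<And>k. k > N \<Longrightarrow> \<rho> k = 0"
  defines "c \<equiv> hermite_coeff m s"
  shows "(\<Sum>k\<le>Suc N. c k / fact k * (real k * \<rho> (k - 1)))
    = m * (\<Sum>k\<le>N. c k / fact k * \<rho> k) + (s\<^sup>2 - 1) * (\<Sum>k\<le>Suc N. c k / fact k * \<rho> (Suc k))"
proof -
  let ?f = "\<lambda>k. c (k - 1) / fact k * (real k * \<rho> k)"
  have cancel: "x * (real (Suc k) * y) / fact (Suc k) = x * y / fact k" for x y :: real and k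
    by (simp add: fact_Suc divide_simps del: of_nat_Suc)
  have "(\<Sum>k\<le>Suc N. c k / fact k * (real k * \<rho> (k - 1))) = (\<Sum>k\<le>N. c (Suc k) / fact k * \<rho> k)"
    by (subst sum.atMost_Suc_shift) (simp add: cancel del: fact_Suc of_nat_Suc)
  also have "\<dots> = m * (\<Sum>k\<le>N. c k / fact k * \<rho> k) + (s\<^sup>2 - 1) * (\<Sum>k\<le>N. ?f k)"
    unfolding sum_distrib_left sum.distrib[symmetric] c_def hermite_coeff_Suc
    by (intro sum.cong refl) (simp add: field_simps)
  \<comment> \<open>The two added terms vanish with \<rho>; they make the following shift end at
    \<open>Suc N\<close>.\<close>
  also have "(\<Sum>k\<le>N. ?f k) = (\<Sum>k\<le>Suc (Suc N). ?f k)"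
    using \<rho>[of "Suc N"] \<rho>[of "Suc (Suc N)"] by simp
  also have "\<dots> = (\<Sum>k\<le>Suc N. c k / fact k * \<rho> (Suc k))"
    by (subst sum.atMost_Suc_shift) (simp add: cancel del: fact_Suc of_nat_Suc)
  finally show ?thesis .
qed

lemma integrable_mon_spike:
  "v \<in> carrier_vec d \<Longrightarrow> integrable (std_gaussian d) (\<lambda>g. mon d e (spike m s v g))"
  by (rule poly_grad_integrable[OF poly_grad_spike[OF _ poly_grad_mon]])

lemma integrable_mon_hermite: "integrable (std_gaussian d) (\<lambda>g. mon d e g * hermite k (v \<bullet> g))"
  by (rule poly_grad_integrable[OF poly_grad_mult[OF poly_grad_hermite poly_grad_mon]])

text \<open>Both sides obey the same recursion when one coordinate is taken off the monomial: the
  left by Stein's identity for the composition with \<open>spike\<close>, the right by Stein's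
  identity for monomial times Hermite polynomial. On polynomials, N(m, s^2) along \<open>v\<close>
  thus acts as the series of (c_k/k!) He_k(v \<bullet> g), c_k being
  \<open>hermite_coeff m s k\<close>.\<close>

lemma integral_mon_spike:
  assumes v: "v \<in> carrier_vec d" "v \<bullet> v = 1"
  shows "(\<Sum>j<d. e j) \<le> N \<Longrightarrow> (\<integral>g. mon d e (spike m s v g) \<partial>std_gaussian d)
    = (\<Sum>k\<le>N. hermite_coeff m s k / fact k * (\<integral>g. mon d e g * hermite k (v \<bullet> g) \<partial>std_gaussian d))"
proof (induction "\<Sum>j<d. e j" arbitrary: e N rule: less_induct)
  case less
  let ?E = "\<lambda>h. \<integral>g. h g \<partial>std_gaussian d"
  let ?c = "\<lambda>k. hermite_coeff m s k / fact k"
  show ?case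
  proof (cases "\<exists>j<d. e j \<noteq> 0")
    case False
    then have e: "(\<Sum>j<d. e j) = 0" and 1: "mon d e = (\<lambda>_. 1)" by (auto simp: mon_def fun_eq_iff)
    have "(\<Sum>k\<le>N. ?c k * ?E (\<lambda>g. mon d e g * hermite k (v \<bullet> g)))
      = (\<Sum>k\<le>N. if k = 0 then 1 else 0)"
    proof (intro sum.cong refl)
      fix k
      show "?c k * ?E (\<lambda>g. mon d e g * hermite k (v \<bullet> g)) = (if k = 0 then 1 else 0)"
        using integral_mon_hermite_eq_0[OF v, of e k] e
        by (cases k) (auto simp: 1)
    qed
    then show ?thesis by (simp add: 1)
  next
    case True
    then obtain j where j: "j < d" "e j \<noteq> 0" by blast
    define e' where "e' = e(j := e j - 1)"
    define N' where "N' = N - 1"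
    define F where "F = mon d e'"
    define F' where "F' = (\<lambda>a x. real (e' a) * mon d (e'(a := e' a - 1)) x)"
    have e: "e = e'(j := Suc (e' j))" using j by (auto simp: e'_def)
    have deg: "(\<Sum>i<d. e i) = Suc (\<Sum>i<d. e' i)"
      unfolding e using j(1) by (simp add: sum.remove[of "{..<d}" j])
    then have N: "N = Suc N'" and N': "(\<Sum>i<d. e' i) \<le> N'" using less.prems by (auto simp: N'_def)
    have F: "poly_grad d F F'" unfolding F_def F'_def by (rule poly_grad_mon)
    define \<Phi> where "\<Phi> g = F (spike m s v g)" for g
    define \<Phi>' where "\<Phi>' a g = (\<Sum>b<d. ((if a = b then 1 else 0) + (s - 1) * v $ a * v $ b) * F' b (spike m s v g))"
      for a g
    have \<Phi>: "poly_grad d \<Phi> \<Phi>'"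
      unfolding \<Phi>_def[abs_def] \<Phi>'_def[abs_def] by (rule poly_grad_spike[OF v(1) F])
    define t where "t b = ?E (\<lambda>g. F' b (spike m s v g))" for b
    define \<tau> where "\<tau> = (\<Sum>b<d. v $ b * t b)"
    define \<rho> where "\<rho> k = ?E (\<lambda>g. F g * hermite k (v \<bullet> g))" for k
    \<comment> \<open>Differentiation lowers the degree, so the induction hypothesis applies; the
      range stays at \<open>N\<close> to match the target sum.\<close>
    have t: "t b = (\<Sum>k\<le>N. ?c k * ?E (\<lambda>g. F' b g * hermite k (v \<bullet> g)))" if "b < d" for b
    proof (cases "e' b = 0")
      case False
      have deg': "(\<Sum>i<d. e' i) = Suc (\<Sum>i<d. (e'(b := e' b - 1)) i)"
        using that False by (simp add: sum.remove[of "{..<d}" b])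
      have "?E (\<lambda>g. mon d (e'(b := e' b - 1)) (spike m s v g))
        = (\<Sum>k\<le>N. ?c k * ?E (\<lambda>g. mon d (e'(b := e' b - 1)) g * hermite k (v \<bullet> g)))"
        using deg deg' less.prems by (intro less.hyps) auto
      then show ?thesis unfolding t_def F'_def
        by (simp add: mult.assoc sum_distrib_left mult.left_commute)
    qed (simp add: t_def F'_def)
    have E\<Phi>': "?E (\<Phi>' a) = t a + (s - 1) * v $ a * \<tau>" if "a < d" for a
    proof -
      have "?E (\<Phi>' a) = (\<Sum>b<d. ((if a = b then 1 else 0) + (s - 1) * v $ a * v $ b) * t b)"
        unfolding \<Phi>'_def t_def F'_def
        by (subst Bochner_Integration.integral_sum)
           (auto intro!: integrable_mult_right integrable_mon_spike v)
      also have "\<dots> = (\<Sum>b<d. (if a = b then t b else 0) + (s - 1) * v $ a * (v $ b * t b))"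
        by (intro sum.cong) (auto simp: algebra_simps)
      finally show ?thesis using that by (simp add: sum.distrib \<tau>_def sum_distrib_left)
    qed
    have i\<Phi>: "integrable (std_gaussian d) (\<lambda>g. g $ j * \<Phi> g)" "integrable (std_gaussian d) \<Phi>"
      "integrable (std_gaussian d) (\<lambda>g. (v \<bullet> g) * \<Phi> g)"
      by (rule poly_grad_integrable[OF poly_grad.coord[OF \<Phi> j(1)]] poly_grad_integrable[OF \<Phi>]
          poly_grad_integrable[OF poly_grad_mult[OF \<Phi> poly_grad_linear]])+
    have "?E (\<lambda>g. mon d e (spike m s v g))
        = ?E (\<lambda>g. g $ j * \<Phi> g + (m * v $ j * \<Phi> g + (s - 1) * v $ j * ((v \<bullet> g) * \<Phi> g)))"
    proof (intro Bochner_Integration.integral_cong refl)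
      fix g assume "g \<in> space (std_gaussian d)"
      then have "spike m s v g $ j = g $ j + (m + (s - 1) * (v \<bullet> g)) * v $ j"
        using v j(1) by (simp add: spike_index)
      then show "mon d e (spike m s v g)
        = g $ j * \<Phi> g + (m * v $ j * \<Phi> g + (s - 1) * v $ j * ((v \<bullet> g) * \<Phi> g))"
        unfolding e coord_mon[OF j(1), symmetric] \<Phi>_def F_def by (simp only:) (simp add: algebra_simps)
    qed
    also have "\<dots> = ?E (\<lambda>g. g $ j * \<Phi> g) + (m * v $ j * ?E \<Phi> + (s - 1) * v $ j * ?E (\<lambda>g. (v \<bullet> g) * \<Phi> g))"
      by (simp add: i\<Phi> Bochner_Integration.integral_add)
    also have "?E (\<lambda>g. g $ j * \<Phi> g) = t j + (s - 1) * v $ j * \<tau>"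
      using stein[OF \<Phi> j(1)] E\<Phi>'[OF j(1)] by simp
    also have "?E (\<lambda>g. (v \<bullet> g) * \<Phi> g) = (\<Sum>a<d. v $ a * (t a + (s - 1) * v $ a * \<tau>))"
      unfolding stein_direction[OF \<Phi>] by (intro sum.cong) (auto simp: E\<Phi>')
    also have "\<dots> = (\<Sum>a<d. v $ a * t a) + (s - 1) * \<tau> * (v \<bullet> v)"
      unfolding scalar_prod_sum[OF v(1)] sum_distrib_left sum.distrib[symmetric]
      by (intro sum.cong) (auto simp: algebra_simps)
    also have "(\<Sum>a<d. v $ a * t a) = \<tau>" by (simp add: \<tau>_def)
    also have "?E \<Phi> = (\<Sum>k\<le>N'. ?c k * \<rho> k)"
      unfolding \<Phi>_def \<rho>_def F_def using deg N' by (intro less.hyps) auto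
    \<comment> \<open>The two contributions of the Jacobian combine, by |v| = 1, to (s - 1) + (s -
      1)(1 + (s - 1)) = \<open>s\<^sup>2 - 1\<close>.\<close>
    finally have LHS: "?E (\<lambda>g. mon d e (spike m s v g))
      = t j + v $ j * (m * (\<Sum>k\<le>N'. ?c k * \<rho> k) + (s\<^sup>2 - 1) * \<tau>)"
      by (simp add: v(2) algebra_simps power2_eq_square)
    have coeff: "?E (\<lambda>g. mon d e g * hermite k (v \<bullet> g))
      = ?E (\<lambda>g. F' j g * hermite k (v \<bullet> g)) + v $ j * (real k * \<rho> (k - 1))" for k
    proof -
      have i: "integrable (std_gaussian d) (\<lambda>g. F' j g * hermite k (v \<bullet> g))"
        "integrable (std_gaussian d) (\<lambda>g. F g * hermite (k - 1) (v \<bullet> g))"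
        unfolding F_def F'_def mult.assoc by (intro integrable_mult_right integrable_mon_hermite)+
      have "?E (\<lambda>g. mon d e g * hermite k (v \<bullet> g)) = ?E (\<lambda>g. g $ j * (F g * hermite k (v \<bullet> g)))"
        using coord_mon[OF j(1), of _ e'] e by (simp add: F_def mult.assoc[symmetric])
      also have "\<dots> = ?E (\<lambda>g. F' j g * hermite k (v \<bullet> g) + F g * (real k * hermite (k - 1) (v \<bullet> g) * v $ j))"
        by (rule stein[OF poly_grad_mult[OF poly_grad_hermite F] j(1)])
      also have "\<dots> = ?E (\<lambda>g. F' j g * hermite k (v \<bullet> g) + v $ j * (real k * (F g * hermite (k - 1) (v \<bullet> g))))"
        by (simp add: ac_simps)
      also have "\<dots> = ?E (\<lambda>g. F' j g * hermite k (v \<bullet> g)) + v $ j * (real k * \<rho> (k - 1))"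
        unfolding \<rho>_def Bochner_Integration.integral_add[OF i(1)
            integrable_mult_right[OF integrable_mult_right[OF i(2)]]] integral_mult_right_zero ..
      finally show ?thesis .
    qed
    have "(\<Sum>k\<le>N. ?c k * ?E (\<lambda>g. mon d e g * hermite k (v \<bullet> g)))
      = t j + v $ j * (\<Sum>k\<le>N. ?c k * (real k * \<rho> (k - 1)))"
      unfolding coeff t[OF j(1)] sum_distrib_left sum.distrib[symmetric]
      by (intro sum.cong) (auto simp: algebra_simps)
    also have "(\<Sum>k\<le>N. ?c k * (real k * \<rho> (k - 1)))
      = m * (\<Sum>k\<le>N'. ?c k * \<rho> k) + (s\<^sup>2 - 1) * (\<Sum>k\<le>N. ?c k * \<rho> (Suc k))"
      unfolding N using N' by (intro hermite_coeff_sum) (auto simp: \<rho>_def F_def intro: integral_mon_hermite_eq_0[OF v])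
    \<comment> \<open>The lowering step turns the pairing of \<open>F\<close> with He_(k+1) into the
      pairing of its derivative along \<open>v\<close> with He_k, so the sum reassembles the values
      \<open>t b\<close>.\<close>
    also have "(\<Sum>k\<le>N. ?c k * \<rho> (Suc k)) = \<tau>"
    proof -
      have "(\<Sum>k\<le>N. ?c k * \<rho> (Suc k)) = (\<Sum>k\<le>N. \<Sum>b<d. v $ b * (?c k * ?E (\<lambda>g. F' b g * hermite k (v \<bullet> g))))"
        unfolding \<rho>_def integral_mult_hermite_Suc[OF F v] sum_distrib_left by (simp add: mult.left_commute)
      also have "\<dots> = (\<Sum>b<d. v $ b * (\<Sum>k\<le>N. ?c k * ?E (\<lambda>g. F' b g * hermite k (v \<bullet> g))))"
        unfolding sum_distrib_left by (rule sum.swap)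
      also have "\<dots> = \<tau>" unfolding \<tau>_def by (intro sum.cong) (auto simp: t)
      finally show ?thesis .
    qed
    finally show ?thesis using LHS by simp
  qed
qed

section \<open>Rank-one perturbations of the identity\<close>

definition rank_one :: "nat \<Rightarrow> real \<Rightarrow> real vec \<Rightarrow> real mat" where
  "rank_one d c v = mat d d (\<lambda>(i, j). (if i = j then 1 else 0) + c * v $ i * v $ j)"

lemma rank_one_carrier [simp]: "rank_one d c v \<in> carrier_mat d d"
  by (simp add: rank_one_def)

lemma rank_one_transpose [simp]: "transpose_mat (rank_one d c v) = rank_one d c v"
  by (intro eq_matI) (auto simp: rank_one_def)

lemma rank_one_mult_vec:
  assumes "v \<in> carrier_vec d" "x \<in> carrier_vec d"
  shows "rank_one d c v *\<^sub>v x = x + (c * (v \<bullet> x)) \<cdot>\<^sub>v v"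
proof (rule eq_vecI)
  fix i assume "i < dim_vec (x + (c * (v \<bullet> x)) \<cdot>\<^sub>v v)"
  then have i: "i < d" using assms by simp
  then have "(rank_one d c v *\<^sub>v x) $ i = (\<Sum>j<d. ((if i = j then 1 else 0) + c * v $ i * v $ j) * x $ j)"
    using assms by (simp add: rank_one_def scalar_prod_sum[OF assms(2)])
  also have "\<dots> = (\<Sum>j<d. (if i = j then x $ j else 0) + c * v $ i * (v $ j * x $ j))"
    by (intro sum.cong) (auto simp: algebra_simps)
  also have "\<dots> = x $ i + c * v $ i * (v \<bullet> x)"
    using i by (simp add: sum.distrib sum_distrib_left[symmetric] scalar_prod_sum[OF assms(2)])
  finally show "(rank_one d c v *\<^sub>v x) $ i = (x + (c * (v \<bullet> x)) \<cdot>\<^sub>v v) $ i"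
    using i assms by simp
qed (use assms in \<open>auto simp: rank_one_def\<close>)

lemma eq_mat_vecI:
  fixes A B :: "real mat"
  assumes A: "A \<in> carrier_mat n n" and B: "B \<in> carrier_mat n n"
    and eq: "\<And>x. x \<in> carrier_vec n \<Longrightarrow> A *\<^sub>v x = B *\<^sub>v x"
  shows "A = B"
proof (rule eq_matI)
  fix i j assume ij: "i < dim_row B" "j < dim_col B"
  then have "(A *\<^sub>v unit_vec n j) $ i = (B *\<^sub>v unit_vec n j) $ i" by (simp add: eq)
  then show "A $$ (i, j) = B $$ (i, j)"
    using A B ij by simp
qed (use A B in auto)

text \<open>v v^T is idempotent, so coefficients combine as (1 + a)(1 + b) = 1 + (a + b + a b).
  Square root and inverse of the covariance therefore lie in the same family.\<close>

lemma rank_one_mult: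
  assumes v: "v \<in> carrier_vec d" "v \<bullet> v = 1"
  shows "rank_one d a v * rank_one d b v = rank_one d (a + b + a * b) v"
proof (rule eq_mat_vecI)
  fix x :: "real vec" assume x: "x \<in> carrier_vec d"
  show "rank_one d a v * rank_one d b v *\<^sub>v x = rank_one d (a + b + a * b) v *\<^sub>v x"
    using v x
    by (intro eq_vecI)
       (auto simp: assoc_mult_mat_vec[of _ d d _ d] rank_one_mult_vec scalar_prod_add_distrib[of _ d]
         algebra_simps)
qed (auto intro: mult_carrier_mat[of _ d d])

section \<open>Positivity, square root and spectrum of the rank-one family\<close>

lemma scalar_prod_self_nonneg: "(x :: real vec) \<bullet> x \<ge> 0"
  by (auto simp: scalar_prod_def intro: sum_nonneg)

lemma scalar_prod_self_eq_0:
  assumes "(x :: real vec) \<in> carrier_vec d" "x \<bullet> x = 0"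
  shows "x = 0\<^sub>v d"
proof (rule eq_vecI)
  fix i assume "i < dim_vec (0\<^sub>v d :: real vec)"
  then have "i < d" by simp
  moreover have "\<forall>i\<in>{..<d}. x $ i * x $ i = 0"
    using assms by (subst sum_nonneg_eq_0_iff[symmetric]) (auto simp: scalar_prod_sum)
  ultimately show "x $ i = 0\<^sub>v d $ i" by auto
qed (use assms in auto)

lemma scalar_prod_sq_le:
  assumes v: "(v :: real vec) \<in> carrier_vec d" "v \<bullet> v = 1" and x: "x \<in> carrier_vec d"
  shows "(v \<bullet> x)\<^sup>2 \<le> x \<bullet> x"
proof -
  let ?y = "x - (v \<bullet> x) \<cdot>\<^sub>v v"
  have "?y \<bullet> ?y = x \<bullet> x - (v \<bullet> x)\<^sup>2"
    using v x comm_scalar_prod[OF x v(1)]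
    by (simp add: minus_scalar_prod_distrib[of _ d] scalar_prod_minus_distrib[of _ d] power2_eq_square
        algebra_simps)
  then show ?thesis using scalar_prod_self_nonneg[of ?y] by linarith
qed

lemma scalar_prod_rank_one:
  assumes v: "v \<in> carrier_vec d" and x: "x \<in> carrier_vec d"
  shows "x \<bullet> (rank_one d c v *\<^sub>v x) = x \<bullet> x + c * (v \<bullet> x)\<^sup>2"
  using v x comm_scalar_prod[OF x v]
  by (simp add: rank_one_mult_vec scalar_prod_add_distrib[of _ d] power2_eq_square)

lemma pos_def_rank_one:
  assumes v: "v \<in> carrier_vec d" "v \<bullet> v = 1" and c: "-1 < c" "c \<le> 0"
  shows "pos_def d (rank_one d c v)"
  unfolding pos_def_def
proof (intro conjI ballI impI)
  fix x :: "real vec" assume x: "x \<in> carrier_vec d" "x \<noteq> 0\<^sub>v d"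
  then have "x \<bullet> x > 0" using scalar_prod_self_eq_0 scalar_prod_self_nonneg[of x] by fastforce
  then have "0 < (1 + c) * (x \<bullet> x)" using c by simp
  also have "\<dots> \<le> x \<bullet> x + c * (v \<bullet> x)\<^sup>2"
    using mult_left_mono_neg[OF scalar_prod_sq_le[OF v x(1)] c(2)] by (simp add: algebra_simps)
  finally show "0 < x \<bullet> (rank_one d c v *\<^sub>v x)" by (simp add: scalar_prod_rank_one v x)
qed auto

lemma pos_def_imp_psd: "pos_def d A \<Longrightarrow> psd d A"
  unfolding pos_def_def psd_def
proof (intro conjI ballI; (elim conjE)?)
  fix x :: "real vec"
  assume x: "x \<in> carrier_vec d" and A: "A \<in> carrier_mat d d"
    and p: "\<forall>x\<in>carrier_vec d. x \<noteq> 0\<^sub>v d \<longrightarrow> 0 < x \<bullet> (A *\<^sub>v x)"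
  show "0 \<le> x \<bullet> (A *\<^sub>v x)"
  proof (cases "x = 0\<^sub>v d")
    case True
    have "A *\<^sub>v x \<in> carrier_vec d" using A x by auto
    then show ?thesis using True by simp
  next
    case False
    then show ?thesis using p x by (simp add: less_imp_le)
  qed
qed auto

text \<open>If \<open>B\<^sup>2 = C\<^sup>2\<close> and \<open>B\<close>, \<open>C\<close> commute, then \<open>D = B - C\<close> satisfies \<open>(B + C) D = 0\<close>,
  so \<open>y \<bullet> B y + y \<bullet> C y = 0\<close> for \<open>y = D x\<close>, and definiteness of \<open>C\<close> gives \<open>y = 0\<close>.\<close>

lemma commuting_sqrt_unique:
  assumes B: "psd d B" and C: "pos_def d C" and sq: "B * B = C * C" and comm: "B * C = C * B"
  shows "B = C"
proof (rule eq_mat_vecI)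
  show Bc: "B \<in> carrier_mat d d" and Cc: "C \<in> carrier_mat d d"
    using B C by (auto simp: psd_def pos_def_def)
  fix x :: "real vec" assume x: "x \<in> carrier_vec d"
  define y where "y = B *\<^sub>v x - C *\<^sub>v x"
  have car: "B *\<^sub>v x \<in> carrier_vec d" "C *\<^sub>v x \<in> carrier_vec d" using Bc Cc x by auto
  then have y: "y \<in> carrier_vec d" by (simp add: y_def)
  have a: "(M * N) *\<^sub>v x = M *\<^sub>v (N *\<^sub>v x)" if "M \<in> carrier_mat d d" "N \<in> carrier_mat d d" for M N :: "real mat"
    using that x by (rule assoc_mult_mat_vec)
  have By: "B *\<^sub>v y = B *\<^sub>v (B *\<^sub>v x) - B *\<^sub>v (C *\<^sub>v x)"
    unfolding y_def by (rule mult_minus_distrib_mat_vec[OF Bc car])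
  have Cy: "C *\<^sub>v y = C *\<^sub>v (B *\<^sub>v x) - C *\<^sub>v (C *\<^sub>v x)"
    unfolding y_def by (rule mult_minus_distrib_mat_vec[OF Cc car])
  have 1: "B *\<^sub>v (B *\<^sub>v x) = C *\<^sub>v (C *\<^sub>v x)" "B *\<^sub>v (C *\<^sub>v x) = C *\<^sub>v (B *\<^sub>v x)"
    using a[OF Bc Bc] a[OF Cc Cc] a[OF Bc Cc] a[OF Cc Bc] sq comm by simp_all
  have c4: "C *\<^sub>v (C *\<^sub>v x) \<in> carrier_vec d" "C *\<^sub>v (B *\<^sub>v x) \<in> carrier_vec d" using Cc car by auto
  have "B *\<^sub>v y = - (C *\<^sub>v y)"
    unfolding By Cy 1 using c4 by (intro eq_vecI) auto
  then have "y \<bullet> (B *\<^sub>v y) = - (y \<bullet> (C *\<^sub>v y))"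
    using y Cc by (simp add: scalar_prod_uminus_right)
  moreover have "y \<bullet> (B *\<^sub>v y) \<ge> 0" using B y by (auto simp: psd_def)
  ultimately have "\<not> y \<bullet> (C *\<^sub>v y) > 0" by linarith
  then have y0: "y = 0\<^sub>v d" using C y by (auto simp: pos_def_def)
  show "B *\<^sub>v x = C *\<^sub>v x"
  proof (rule eq_vecI)
    fix i assume i: "i < dim_vec (C *\<^sub>v x)"
    then have "y $ i = (B *\<^sub>v x) $ i - (C *\<^sub>v x) $ i" "i < d" using car Cc by (auto simp: y_def)
    then show "(B *\<^sub>v x) $ i = (C *\<^sub>v x) $ i" using y0 by simp
  qed (use car Bc Cc in auto)
qed

lemma rank_one_0: "rank_one d 0 v = 1\<^sub>m d"
  by (intro eq_matI) (auto simp: rank_one_def)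

text \<open>The definite description in \<open>mat_sqrt\<close> demands uniqueness. A competitor
  \<open>B\<close> commutes with \<open>B * B\<close>, and for s < 1 the candidate is an affine
  function of \<open>B * B\<close>, hence commutes with \<open>B\<close> as well; for s = 1 the
  candidate is the identity.\<close>

lemma mat_sqrt_rank_one:
  assumes v: "v \<in> carrier_vec d" "v \<bullet> v = 1" and s: "0 < s" "s \<le> 1"
  shows "mat_sqrt (rank_one d (s\<^sup>2 - 1) v) = rank_one d (s - 1) v"
  unfolding mat_sqrt_def
proof (rule the_equality)
  have pd: "pos_def d (rank_one d (s - 1) v)" using v s by (intro pos_def_rank_one) auto
  have sq: "rank_one d (s - 1) v * rank_one d (s - 1) v = rank_one d (s\<^sup>2 - 1) v"
    unfolding rank_one_mult[OF v] by (simp add: algebra_simps power2_eq_square)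
  have dim: "dim_row (rank_one d (s\<^sup>2 - 1) v) = d" by (simp add: rank_one_def)
  show "psd (dim_row (rank_one d (s\<^sup>2 - 1) v)) (rank_one d (s - 1) v)
    \<and> rank_one d (s - 1) v * rank_one d (s - 1) v = rank_one d (s\<^sup>2 - 1) v"
    unfolding dim using pos_def_imp_psd[OF pd] sq by simp
  fix B assume "psd (dim_row (rank_one d (s\<^sup>2 - 1) v)) B \<and> B * B = rank_one d (s\<^sup>2 - 1) v"
  then have B: "psd d B" "B * B = rank_one d (s\<^sup>2 - 1) v" by (auto simp: dim)
  then have Bc: "B \<in> carrier_mat d d" by (simp add: psd_def)
  have "B * rank_one d (s - 1) v = rank_one d (s - 1) v * B"
  proof (cases "s = 1")
    case True
    then show ?thesis using Bc by (simp add: rank_one_0)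
  next
    case False
    then have "s\<^sup>2 < 1" using s by (simp add: abs_square_less_1)
    then have s2: "s\<^sup>2 - 1 \<noteq> 0" by simp
    define r where "r = (s - 1) / (s\<^sup>2 - 1)"
    have "s - 1 = r * (s\<^sup>2 - 1)" using s2 by (simp add: r_def)
    then have eq: "rank_one d (s - 1) v = (1 - r) \<cdot>\<^sub>m 1\<^sub>m d + r \<cdot>\<^sub>m (B * B)"
      unfolding B(2)
      by (simp only:, intro eq_matI) (auto simp: rank_one_def algebra_simps)
    have BB: "B * B \<in> carrier_mat d d" using Bc by simp
    have I: "(1 - r) \<cdot>\<^sub>m 1\<^sub>m d \<in> carrier_mat d d" "r \<cdot>\<^sub>m (B * B) \<in> carrier_mat d d"
      using BB by auto
    have "B * rank_one d (s - 1) v = (1 - r) \<cdot>\<^sub>m B + r \<cdot>\<^sub>m (B * (B * B))"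
      unfolding eq mult_add_distrib_mat[OF Bc I]
      using mult_smult_distrib[OF Bc one_carrier_mat] mult_smult_distrib[OF Bc BB] Bc by simp
    moreover have "rank_one d (s - 1) v * B = (1 - r) \<cdot>\<^sub>m B + r \<cdot>\<^sub>m (B * B * B)"
      unfolding eq add_mult_distrib_mat[OF I Bc]
      using mult_smult_assoc_mat[OF one_carrier_mat Bc] mult_smult_assoc_mat[OF BB Bc] Bc by simp
    ultimately show ?thesis
      using assoc_mult_mat[OF Bc Bc Bc] by simp
  qed
  then show "B = rank_one d (s - 1) v"
    by (rule commuting_sqrt_unique[OF B(1) pd trans[OF B(2) sq[symmetric]]])
qed

text \<open>The matrix \<open>C\<close> returned by \<open>mat_inverse\<close> is never computed:
  the root maps (m/s) v to m v, and \<open>C\<close> being a left inverse undoes this. Only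
  multiples of \<open>v\<close> matter, because the mean is one.\<close>

lemma mat_inv_sqrt_rank_one:
  assumes v: "v \<in> carrier_vec d" "v \<bullet> v = 1" and s: "0 < s" "s \<le> 1"
  shows "mat_inv_sqrt (rank_one d (s\<^sup>2 - 1) v) *\<^sub>v (m \<cdot>\<^sub>v v) = (m / s) \<cdot>\<^sub>v v"
proof -
  let ?A = "rank_one d (s - 1) v"
  let ?B = "rank_one d (1 / s - 1) v"
  have inv: "?A * ?B = 1\<^sub>m d" "?B * ?A = 1\<^sub>m d"
    unfolding rank_one_mult[OF v] rank_one_0[symmetric, of d v] using s
    by (auto intro!: arg_cong[where f = "\<lambda>c. rank_one d c v"] simp: field_simps)
  have "?A \<in> Units (ring_mat TYPE(real) d ())"
    using inv by (auto simp: Units_def ring_mat_simps intro!: bexI[of _ ?B])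
  then obtain C where C: "mat_inverse ?A = Some C"
    using mat_inverse(1)[of ?A d "()"] by (cases "mat_inverse ?A") auto
  have C': "C * ?A = 1\<^sub>m d" "C \<in> carrier_mat d d"
    using mat_inverse(2)[OF _ C, of d] by auto
  have "?A *\<^sub>v ((m / s) \<cdot>\<^sub>v v) = m \<cdot>\<^sub>v v"
    using v s by (intro eq_vecI) (auto simp: rank_one_mult_vec field_simps)
  then have "C *\<^sub>v (m \<cdot>\<^sub>v v) = (C * ?A) *\<^sub>v ((m / s) \<cdot>\<^sub>v v)"
    using assoc_mult_mat_vec[OF C'(2) rank_one_carrier, of "(m / s) \<cdot>\<^sub>v v"] v by simp
  also have "\<dots> = (m / s) \<cdot>\<^sub>v v" using C' v by simp
  finally show ?thesis
    by (simp add: mat_inv_sqrt_def mat_sqrt_rank_one[OF v s] C)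
qed

text \<open>Pairing an eigenvector equation with \<open>v\<close> gives (1 + c - l)(v \<bullet> x) =
  0, and v \<bullet> x = 0 forces l = 1. The spectrum is only placed inside {1 + c, 1}, since in
  dimension 1 nothing is orthogonal to \<open>v\<close>.\<close>

lemma min_eigenvalue_rank_one:
  assumes v: "v \<in> carrier_vec d" "v \<bullet> v = 1" and c: "c \<le> 0"
  shows "min_eigenvalue (rank_one d c v) = 1 + c"
proof -
  have dim: "dim_row (rank_one d c v) = d" by (simp add: rank_one_def)
  have "eigenvalue (rank_one d c v) (1 + c)"
    unfolding eigenvalue_def eigenvector_def dim
  proof (intro exI[of _ v] conjI)
    show "v \<noteq> 0\<^sub>v d" using v by auto
    show "rank_one d c v *\<^sub>v v = (1 + c) \<cdot>\<^sub>v v"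
      using v by (intro eq_vecI) (auto simp: rank_one_mult_vec algebra_simps)
  qed (rule v)
  moreover have "l \<in> {1 + c, 1}" if l: "eigenvalue (rank_one d c v) l" for l
  proof -
    obtain x where x: "x \<in> carrier_vec d" "x \<noteq> 0\<^sub>v d" "rank_one d c v *\<^sub>v x = l \<cdot>\<^sub>v x"
      using l unfolding eigenvalue_def eigenvector_def dim by blast
    then have eq: "x + (c * (v \<bullet> x)) \<cdot>\<^sub>v v = l \<cdot>\<^sub>v x" using v by (simp add: rank_one_mult_vec)
    have "v \<bullet> (x + (c * (v \<bullet> x)) \<cdot>\<^sub>v v) = v \<bullet> x + c * (v \<bullet> x)"
      using v x by (simp add: scalar_prod_add_distrib[of _ d])
    then have "(1 + c - l) * (v \<bullet> x) = 0"
      unfolding eq using v x by (simp add: algebra_simps)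
    moreover have "l = 1" if "v \<bullet> x = 0"
    proof -
      have "x \<bullet> x > 0"
        using scalar_prod_self_eq_0[OF x(1)] scalar_prod_self_nonneg[of x] x(2) by fastforce
      moreover have "x + (c * (v \<bullet> x)) \<cdot>\<^sub>v v = x"
        using that v x by (intro eq_vecI) auto
      then have "x = l \<cdot>\<^sub>v x" using eq by simp
      then have "x \<bullet> x = l * (x \<bullet> x)"
        using x(1) by (metis scalar_prod_smult_distrib)
      ultimately show ?thesis by simp
    qed
    ultimately show ?thesis by auto
  qed
  ultimately have *: "1 + c \<in> {l. eigenvalue (rank_one d c v) l}"
    "{l. eigenvalue (rank_one d c v) l} \<subseteq> {1 + c, 1}" by blast+
  show ?thesis
    unfolding min_eigenvalue_def
  proof (rule Min_eqI)
    show "finite {l. eigenvalue (rank_one d c v) l}" using *(2) by (rule finite_subset) simp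
    fix l assume "l \<in> {l. eigenvalue (rank_one d c v) l}"
    then have "l \<in> {1 + c, 1}" using *(2) by blast
    then show "1 + c \<le> l" using c by auto
  qed (rule *(1))
qed

section \<open>Integration against mixtures\<close>

text \<open>Polynomials are signed and unbounded, so positive and negative parts go separately
  through the nonnegative integral; the bound \<open>B\<close>, uniform in \<open>v\<close>, makes
  the inner absolute moments integrable.\<close>

lemma bind_integral:
  fixes f :: "'b \<Rightarrow> real"
  assumes M: "finite_measure M" "space M \<noteq> {}"
    and K: "K \<in> M \<rightarrow>\<^sub>M subprob_algebra N"
    and f: "f \<in> borel_measurable N"
    and int: "\<And>v. v \<in> space M \<Longrightarrow> integrable (K v) f"
    and bound: "\<And>v. v \<in> space M \<Longrightarrow> (\<integral>y. \<bar>f y\<bar> \<partial>K v) \<le> B"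
  shows "integrable (M \<bind> K) f"
    and "(\<integral>y. f y \<partial>(M \<bind> K)) = (\<integral>v. (\<integral>y. f y \<partial>K v) \<partial>M)"
proof -
  interpret finite_measure M by fact
  have sets_K: "sets (K v) = sets N" if "v \<in> space M" for v
    using measurable_space[OF K that] by (simp add: space_subprob_algebra)
  have meas: "borel_measurable (K v) = borel_measurable N" if "v \<in> space M" for v
    using sets_K[OF that] by (simp cong: measurable_cong_sets)
  have *: "has_bochner_integral (M \<bind> K) h (\<integral>v. (\<integral>y. h y \<partial>K v) \<partial>M)
      \<and> integrable M (\<lambda>v. \<integral>y. h y \<partial>K v)"
    if h: "h \<in> borel_measurable N" "\<And>y. 0 \<le> h y" and le: "\<And>y. h y \<le> \<bar>f y\<bar>" for h
  proof -
    have hi: "integrable (K v) h" if "v \<in> space M" for v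
      using h(2) le
      by (intro Bochner_Integration.integrable_bound[OF int[OF that]]) (auto simp: meas[OF that] h(1))
    have hB: "(\<integral>y. h y \<partial>K v) \<le> B" if "v \<in> space M" for v
      using bound[OF that] integral_mono[OF hi[OF that] integrable_abs[OF int[OF that]] le] by linarith
    have h0: "0 \<le> (\<integral>y. h y \<partial>K v)" for v
      using h(2) by (intro integral_nonneg_AE) auto
    have Im: "(\<lambda>v. \<integral>y. h y \<partial>K v) \<in> borel_measurable M"
      by (rule measurable_compose[OF K integral_measurable_subprob_algebra[OF h(1)]])
    have I: "integrable M (\<lambda>v. \<integral>y. h y \<partial>K v)"
      using Im hB h0 by (intro integrable_const_bound[where B = B]) auto
    have "(\<integral>\<^sup>+y. ennreal (h y) \<partial>(M \<bind> K)) = (\<integral>\<^sup>+v. (\<integral>\<^sup>+y. ennreal (h y) \<partial>K v) \<partial>M)"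
      using h(1) by (intro nn_integral_bind[OF _ K]) auto
    also have "\<dots> = (\<integral>\<^sup>+v. ennreal (\<integral>y. h y \<partial>K v) \<partial>M)"
      using hi h(2) by (intro nn_integral_cong nn_integral_eq_integral) auto
    also have "\<dots> = ennreal (\<integral>v. (\<integral>y. h y \<partial>K v) \<partial>M)"
      using I h0 by (intro nn_integral_eq_integral) auto
    finally have "has_bochner_integral (M \<bind> K) h (\<integral>v. (\<integral>y. h y \<partial>K v) \<partial>M)"
      using h h0 sets_bind[OF sets_K M(2)] measurable_cong_sets[of "M \<bind> K" N borel borel]
      by (intro has_bochner_integral_nn_integral integral_nonneg_AE) auto
    with I show ?thesis by simp
  qed
  let ?p = "\<lambda>y. max (f y) 0" and ?n = "\<lambda>y. max (- f y) 0"
  have p: "has_bochner_integral (M \<bind> K) ?p (\<integral>v. (\<integral>y. ?p y \<partial>K v) \<partial>M)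
      \<and> integrable M (\<lambda>v. \<integral>y. ?p y \<partial>K v)"
    using f by (intro *) auto
  have n: "has_bochner_integral (M \<bind> K) ?n (\<integral>v. (\<integral>y. ?n y \<partial>K v) \<partial>M)
      \<and> integrable M (\<lambda>v. \<integral>y. ?n y \<partial>K v)"
    using f by (intro *) auto
  have f_eq: "f = (\<lambda>y. ?p y - ?n y)" by (auto simp: fun_eq_iff)
  have "has_bochner_integral (M \<bind> K) (\<lambda>y. ?p y - ?n y)
     ((\<integral>v. (\<integral>y. ?p y \<partial>K v) \<partial>M) - (\<integral>v. (\<integral>y. ?n y \<partial>K v) \<partial>M))"
    using p n by (intro has_bochner_integral_diff) auto
  also have "(\<integral>v. (\<integral>y. ?p y \<partial>K v) \<partial>M) - (\<integral>v. (\<integral>y. ?n y \<partial>K v) \<partial>M)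
    = (\<integral>v. (\<integral>y. ?p y \<partial>K v) - (\<integral>y. ?n y \<partial>K v) \<partial>M)"
    using p n by (intro Bochner_Integration.integral_diff[symmetric]) auto
  also have "\<dots> = (\<integral>v. (\<integral>y. f y \<partial>K v) \<partial>M)"
  proof (intro Bochner_Integration.integral_cong refl)
    fix v assume v: "v \<in> space M"
    show "(\<integral>y. ?p y \<partial>K v) - (\<integral>y. ?n y \<partial>K v) = (\<integral>y. f y \<partial>K v)"
      using int[OF v] by (subst Bochner_Integration.integral_diff[symmetric]) (auto simp: f_eq[symmetric])
  qed
  finally have "has_bochner_integral (M \<bind> K) f (\<integral>v. (\<integral>y. f y \<partial>K v) \<partial>M)"
    using f_eq by simp
  then show "integrable (M \<bind> K) f"
    and "(\<integral>y. f y \<partial>(M \<bind> K)) = (\<integral>v. (\<integral>y. f y \<partial>K v) \<partial>M)"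
    by (simp_all add: has_bochner_integral_iff)
qed

lemma bind_pmf_integral:
  fixes f :: "'b \<Rightarrow> real"
  assumes J: "finite (set_pmf J)"
    and K: "\<And>j. K j \<in> space (prob_algebra N)" and f: "f \<in> borel_measurable N"
    and int: "\<And>j. integrable (K j) f" and B: "\<And>j. (\<integral>y. \<bar>f y\<bar> \<partial>K j) \<le> B"
  shows "integrable (measure_pmf J \<bind> K) f"
    and "(\<integral>y. f y \<partial>(measure_pmf J \<bind> K)) = (\<Sum>j\<in>set_pmf J. pmf J j * (\<integral>y. f y \<partial>K j))"
proof -
  have K': "K \<in> measure_pmf J \<rightarrow>\<^sub>M subprob_algebra N"
    using K by (auto simp: space_prob_algebra space_subprob_algebra intro: prob_space_imp_subprob_space)
  have fin: "finite_measure (measure_pmf J)" by (rule prob_space.finite_measure) (rule prob_space_measure_pmf)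
  show "integrable (measure_pmf J \<bind> K) f"
    using fin K' f int B by (intro bind_integral) auto
  have "(\<integral>y. f y \<partial>(measure_pmf J \<bind> K)) = (\<integral>j. (\<integral>y. f y \<partial>K j) \<partial>measure_pmf J)"
    using fin K' f int B by (intro bind_integral) auto
  also have "\<dots> = (\<Sum>j\<in>set_pmf J. (\<integral>y. f y \<partial>K j) * pmf J j)"
    using J by (intro integral_measure_pmf_real) auto
  finally show "(\<integral>y. f y \<partial>(measure_pmf J \<bind> K)) = (\<Sum>j\<in>set_pmf J. pmf J j * (\<integral>y. f y \<partial>K j))"
    by (simp add: mult.commute)
qed

lemma contaminate_integral:
  fixes f :: "'a \<Rightarrow> real"
  assumes "0 < \<eta>" "\<eta> < 1" and G: "G \<in> space (prob_algebra N)" and Q: "Q \<in> space (prob_algebra N)"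
    and f: "f \<in> borel_measurable N" and int: "integrable G f" "integrable Q f"
  shows "integrable (contaminate \<eta> G Q) f"
    and "(\<integral>y. f y \<partial>contaminate \<eta> G Q) = (1 - \<eta>) * (\<integral>y. f y \<partial>G) + \<eta> * (\<integral>y. f y \<partial>Q)"
proof -
  let ?B = "max (\<integral>y. \<bar>f y\<bar> \<partial>G) (\<integral>y. \<bar>f y\<bar> \<partial>Q)"
  have 1: "finite (set_pmf (bernoulli_pmf \<eta>))" by (rule finite_subset[of _ UNIV]) auto
  note * = bind_pmf_integral[OF 1, of "\<lambda>b. if b then Q else G" N f ?B]
  show "integrable (contaminate \<eta> G Q) f"
    unfolding contaminate_def using G Q f int by (intro *) (auto simp: max_def)
  have "(\<integral>y. f y \<partial>contaminate \<eta> G Q)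
     = (\<Sum>b\<in>set_pmf (bernoulli_pmf \<eta>). pmf (bernoulli_pmf \<eta>) b * (\<integral>y. f y \<partial>(if b then Q else G)))"
    unfolding contaminate_def using G Q f int by (intro *) (auto simp: max_def)
  also have "set_pmf (bernoulli_pmf \<eta>) = {True, False}" using assms by auto
  finally show "(\<integral>y. f y \<partial>contaminate \<eta> G Q) = (1 - \<eta>) * (\<integral>y. f y \<partial>G) + \<eta> * (\<integral>y. f y \<partial>Q)"
    using assms by simp
qed

text \<open>Rectangles are intersection-stable and generate the product algebra, and on a rectangle
  the measure is a finite product of measurable functions of \<open>v\<close>. Hence
  \<open>planted_law\<close> is a mixture along a measurable kernel.\<close>

lemma measurable_PiM_prob_algebra:
  assumes I: "finite I" and K: "K \<in> M \<rightarrow>\<^sub>M prob_algebra N"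
  shows "(\<lambda>v. PiM I (\<lambda>_. K v)) \<in> M \<rightarrow>\<^sub>M prob_algebra (PiM I (\<lambda>_. N))"
proof (rule measurable_prob_algebra_generated[OF sets_PiM Int_stable_prod_algebra prod_algebra_sets_into_space])
  have Kv: "prob_space (K v)" "sets (K v) = sets N" if "v \<in> space M" for v
    using measurable_space[OF K that] by (auto simp: space_prob_algebra)
  fix v assume v: "v \<in> space M"
  interpret product_prob_space "\<lambda>_. K v" I
    by (intro product_prob_spaceI Kv v)
  show "prob_space (PiM I (\<lambda>_. K v))" by (rule prob_space_PiM) (rule Kv[OF v])
  show "sets (PiM I (\<lambda>_. K v)) = sets (PiM I (\<lambda>_. N))"
    by (intro sets_PiM_cong) (auto simp: Kv v)
next
  have Kv: "prob_space (K v)" "sets (K v) = sets N" if "v \<in> space M" for v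
    using measurable_space[OF K that] by (auto simp: space_prob_algebra)
  fix A assume "A \<in> prod_algebra I (\<lambda>_. N)"
  then obtain X where X: "X \<in> (\<Pi> j\<in>I. sets N)" and A: "A = PiE I X"
    unfolding prod_algebra_eq_finite[OF I] by blast
  have "(\<lambda>v. \<Prod>i\<in>I. emeasure (K v) (X i)) \<in> borel_measurable M"
    using X by (intro borel_measurable_prod_ennreal
        measurable_compose[OF measurable_prob_algebraD[OF K] measurable_emeasure_subprob_algebra]) auto
  moreover have "emeasure (PiM I (\<lambda>_. K v)) A = (\<Prod>i\<in>I. emeasure (K v) (X i))" if v: "v \<in> space M" for v
  proof -
    interpret product_prob_space "\<lambda>_. K v" I
      by (intro product_prob_spaceI Kv v)
    show ?thesis unfolding A using I X Kv[OF v] by (intro emeasure_PiM) auto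
  qed
  ultimately show "(\<lambda>v. emeasure (PiM I (\<lambda>_. K v)) A) \<in> borel_measurable M"
    by (simp cong: measurable_cong)
qed

section \<open>The second-moment bound\<close>

lemma integrable_mult_of_squares:
  fixes f g :: "'a \<Rightarrow> real"
  assumes f: "f \<in> borel_measurable M" "integrable M (\<lambda>x. (f x)\<^sup>2)"
    and g: "g \<in> borel_measurable M" "integrable M (\<lambda>x. (g x)\<^sup>2)"
  shows "integrable M (\<lambda>x. f x * g x)"
proof (rule Bochner_Integration.integrable_bound[OF Bochner_Integration.integrable_add[OF f(2) g(2)]])
  show "(\<lambda>x. f x * g x) \<in> borel_measurable M" using f g by simp
  have "\<bar>f x * g x\<bar> \<le> (f x)\<^sup>2 + (g x)\<^sup>2" for x
    using sum_squares_bound[of "\<bar>f x\<bar>" "\<bar>g x\<bar>"] abs_mult[of "f x" "g x"]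
    by (simp add: power2_eq_square)
  then show "AE x in M. norm (f x * g x) \<le> norm ((f x)\<^sup>2 + (g x)\<^sup>2)"
    by auto
qed

lemma integral_Cauchy_Schwarz:
  fixes f g :: "'a \<Rightarrow> real"
  assumes f: "f \<in> borel_measurable M" "integrable M (\<lambda>x. (f x)\<^sup>2)"
    and g: "g \<in> borel_measurable M" "integrable M (\<lambda>x. (g x)\<^sup>2)"
  shows "(\<integral>x. f x * g x \<partial>M)\<^sup>2 \<le> (\<integral>x. (f x)\<^sup>2 \<partial>M) * (\<integral>x. (g x)\<^sup>2 \<partial>M)"
proof -
  define a b c where "a = (\<integral>x. (f x)\<^sup>2 \<partial>M)" and "b = (\<integral>x. f x * g x \<partial>M)" and "c = (\<integral>x. (g x)\<^sup>2 \<partial>M)"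
  note fg = integrable_mult_of_squares[OF f g]
  have q: "0 \<le> a - 2 * t * b + t\<^sup>2 * c" for t
  proof -
    have "0 \<le> (\<integral>x. (f x - t * g x)\<^sup>2 \<partial>M)" by simp
    also have "\<dots> = (\<integral>x. (f x)\<^sup>2 - 2 * t * (f x * g x) + t\<^sup>2 * (g x)\<^sup>2 \<partial>M)"
      by (intro Bochner_Integration.integral_cong) (auto simp: power2_eq_square algebra_simps)
    also have "\<dots> = a - 2 * t * b + t\<^sup>2 * c"
      unfolding a_def b_def c_def using f g fg by simp
    finally show ?thesis .
  qed
  have "c \<ge> 0" by (simp add: c_def)
  show ?thesis
  proof (cases "c = 0")
    case True
    have "b = 0"
    proof (rule ccontr)
      assume "b \<noteq> 0"
      \<comment> \<open>For c = 0 the quadratic is affine in \<open>t\<close>, and this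
        \<open>t\<close> gives it the value -1.\<close>
      then show False using q[of "(a + 1) / (2 * b)"] True by (simp add: field_simps)
    qed
    then show ?thesis using True by (simp add: a_def b_def c_def)
  next
    case False
    then have "c > 0" using \<open>c \<ge> 0\<close> by simp
    then have "0 \<le> a - b\<^sup>2 / c" using q[of "b / c"] by (simp add: power2_eq_square)
    then have "b\<^sup>2 \<le> a * c" using \<open>c > 0\<close> by (simp add: field_simps)
    then show ?thesis by (simp add: a_def b_def c_def)
  qed
qed

text \<open>Cauchy-Schwarz for \<open>f\<close> against the average \<open>L\<close> of the
  functions \<open>H v\<close>, whose squared norm is the double integral over independent
  \<open>v\<close> and \<open>w\<close>. The uniform bound \<open>B\<close> supplies the joint
  integrability for Fubini.\<close>

lemma kernel_integral_bound:
  fixes H :: "'a \<Rightarrow> 'b \<Rightarrow> real" and f :: "'b \<Rightarrow> real"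
  assumes U: "subprob_space U" and Q: "prob_space Q"
    and H: "(\<lambda>(v, y). H v y) \<in> borel_measurable (U \<Otimes>\<^sub>M Q)"
    and HI: "\<And>v. v \<in> space U \<Longrightarrow> integrable Q (\<lambda>y. (H v y)\<^sup>2)"
    and HB: "\<And>v. v \<in> space U \<Longrightarrow> (\<integral>y. (H v y)\<^sup>2 \<partial>Q) \<le> B"
    and R: "(\<integral>v. (\<integral>w. (\<integral>y. H v y * H w y \<partial>Q) \<partial>U) \<partial>U) \<le> R"
    and f: "f \<in> borel_measurable Q" "integrable Q (\<lambda>y. (f y)\<^sup>2)"
  shows "(\<integral>v. (\<integral>y. f y * H v y \<partial>Q) \<partial>U) \<le> sqrt R * sqrt (\<integral>y. (f y)\<^sup>2 \<partial>Q)"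
proof -
  interpret U: subprob_space U by fact
  interpret Q: prob_space Q by fact
  interpret pair_sigma_finite U Q ..
  define L where "L y = (\<integral>v. H v y \<partial>U)" for y
  note [measurable] = H
  have Hv: "H v \<in> borel_measurable Q" if "v \<in> space U" for v
    using measurable_compose[OF measurable_Pair1'[OF that] H] by simp
  have Lm [measurable]: "L \<in> borel_measurable Q"
    unfolding L_def[abs_def] by measurable
  have fub: "(\<integral>v. (\<integral>y. h y * H v y \<partial>Q) \<partial>U) = (\<integral>y. h y * L y \<partial>Q)"
    if h[measurable]: "h \<in> borel_measurable Q" and h2: "integrable Q (\<lambda>y. (h y)\<^sup>2)" for h
  proof -
    have i: "integrable Q (\<lambda>y. h y * H v y)" if "v \<in> space U" for v
      using h h2 Hv[OF that] HI[OF that] by (rule integrable_mult_of_squares)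
    have "integrable (U \<Otimes>\<^sub>M Q) (\<lambda>(v, y). h y * H v y)"
    proof (rule Fubini_integrable)
      have "(\<lambda>v. \<integral>y. norm (case (v, y) of (v, y) \<Rightarrow> h y * H v y) \<partial>Q) \<in> borel_measurable U"
        by measurable
      moreover have "(\<integral>y. norm (case (v, y) of (v, y) \<Rightarrow> h y * H v y) \<partial>Q) \<le> (\<integral>y. (h y)\<^sup>2 \<partial>Q) + B"
        if v: "v \<in> space U" for v
      proof -
        have le: "\<bar>h y * H v y\<bar> \<le> (h y)\<^sup>2 + (H v y)\<^sup>2" for y
          using sum_squares_bound[of "\<bar>h y\<bar>" "\<bar>H v y\<bar>"] abs_mult[of "h y" "H v y"]
          by (simp add: power2_eq_square)
        have "(\<integral>y. \<bar>h y * H v y\<bar> \<partial>Q) \<le> (\<integral>y. (h y)\<^sup>2 + (H v y)\<^sup>2 \<partial>Q)"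
          using i[OF v] h2 HI[OF v] le by (intro integral_mono) auto
        also have "\<dots> \<le> (\<integral>y. (h y)\<^sup>2 \<partial>Q) + B" using h2 HI[OF v] HB[OF v] by simp
        finally show ?thesis by simp
      qed
      ultimately show "integrable U (\<lambda>v. \<integral>y. norm (case (v, y) of (v, y) \<Rightarrow> h y * H v y) \<partial>Q)"
        by (intro U.integrable_const_bound[where B = "(\<integral>y. (h y)\<^sup>2 \<partial>Q) + B"]) auto
      show "AE v in U. integrable Q (\<lambda>y. case (v, y) of (v, y) \<Rightarrow> h y * H v y)" using i by auto
    qed measurable
    from Fubini_integral[OF this] show ?thesis unfolding L_def by simp
  qed
  have L2: "integrable Q (\<lambda>y. (L y)\<^sup>2)"
  proof -
    have HH: "integrable (U \<Otimes>\<^sub>M Q) (\<lambda>(v, y). (H v y)\<^sup>2)"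
    proof (rule Fubini_integrable)
      have "(\<lambda>v. \<integral>y. norm (case (v, y) of (v, y) \<Rightarrow> (H v y)\<^sup>2) \<partial>Q) \<in> borel_measurable U"
        by measurable
      then show "integrable U (\<lambda>v. \<integral>y. norm (case (v, y) of (v, y) \<Rightarrow> (H v y)\<^sup>2) \<partial>Q)"
        using HB by (intro U.integrable_const_bound[where B = B]) auto
      show "AE v in U. integrable Q (\<lambda>y. case (v, y) of (v, y) \<Rightarrow> (H v y)\<^sup>2)" using HI by auto
    qed measurable
    have "AE y in Q. (L y)\<^sup>2 \<le> (\<integral>v. (H v y)\<^sup>2 \<partial>U)"
      using AE_integrable_snd[OF HH] AE_space
    proof eventually_elim
      case (elim y)
      have Hy: "(\<lambda>v. H v y) \<in> borel_measurable U"
        using measurable_compose[OF measurable_Pair2'[OF elim(2)] H] by simp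
      have "(\<integral>v. 1 * H v y \<partial>U)\<^sup>2 \<le> (\<integral>v. 1\<^sup>2 \<partial>U) * (\<integral>v. (H v y)\<^sup>2 \<partial>U)"
        using Hy elim by (intro integral_Cauchy_Schwarz) auto
      also have "\<dots> \<le> 1 * (\<integral>v. (H v y)\<^sup>2 \<partial>U)"
        using U.subprob_measure_le_1 by (intro mult_right_mono) auto
      finally show ?case by (simp add: L_def)
    qed
    then show ?thesis
      by (intro Bochner_Integration.integrable_bound[OF integrable_snd[OF HH]]) auto
  qed
  have "(\<integral>y. L y * L y \<partial>Q) = (\<integral>v. (\<integral>y. L y * H v y \<partial>Q) \<partial>U)"
    using fub[OF Lm L2] by simp
  \<comment> \<open>The exchange of integrals is used a second time, now with \<open>H v\<close> for
    fixed \<open>v\<close> as the test function.\<close>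
  also have "\<dots> = (\<integral>v. (\<integral>w. (\<integral>y. H v y * H w y \<partial>Q) \<partial>U) \<partial>U)"
    using fub[OF Hv HI] by (intro Bochner_Integration.integral_cong) (auto simp: mult.commute)
  finally have LR: "(\<integral>y. (L y)\<^sup>2 \<partial>Q) \<le> R" using R by (simp add: power2_eq_square)
  have "(\<integral>y. f y * L y \<partial>Q)\<^sup>2 \<le> (\<integral>y. (f y)\<^sup>2 \<partial>Q) * (\<integral>y. (L y)\<^sup>2 \<partial>Q)"
    by (rule integral_Cauchy_Schwarz[OF f Lm L2])
  also have "\<dots> \<le> (\<integral>y. (f y)\<^sup>2 \<partial>Q) * R" using LR by (intro mult_left_mono) auto
  finally have "(\<integral>y. f y * L y \<partial>Q) \<le> sqrt ((\<integral>y. (f y)\<^sup>2 \<partial>Q) * R)" by (rule real_le_rsqrt)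
  then show ?thesis unfolding fub[OF f] by (simp add: real_sqrt_mult mult.commute)
qed

section \<open>Moments of the uniform distribution on the sphere\<close>

lemma unit_sphereD:
  assumes "v \<in> unit_sphere d"
  shows "v \<in> carrier_vec d" "v \<bullet> v = 1"
  using assms by (auto simp: unit_sphere_def l2norm_def real_sqrt_eq_1_iff)

lemma l2norm_measurable: "l2norm \<in> borel_measurable (Rd d)"
proof -
  have "(\<lambda>x. x \<bullet> x) \<in> borel_measurable (Rd d)"
    by (rule measurable_scalar_prod[where d = d]) simp_all
  then show ?thesis unfolding l2norm_def[abs_def] by measurable
qed

lemma unit_sphere_sets: "unit_sphere d \<in> sets (Rd d)"
proof -
  have "l2norm -` {1} \<inter> space (Rd d) \<in> sets (Rd d)"
    by (rule measurable_sets[OF l2norm_measurable]) simp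
  also have "l2norm -` {1} \<inter> space (Rd d) = unit_sphere d" by (auto simp: unit_sphere_def)
  finally show ?thesis .
qed

lemma measurable_normalize: "(\<lambda>x. (1 / l2norm x) \<cdot>\<^sub>v x) \<in> Rd d \<rightarrow>\<^sub>M Rd d"
proof (rule measurable_RdI)
  fix i assume i: "i < d"
  have m: "(\<lambda>x. (1 / l2norm x) * x $ i) \<in> borel_measurable (Rd d)"
    using i by (intro borel_measurable_times borel_measurable_divide l2norm_measurable measurable_Rd_component) auto
  have eq: "((1 / l2norm x) \<cdot>\<^sub>v x) $ i = (1 / l2norm x) * x $ i" if "x \<in> space (Rd d)" for x
    using that i by simp
  show "(\<lambda>x. ((1 / l2norm x) \<cdot>\<^sub>v x) $ i) \<in> borel_measurable (Rd d)"
    by (subst measurable_cong[OF eq]) (assumption, rule m)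
qed auto

lemma measurable_normalize': "(\<lambda>x. (1 / l2norm x) \<cdot>\<^sub>v x) \<in> std_gaussian d \<rightarrow>\<^sub>M Rd d"
  using measurable_normalize by (simp cong: measurable_cong_sets)

lemma space_uniform_sphere [simp]: "space (uniform_sphere d) = unit_sphere d"
  by (auto simp: uniform_sphere_def space_restrict_space unit_sphere_def)

lemma measurable_uniform_sphere: "f \<in> Rd d \<rightarrow>\<^sub>M N \<Longrightarrow> f \<in> uniform_sphere d \<rightarrow>\<^sub>M N"
  unfolding uniform_sphere_def by (intro measurable_restrict_space1) (simp cong: measurable_cong_sets)

lemma subprob_space_uniform_sphere:
  assumes "d \<ge> 1"
  shows "subprob_space (uniform_sphere d)"
proof
  interpret prob_space "distr (std_gaussian d) (Rd d) (\<lambda>x. (1 / l2norm x) \<cdot>\<^sub>v x)"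
    by (rule prob_space.prob_space_distr[OF prob_space_std_gaussian measurable_normalize'])
  have "unit_sphere d \<inter> carrier_vec d = unit_sphere d" by (auto simp: unit_sphere_def)
  then show "emeasure (uniform_sphere d) (space (uniform_sphere d)) \<le> 1"
    unfolding space_uniform_sphere unfolding uniform_sphere_def using unit_sphere_sets
    by (subst emeasure_restrict_space) (auto intro: emeasure_le_1)
  have "unit_vec d 0 \<in> unit_sphere d"
    using assms by (auto simp: unit_sphere_def l2norm_def)
  then show "space (uniform_sphere d) \<noteq> {}" by auto
qed

text \<open>The indicator handles g = 0: division by zero gives 0 there, so the normalized vector is
  0 and lies off the sphere.\<close>

lemma integral_uniform_sphere:
  fixes h :: "real vec \<Rightarrow> real"
  assumes h: "h \<in> borel_measurable (Rd d)"
  shows "(\<integral>v. h v \<partial>uniform_sphere d) = (\<integral>g. indicator (unit_sphere d) ((1 / l2norm g) \<cdot>\<^sub>v g)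
    * h ((1 / l2norm g) \<cdot>\<^sub>v g) \<partial>std_gaussian d)"
proof -
  let ?n = "\<lambda>g. (1 / l2norm g) \<cdot>\<^sub>v g"
  let ?M = "distr (std_gaussian d) (Rd d) ?n"
  have "unit_sphere d \<inter> space ?M = unit_sphere d" by (auto simp: unit_sphere_def)
  then have S: "unit_sphere d \<inter> space ?M \<in> sets ?M" using unit_sphere_sets by simp
  have "(\<integral>v. h v \<partial>uniform_sphere d) = (\<integral>v. indicator (unit_sphere d) v *\<^sub>R h v \<partial>?M)"
    unfolding uniform_sphere_def by (rule integral_restrict_space[OF S])
  also have "\<dots> = (\<integral>g. indicator (unit_sphere d) (?n g) *\<^sub>R h (?n g) \<partial>std_gaussian d)"
    by (rule integral_distr[OF measurable_normalize'])
       (intro borel_measurable_scaleR borel_measurable_indicator unit_sphere_sets h)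
  finally show ?thesis by simp
qed

section \<open>Gaussian moments along a direction and the Chernoff weight\<close>

lemma poly_grad_power: "poly_grad d (\<lambda>x. (w \<bullet> x) ^ k) (\<lambda>a x. real k * (w \<bullet> x) ^ (k - 1) * w $ a)"
proof (induction k)
  case 0
  show ?case by (rule poly_grad.cong[OF poly_grad.const[of d 1]]) auto
next
  case (Suc k)
  show ?case
    by (rule poly_grad.cong[OF poly_grad_mult[OF Suc poly_grad_linear[of d w]]])
       (cases k; auto simp: algebra_simps)+
qed

text \<open>Stein's identity multiplies the moment by 2s + 1 at each step; the resulting double
  factorial is weakened to a power that combines well with d^s.\<close>

lemma gaussian_even_moment_le:
  assumes w: "w \<in> carrier_vec d" "w \<bullet> w = 1"
  shows "(\<integral>g. (w \<bullet> g) ^ (2 * s) \<partial>std_gaussian d) \<le> (2 * real s) ^ s"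
proof (induction s)
  case (Suc s)
  let ?E = "\<lambda>h. \<integral>g. h g \<partial>std_gaussian d"
  have "?E (\<lambda>g. (w \<bullet> g) ^ (2 * Suc s)) = ?E (\<lambda>g. (w \<bullet> g) * (w \<bullet> g) ^ Suc (2 * s))" by simp
  also have "\<dots> = (\<Sum>a<d. w $ a * ?E (\<lambda>g. real (Suc (2 * s)) * (w \<bullet> g) ^ (Suc (2 * s) - 1) * w $ a))"
    by (rule stein_direction[OF poly_grad_power])
  also have "\<dots> = (\<Sum>a<d. w $ a * w $ a * (real (Suc (2 * s)) * ?E (\<lambda>g. (w \<bullet> g) ^ (2 * s))))"
    by (simp add: mult_ac)
  also have "\<dots> = real (Suc (2 * s)) * ?E (\<lambda>g. (w \<bullet> g) ^ (2 * s))"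
    unfolding sum_distrib_right[symmetric] scalar_prod_sum[OF w(1), symmetric] w(2) by simp
  also have "\<dots> \<le> (2 * real (Suc s)) * (2 * real (Suc s)) ^ s"
  proof (rule mult_mono)
    show "?E (\<lambda>g. (w \<bullet> g) ^ (2 * s)) \<le> (2 * real (Suc s)) ^ s"
      by (rule order_trans[OF Suc power_mono]) auto
  qed (auto intro!: integral_nonneg_AE)
  finally show ?case by simp
qed simp

lemma integrable_inner_power: "integrable (std_gaussian d) (\<lambda>g. (w \<bullet> g) ^ k)"
  by (rule poly_grad_integrable[OF poly_grad_power])

text \<open>The tilt 3/2 turns the exponent \<open>x\<^sup>2/2\<close> into
  \<open>2 x\<^sup>2\<close>, that of a Gaussian with standard deviation 1/2, so the expectation is
  the rational number 1/2.\<close>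

lemma integral_exp_neg_square:
  "has_bochner_integral std_normal (\<lambda>x. exp (- (3 / 2) * x\<^sup>2)) (1 / 2)"
proof -
  have "has_bochner_integral lborel (\<lambda>x. normal_density 0 (1 / 2) x / 2) (1 / 2)"
    using normal_moment_even[of "1 / 2" 0 0] by (intro has_bochner_integral_divide_zero) auto
  also have "(\<lambda>x. normal_density 0 (1 / 2) x / 2) = (\<lambda>x. std_normal_density x * exp (- (3 / 2) * x\<^sup>2))"
  proof
    fix x :: real
    have "exp (- (x\<^sup>2 / 2)) * exp (- (3 / 2) * x\<^sup>2) = exp (- (2 * x\<^sup>2))"
      by (simp add: exp_add[symmetric])
    moreover have "sqrt (2 * pi * (1 / 2)\<^sup>2) = sqrt (2 * pi) / 2"
      by (simp only: real_sqrt_mult power2_eq_square real_sqrt_mult_self)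
    ultimately show "normal_density 0 (1 / 2) x / 2 = std_normal_density x * exp (- (3 / 2) * x\<^sup>2)"
      by (simp add: normal_density_def std_normal_density_def power2_eq_square)
  qed
  finally show ?thesis
    by (intro has_bochner_integral_density) auto
qed

lemma gaussian_exp_neg_norm:
  "integrable (std_gaussian d) (\<lambda>g. exp (- (3 / 2) * (g \<bullet> g)))"
  "(\<integral>g. exp (- (3 / 2) * (g \<bullet> g)) \<partial>std_gaussian d) = (1 / 2) ^ d"
proof -
  have i: "integrable std_normal (\<lambda>x. exp (- (3 / 2) * x\<^sup>2))"
    and v: "(\<integral>x. exp (- (3 / 2) * x\<^sup>2) \<partial>std_normal) = 1 / 2"
    using integral_exp_neg_square by (simp_all only: has_bochner_integral_iff)
  have eq: "exp (- (3 / 2) * (g \<bullet> g)) = (\<Prod>j<d. exp (- (3 / 2) * (g $ j)\<^sup>2))"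
    if "g \<in> space (std_gaussian d)" for g
    using that by (simp add: scalar_prod_sum[of g d] exp_sum sum_distrib_left power2_eq_square)
  show "integrable (std_gaussian d) (\<lambda>g. exp (- (3 / 2) * (g \<bullet> g)))"
    by (subst Bochner_Integration.integrable_cong[OF refl eq]) (assumption, rule std_gaussian_prod(1), rule i)
  show "(\<integral>g. exp (- (3 / 2) * (g \<bullet> g)) \<partial>std_gaussian d) = (1 / 2) ^ d"
    by (subst Bochner_Integration.integral_cong[OF refl eq])
       (assumption, subst std_gaussian_prod(2)[OF i], simp_all only: v prod_constant card_lessThan)
qed

text \<open>From x/s \<le> exp (x/s), raised to the power s. It brings an exponential tail to the
  same form (s/d)^s as the main term.\<close>

lemma exp_neg_le_power:
  assumes "0 < x"
  shows "exp (- x) \<le> (real s / x) ^ s"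
proof (cases "s = 0")
  case False
  have "x / real s \<le> exp (x / real s)" using exp_ge_add_one_self[of "x / real s"] by linarith
  then have "(x / real s) ^ s \<le> exp (x / real s) ^ s" using assms by (intro power_mono) auto
  also have "\<dots> = exp x" using False by (simp add: exp_of_nat_mult[symmetric])
  finally have "inverse (exp x) \<le> inverse ((x / real s) ^ s)"
    using assms False by (intro le_imp_inverse_le) auto
  then show ?thesis by (simp add: exp_minus power_divide field_simps)
qed (use assms in simp)

text \<open>On \<open>|g|\<^sup>2 \<ge> d/4\<close> the sphere moment is controlled by the Gaussian one; the complementary
  event has exponentially small probability by a Chernoff bound.\<close>

lemma sphere_even_moment_le:
  assumes w: "w \<in> unit_sphere d" and d: "d \<ge> 1"
  shows "(\<integral>v. (v \<bullet> w) ^ (2 * s) \<partial>uniform_sphere d) \<le> 2 * (8 * real s / real d) ^ s"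
proof -
  note w = unit_sphereD[OF w]
  let ?n = "\<lambda>g. (1 / l2norm g) \<cdot>\<^sub>v g"
  \<comment> \<open>A majorant covering both cases: the factor 4/d comes from |g|^2 >= d/4, and the
    exponential weight is at least 1 when |g|^2 < d/4, because 3/8 = (3/2)(1/4).\<close>
  let ?u = "\<lambda>g. (4 / real d) ^ s * (w \<bullet> g) ^ (2 * s) + exp (3 * real d / 8) * exp (- (3 / 2) * (g \<bullet> g))"
  let ?\<phi> = "\<lambda>g. indicator (unit_sphere d) (?n g) * (?n g \<bullet> w) ^ (2 * s) :: real"
  have m: "(\<lambda>v. (v \<bullet> w) ^ (2 * s)) \<in> borel_measurable (Rd d)"
    using w by (intro borel_measurable_power measurable_scalar_prod[where d = d]) auto
  have pt: "?\<phi> g \<le> ?u g" if g: "g \<in> carrier_vec d" for g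
  proof (cases "?n g \<in> unit_sphere d")
    case True
    let ?q = "g \<bullet> g"
    have q: "?q \<ge> 0" by (rule scalar_prod_self_nonneg)
    have u0: "0 \<le> (4 / real d) ^ s * (w \<bullet> g) ^ (2 * s)" by (simp add: power_mult)
    show ?thesis
    proof (cases "?q \<ge> real d / 4")
      case True
      then have qp: "?q > 0" using d by simp
      have "(?n g \<bullet> w)\<^sup>2 = (w \<bullet> g)\<^sup>2 / ?q"
        using g w q comm_scalar_prod[OF g w(1)] by (simp add: l2norm_def power_divide)
      also have "\<dots> \<le> (w \<bullet> g)\<^sup>2 / (real d / 4)"
        using True d qp by (intro divide_left_mono) auto
      finally have "(?n g \<bullet> w)\<^sup>2 \<le> (w \<bullet> g)\<^sup>2 / (real d / 4)" .
      moreover have eq: "(w \<bullet> g)\<^sup>2 / (real d / 4) = (4 / real d) * (w \<bullet> g)\<^sup>2" by simp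
      ultimately have "((?n g \<bullet> w)\<^sup>2) ^ s \<le> ((w \<bullet> g)\<^sup>2 / (real d / 4)) ^ s"
        by (intro power_mono) auto
      then have "(?n g \<bullet> w) ^ (2 * s) \<le> (4 / real d) ^ s * (w \<bullet> g) ^ (2 * s)"
        by (simp only: eq power_mult power_mult_distrib)
      moreover have "0 \<le> exp (3 * real d / 8) * exp (- (3 / 2) * (g \<bullet> g))" by simp
      moreover have "?\<phi> g = (?n g \<bullet> w) ^ (2 * s)" using \<open>?n g \<in> unit_sphere d\<close> by simp
      ultimately show ?thesis by linarith
    next
      case False
      have "(w \<bullet> ?n g)\<^sup>2 \<le> 1"
        using scalar_prod_sq_le[OF w unit_sphereD(1)[OF True]] unit_sphereD(2)[OF True] by simp
      then have "((w \<bullet> ?n g)\<^sup>2) ^ s \<le> 1" by (rule power_le_one[OF zero_le_power2])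
      then have "?\<phi> g \<le> 1"
        using True comm_scalar_prod[OF w(1) unit_sphereD(1)[OF True]] by (simp add: power_mult)
      also have "1 \<le> exp (3 * real d / 8 + - (3 / 2) * (g \<bullet> g))" using False by simp
      also have "\<dots> \<le> ?u g" using u0 unfolding exp_add by linarith
      finally show ?thesis .
    qed
  next
    case False
    then show ?thesis by (simp add: power_mult)
  qed
  have ui: "integrable (std_gaussian d) ?u"
    by (intro Bochner_Integration.integrable_add integrable_mult_right gaussian_exp_neg_norm integrable_inner_power)
  have "(\<integral>v. (v \<bullet> w) ^ (2 * s) \<partial>uniform_sphere d) = (\<integral>g. ?\<phi> g \<partial>std_gaussian d)"
    by (rule integral_uniform_sphere[OF m])
  also have "\<dots> \<le> (\<integral>g. ?u g \<partial>std_gaussian d)"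
  proof (rule integral_mono'[OF ui])
    fix g assume "g \<in> space (std_gaussian d)"
    then have g: "g \<in> carrier_vec d" by simp
    show "?\<phi> g \<le> ?u g" by (rule pt[OF g])
    show "0 \<le> ?u g" by (simp add: power_mult)
  qed
  also have "\<dots> = (4 / real d) ^ s * (\<integral>g. (w \<bullet> g) ^ (2 * s) \<partial>std_gaussian d)
      + exp (3 * real d / 8) * (1 / 2) ^ d"
    by (subst Bochner_Integration.integral_add)
       (simp_all only: integral_mult_right_zero gaussian_exp_neg_norm integrable_mult_right integrable_inner_power)
  also have "\<dots> \<le> (4 / real d) ^ s * (2 * real s) ^ s + (4 * real s / real d) ^ s"
  proof (intro add_mono mult_left_mono gaussian_even_moment_le w)
    have "(1 / 2 :: real) ^ d = exp (- ln 2) ^ d" by (simp add: exp_minus inverse_eq_divide)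
    also have "\<dots> = exp (- (real d * ln 2))" by (simp add: exp_of_nat_mult[symmetric])
    finally have "exp (3 * real d / 8) * (1 / 2) ^ d = exp (3 * real d / 8 + - (real d * ln 2))"
      by (simp only: exp_add)
    also have "\<dots> \<le> exp (- (real d / 4))"
    proof -
      \<comment> \<open>5/8 = 3/8 + 1/4 lies below 2/3, hence below ln 2, which leaves the decay
        rate 1/4.\<close>
      have "real d * (5 / 8) \<le> real d * ln 2" using ln2_ge_two_thirds by (intro mult_left_mono) auto
      then show ?thesis by simp
    qed
    also have "\<dots> \<le> (real s / (real d / 4)) ^ s" using d by (intro exp_neg_le_power) auto
    also have "real s / (real d / 4) = 4 * real s / real d" by simp
    finally show "exp (3 * real d / 8) * (1 / 2) ^ d \<le> (4 * real s / real d) ^ s" .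
  qed auto
  also have "\<dots> \<le> 2 * (8 * real s / real d) ^ s"
  proof -
    have "(4 / real d) ^ s * (2 * real s) ^ s = (8 * real s / real d) ^ s"
      by (simp only: power_mult_distrib[symmetric]) simp
    moreover have "(4 * real s / real d) ^ s \<le> (8 * real s / real d) ^ s"
      by (intro power_mono divide_right_mono) auto
    ultimately show ?thesis by linarith
  qed
  finally show ?thesis .
qed

lemma inner_unit_abs_le:
  assumes "v \<in> unit_sphere d" "w \<in> unit_sphere d"
  shows "\<bar>v \<bullet> w\<bar> \<le> 1"
  using scalar_prod_sq_le[OF unit_sphereD[OF assms(1)] unit_sphereD(1)[OF assms(2)]]
    unit_sphereD(2)[OF assms(2)] by (simp add: abs_square_le_1)

text \<open>Odd powers are reached by Cauchy-Schwarz from the even power 2s. Replacing s by D inside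
  the base makes the bound a pure s-th power, which can later be distributed over the
  samples.\<close>

lemma sphere_moment_le:
  assumes w: "w \<in> unit_sphere d" and d: "d \<ge> 1" and s: "s \<le> D"
  shows "(\<integral>v. (v \<bullet> w) ^ s \<partial>uniform_sphere d) \<le> 2 * sqrt (8 * real D / real d) ^ s"
proof -
  interpret U: subprob_space "uniform_sphere d" by (rule subprob_space_uniform_sphere[OF d])
  have m: "(\<lambda>v. (v \<bullet> w) ^ k) \<in> borel_measurable (uniform_sphere d)" for k
    using unit_sphereD[OF w] by (intro borel_measurable_power measurable_scalar_prod[of _ _ d] measurable_uniform_sphere) auto
  have i: "integrable (uniform_sphere d) (\<lambda>v. (v \<bullet> w) ^ k)" for k
    using inner_unit_abs_le[OF _ w] m
    by (intro U.integrable_const_bound[where B = 1]) (auto simp: power_abs intro!: power_le_one)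
  have i2: "integrable (uniform_sphere d) (\<lambda>v. ((v \<bullet> w) ^ s)\<^sup>2)"
    using i[of "2 * s"] by (simp add: power_mult[symmetric] mult.commute)
  have "(\<integral>v. 1 * (v \<bullet> w) ^ s \<partial>uniform_sphere d)\<^sup>2
    \<le> (\<integral>v. 1\<^sup>2 \<partial>uniform_sphere d) * (\<integral>v. ((v \<bullet> w) ^ s)\<^sup>2 \<partial>uniform_sphere d)"
    by (rule integral_Cauchy_Schwarz) (use m i2 in auto)
  also have "\<dots> \<le> 1 * (\<integral>v. ((v \<bullet> w) ^ s)\<^sup>2 \<partial>uniform_sphere d)"
    using U.subprob_measure_le_1 by (intro mult_right_mono) auto
  also have "\<dots> = (\<integral>v. (v \<bullet> w) ^ (2 * s) \<partial>uniform_sphere d)"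
    by (simp add: power_mult[symmetric] mult.commute)
  also have "\<dots> \<le> 2 * (8 * real s / real d) ^ s" by (rule sphere_even_moment_le[OF w d])
  also have "\<dots> \<le> 2 * (8 * real D / real d) ^ s"
    using s by (intro mult_left_mono power_mono divide_right_mono) auto
  also have "\<dots> \<le> (2 * sqrt (8 * real D / real d) ^ s)\<^sup>2"
  proof -
    have "(sqrt (8 * real D / real d) ^ s)\<^sup>2 = (sqrt (8 * real D / real d))\<^sup>2 ^ s"
      by (simp only: power_mult[symmetric] mult.commute)
    then show ?thesis by (simp add: power_mult_distrib)
  qed
  finally have "\<bar>\<integral>v. (v \<bullet> w) ^ s \<partial>uniform_sphere d\<bar> \<le> \<bar>2 * sqrt (8 * real D / real d) ^ s\<bar>"
    unfolding mult_1 by (simp only: abs_le_square_iff)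
  then show ?thesis by simp
qed

section \<open>The planted model\<close>

definition spike_law :: "nat \<Rightarrow> real \<Rightarrow> real \<Rightarrow> real vec \<Rightarrow> real vec measure" where
  "spike_law d m s v = distr (std_gaussian d) (Rd d) (spike m s v)"

lemma measurable_spike: "(\<lambda>(v, g). spike m s v g) \<in> Rd d \<Otimes>\<^sub>M Rd d \<rightarrow>\<^sub>M Rd d"
proof (rule measurable_RdI)
  let ?M = "Rd d \<Otimes>\<^sub>M Rd d"
  have fst: "fst \<in> ?M \<rightarrow>\<^sub>M Rd d" and snd: "snd \<in> ?M \<rightarrow>\<^sub>M Rd d" by simp_all
  fix i assume i: "i < d"
  have m: "(\<lambda>z. snd z $ i + (m + (s - 1) * (fst z \<bullet> snd z)) * fst z $ i) \<in> borel_measurable ?M"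
    by (intro borel_measurable_add borel_measurable_times borel_measurable_const
        measurable_Rd_component_comp[OF fst i] measurable_Rd_component_comp[OF snd i]
        measurable_scalar_prod[OF fst snd])
  have eq: "(case z of (v, g) \<Rightarrow> spike m s v g) $ i = snd z $ i + (m + (s - 1) * (fst z \<bullet> snd z)) * fst z $ i"
    if "z \<in> space ?M" for z
    using that i by (auto simp: space_pair_measure spike_index)
  show "(\<lambda>z. (case z of (v, g) \<Rightarrow> spike m s v g) $ i) \<in> borel_measurable ?M"
    by (subst measurable_cong[OF eq]) (assumption, rule m)
qed (auto simp: space_pair_measure)

lemma std_gaussian_prob_algebra: "std_gaussian d \<in> space (prob_algebra (Rd d))"
  by (simp add: space_prob_algebra prob_space_std_gaussian)

lemma measurable_spike_law: "spike_law d m s \<in> Rd d \<rightarrow>\<^sub>M prob_algebra (Rd d)"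
  unfolding spike_law_def[abs_def]
  by (rule measurable_distr_prob_space2[OF _ measurable_spike])
     (rule measurable_const[OF std_gaussian_prob_algebra])

lemma measurable_spike_snd: "v \<in> carrier_vec d \<Longrightarrow> spike m s v \<in> std_gaussian d \<rightarrow>\<^sub>M Rd d"
  using measurable_compose[OF measurable_Pair1'[of v "Rd d" "Rd d"] measurable_spike]
  by (simp cong: measurable_cong_sets)

lemma gaussian_rank_one:
  assumes v: "v \<in> carrier_vec d" "v \<bullet> v = 1" and s: "0 < s" "s \<le> 1"
  shows "gaussian d (m \<cdot>\<^sub>v v) (rank_one d (s\<^sup>2 - 1) v) = spike_law d m s v"
  unfolding gaussian_def spike_law_def mat_sqrt_rank_one[OF v s]
proof (rule distr_cong)
  fix g assume "g \<in> space (std_gaussian d)"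
  then show "m \<cdot>\<^sub>v v + rank_one d (s - 1) v *\<^sub>v g = spike m s v g"
    using v by (intro eq_vecI) (auto simp: rank_one_mult_vec spike_def algebra_simps)
qed auto

lemma measurable_mon: "mon d e \<in> borel_measurable (Rd d)"
  unfolding mon_def[abs_def]
  by (intro borel_measurable_prod borel_measurable_power measurable_Rd_component) auto

lemma spike_law_mon:
  assumes v: "v \<in> carrier_vec d"
  shows "integrable (spike_law d m s v) (mon d e)"
    and "(\<integral>y. mon d e y \<partial>spike_law d m s v) = (\<integral>g. mon d e (spike m s v g) \<partial>std_gaussian d)"
  unfolding spike_law_def
  using integrable_distr_eq[OF measurable_spike_snd[OF v] measurable_mon]
    integral_distr[OF measurable_spike_snd[OF v] measurable_mon] integrable_mon_spike[OF v]
  by auto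

lemma mon_power2: "(mon d e y)\<^sup>2 = mon d (\<lambda>j. 2 * e j) y"
  by (simp add: mon_def prod_power_distrib power_mult[symmetric] mult.commute)

text \<open>What counts is that the right-hand side is independent of \<open>v\<close>: it feeds the
  uniform moment bound required by \<open>bind_integral\<close>.\<close>

lemma integral_mon_hermite_le:
  assumes v: "v \<in> carrier_vec d" "v \<bullet> v = 1"
  shows "\<bar>\<integral>g. mon d e g * hermite k (v \<bullet> g) \<partial>std_gaussian d\<bar>
    \<le> sqrt (\<integral>g. mon d (\<lambda>j. 2 * e j) g \<partial>std_gaussian d) * sqrt (fact k)"
proof -
  have hm: "(\<lambda>g. hermite k (v \<bullet> g)) \<in> borel_measurable (std_gaussian d)"
    and h2: "integrable (std_gaussian d) (\<lambda>g. (hermite k (v \<bullet> g))\<^sup>2)"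
    using poly_grad_integrable(1)[OF poly_grad_hermite[of d k v]]
      poly_grad_integrable(1)[OF poly_grad_mult[OF poly_grad_hermite[of d k v] poly_grad_hermite[of d k v]]]
    by (auto simp: power2_eq_square dest: borel_measurable_integrable)
  have "(\<integral>g. mon d e g * hermite k (v \<bullet> g) \<partial>std_gaussian d)\<^sup>2
    \<le> (\<integral>g. (mon d e g)\<^sup>2 \<partial>std_gaussian d) * (\<integral>g. (hermite k (v \<bullet> g))\<^sup>2 \<partial>std_gaussian d)"
    by (rule integral_Cauchy_Schwarz[OF _ _ hm h2])
       (simp_all only: mon_power2 integrable_mon borel_measurable_integrable)
  also have "(\<integral>g. (hermite k (v \<bullet> g))\<^sup>2 \<partial>std_gaussian d) = fact k"
    using hermite_orthogonal[OF v v, of k k] v by (simp add: power2_eq_square)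
  finally show ?thesis
    unfolding mon_power2 by (metis real_sqrt_abs real_sqrt_le_mono real_sqrt_mult)
qed

text \<open>The noise is a finite mixture of N(x_j v, I) with index law \<open>J\<close>. Nodes and
  weights stay abstract; moment matching enters later only as the vanishing of three values of
  \<open>hermite_moment\<close>.\<close>

locale spiked_mixture =
  fixes d :: nat and \<eta> m s :: real and J :: "nat pmf" and x :: "nat \<Rightarrow> real"
  assumes \<eta>: "0 < \<eta>" "\<eta> < 1" and s: "0 < s" "s \<le> 1" and J: "finite (set_pmf J)"
begin

definition spike_mean :: "real vec \<Rightarrow> real vec" where
  "spike_mean v = m \<cdot>\<^sub>v v"

definition spike_cov :: "real vec \<Rightarrow> real mat" where
  "spike_cov v = rank_one d (s\<^sup>2 - 1) v"

definition spike_noise :: "real vec \<Rightarrow> real vec measure" where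
  "spike_noise v = measure_pmf J \<bind> (\<lambda>j. spike_law d (x j) 1 v)"

definition sample :: "real vec \<Rightarrow> real vec measure" where
  "sample v = contaminate \<eta> (spike_law d m s v) (spike_noise v)"

text \<open>The number \<lambda>_k of the overview. With s = 1 the recurrence collapses and
  \<open>hermite_coeff (x j) 1 k\<close> is the plain power (x j)^k.\<close>

definition hermite_moment :: "nat \<Rightarrow> real" where
  "hermite_moment k = (1 - \<eta>) * hermite_coeff m s k
     + \<eta> * (\<Sum>j\<in>set_pmf J. pmf J j * hermite_coeff (x j) 1 k)"

lemma measurable_spike_noise: "spike_noise \<in> Rd d \<rightarrow>\<^sub>M prob_algebra (Rd d)"
  unfolding spike_noise_def[abs_def]
proof (rule measurable_bind_prob_space2[where N = "count_space UNIV"])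
  show "(\<lambda>_. measure_pmf J) \<in> Rd d \<rightarrow>\<^sub>M prob_algebra (count_space UNIV)"
    by (intro measurable_const) (simp add: space_prob_algebra prob_space_measure_pmf)
  have "(\<lambda>z. (\<lambda>j z. spike_law d (x j) 1 (fst z)) (snd z) z) \<in> Rd d \<Otimes>\<^sub>M count_space UNIV \<rightarrow>\<^sub>M prob_algebra (Rd d)"
    by (rule measurable_compose_countable) (intro measurable_compose[OF measurable_fst measurable_spike_law], simp)
  then show "(\<lambda>(v, j). spike_law d (x j) 1 v) \<in> Rd d \<Otimes>\<^sub>M count_space UNIV \<rightarrow>\<^sub>M prob_algebra (Rd d)"
    by (simp add: case_prod_unfold)
qed

lemma measurable_sample: "sample \<in> Rd d \<rightarrow>\<^sub>M prob_algebra (Rd d)"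
  unfolding sample_def[abs_def] contaminate_def
proof (rule measurable_bind_prob_space2[where N = "count_space UNIV"])
  show "(\<lambda>_. measure_pmf (bernoulli_pmf \<eta>)) \<in> Rd d \<rightarrow>\<^sub>M prob_algebra (count_space UNIV)"
    by (intro measurable_const) (simp add: space_prob_algebra prob_space_measure_pmf)
  have "(\<lambda>z. (\<lambda>b z. if b then spike_noise (fst z) else spike_law d m s (fst z)) (snd z) z)
    \<in> Rd d \<Otimes>\<^sub>M count_space UNIV \<rightarrow>\<^sub>M prob_algebra (Rd d)"
  proof (rule measurable_compose_countable[where g = snd
        and f = "\<lambda>b z. if b then spike_noise (fst z) else spike_law d m s (fst z)"])
    fix b :: bool
    show "(\<lambda>z. if b then spike_noise (fst z) else spike_law d m s (fst z))
      \<in> Rd d \<Otimes>\<^sub>M count_space UNIV \<rightarrow>\<^sub>M prob_algebra (Rd d)"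
      by (cases b) (simp_all add: measurable_compose[OF measurable_fst measurable_spike_law]
          measurable_compose[OF measurable_fst measurable_spike_noise])
  qed simp
  then show "(\<lambda>(v, b). if b then spike_noise v else spike_law d m s v)
    \<in> Rd d \<Otimes>\<^sub>M count_space UNIV \<rightarrow>\<^sub>M prob_algebra (Rd d)"
    by (simp add: case_prod_unfold)
qed

lemma sample_law_eq: "v \<in> unit_sphere d \<Longrightarrow> sample_law d \<eta> spike_mean spike_cov spike_noise v = sample v"
  using s unit_sphereD[of v d]
  by (simp add: sample_law_def spike_mean_def spike_cov_def gaussian_rank_one sample_def)

lemma spike_law_prob_algebra: "v \<in> carrier_vec d \<Longrightarrow> spike_law d a b v \<in> space (prob_algebra (Rd d))"
  using measurable_space[OF measurable_spike_law] by simp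

lemma spike_noise_prob_algebra: "v \<in> carrier_vec d \<Longrightarrow> spike_noise v \<in> space (prob_algebra (Rd d))"
  using measurable_space[OF measurable_spike_noise] by simp

lemma sample_prob_algebra: "v \<in> carrier_vec d \<Longrightarrow> sample v \<in> space (prob_algebra (Rd d))"
  using measurable_space[OF measurable_sample] by simp

text \<open>Whitening divides the mean by s along \<open>v\<close>, giving exactly \<alpha> v; this
  fixes the relation m = \<alpha> s.\<close>

lemma valid_choice_spiked:
  assumes "m = \<alpha> * s" "0 < \<alpha>"
  shows "valid_choice d \<eta> \<alpha> spike_mean spike_cov spike_noise"
  unfolding valid_choice_def
proof (intro conjI ballI)
  fix v assume "v \<in> unit_sphere d"
  note v = unit_sphereD[OF this]
  show "spike_mean v \<in> carrier_vec d" using v by (simp add: spike_mean_def)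
  show "pos_def d (spike_cov v)"
    using v s by (auto simp: spike_cov_def power_le_one intro!: pos_def_rank_one)
  show "spike_noise v \<in> space (prob_algebra (Rd d))" using v by (intro spike_noise_prob_algebra)
  have "mat_inv_sqrt (spike_cov v) *\<^sub>v spike_mean v = \<alpha> \<cdot>\<^sub>v v"
    unfolding spike_cov_def spike_mean_def mat_inv_sqrt_rank_one[OF v s] using assms(1) s by simp
  then show "\<alpha> \<le> l2norm (mat_inv_sqrt (spike_cov v) *\<^sub>v spike_mean v)"
    using v assms by (simp add: l2norm_def real_sqrt_mult)
next
  have "sample \<in> uniform_sphere d \<rightarrow>\<^sub>M prob_algebra (Rd d)"
    by (rule measurable_uniform_sphere[OF measurable_sample])
  then show "sample_law d \<eta> spike_mean spike_cov spike_noise \<in> uniform_sphere d \<rightarrow>\<^sub>M prob_algebra (Rd d)"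
    by (subst measurable_cong[OF sample_law_eq]) auto
qed

lemma sample_mon:
  assumes v: "v \<in> carrier_vec d" "v \<bullet> v = 1"
  shows "integrable (sample v) (mon d e)"
    and "(\<Sum>j<d. e j) \<le> N \<Longrightarrow> (\<integral>y. mon d e y \<partial>sample v) = (\<Sum>k\<le>N. hermite_moment k / fact k
      * (\<integral>g. mon d e g * hermite k (v \<bullet> g) \<partial>std_gaussian d))"
proof -
  let ?B = "Max ((\<lambda>j. \<integral>y. \<bar>mon d e y\<bar> \<partial>spike_law d (x j) 1 v) ` set_pmf J)"
  \<comment> \<open>\<open>bind_pmf_integral\<close> wants one bound valid for all indices. Off the
    finite support \<open>x\<close> is arbitrary, so it is replaced there by a value taken on the
    support, which leaves the mixture unchanged.\<close>
  define x' where "x' j = (if j \<in> set_pmf J then x j else x (SOME j. j \<in> set_pmf J))" for j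
  have some: "(SOME j. j \<in> set_pmf J) \<in> set_pmf J" using set_pmf_not_empty[of J] by (simp add: some_in_eq)
  have sub: "spike_law d a b v \<in> space (subprob_algebra (Rd d))" for a b
    using measurable_space[OF measurable_prob_algebraD[OF measurable_spike_law]] v(1) by simp
  have noise: "spike_noise v = measure_pmf J \<bind> (\<lambda>j. spike_law d (x' j) 1 v)"
    unfolding spike_noise_def
    by (intro bind_measure_pmf_cong[where N = "Rd d"])
       (auto simp: x'_def sub)
  have bound: "(\<integral>y. \<bar>mon d e y\<bar> \<partial>spike_law d (x' j) 1 v) \<le> ?B" for j
    using J some by (intro Max_ge) (auto simp: x'_def)
  have noise_int: "integrable (spike_noise v) (mon d e)"
    "(\<integral>y. mon d e y \<partial>spike_noise v) = (\<Sum>j\<in>set_pmf J. pmf J j * (\<integral>y. mon d e y \<partial>spike_law d (x' j) 1 v))"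
    unfolding noise
    by (rule bind_pmf_integral[where N = "Rd d", OF J _ measurable_mon _ bound],
        rule spike_law_prob_algebra[OF v(1)], rule spike_law_mon(1)[OF v(1)])+
  have n: "integrable (spike_noise v) (mon d e)" by (rule noise_int)
  show "integrable (sample v) (mon d e)"
    unfolding sample_def
    by (rule contaminate_integral[OF \<eta> spike_law_prob_algebra[OF v(1)] spike_noise_prob_algebra[OF v(1)]
          measurable_mon spike_law_mon(1)[OF v(1)] n])
  assume N: "(\<Sum>j<d. e j) \<le> N"
  let ?I = "\<lambda>k. \<integral>g. mon d e g * hermite k (v \<bullet> g) \<partial>std_gaussian d"
  have "(\<integral>y. mon d e y \<partial>sample v) = (1 - \<eta>) * (\<integral>y. mon d e y \<partial>spike_law d m s v)
      + \<eta> * (\<integral>y. mon d e y \<partial>spike_noise v)"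
    unfolding sample_def
    by (rule contaminate_integral[OF \<eta> spike_law_prob_algebra[OF v(1)] spike_noise_prob_algebra[OF v(1)]
          measurable_mon spike_law_mon(1)[OF v(1)] n])
  also have "(\<integral>y. mon d e y \<partial>spike_noise v)
      = (\<Sum>j\<in>set_pmf J. pmf J j * (\<integral>y. mon d e y \<partial>spike_law d (x j) 1 v))"
    unfolding noise_int(2) by (intro sum.cong) (auto simp: x'_def)
  also have "\<dots> = (\<Sum>j\<in>set_pmf J. \<Sum>k\<le>N. pmf J j * hermite_coeff (x j) 1 k / fact k * ?I k)"
    unfolding spike_law_mon(2)[OF v(1)] integral_mon_spike[OF v N] sum_distrib_left by (simp add: mult_ac)
  also have "\<dots> = (\<Sum>k\<le>N. (\<Sum>j\<in>set_pmf J. pmf J j * hermite_coeff (x j) 1 k) / fact k * ?I k)"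
    unfolding sum_divide_distrib sum_distrib_right by (rule sum.swap)
  finally show "(\<integral>y. mon d e y \<partial>sample v) = (\<Sum>k\<le>N. hermite_moment k / fact k * ?I k)"
    unfolding spike_law_mon(2)[OF v(1)] integral_mon_spike[OF v N] sum_distrib_left
      sum.distrib[symmetric]
    unfolding hermite_moment_def by (simp add: algebra_simps add_divide_distrib diff_divide_distrib)
qed

text \<open>|y| \<le> 1 + y^2 replaces the absolute value by the monomial with doubled exponents;
  its expectation depends on \<open>v\<close> only through Hermite pairings, which are bounded
  uniformly.\<close>

lemma sample_abs_mon_bounded:
  obtains B where "\<And>v. v \<in> unit_sphere d \<Longrightarrow> (\<integral>y. \<bar>mon d e y\<bar> \<partial>sample v) \<le> B"
proof
  let ?e = "\<lambda>j. 2 * e j"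
  let ?N = "\<Sum>j<d. ?e j"
  let ?M = "sqrt (\<integral>g. mon d (\<lambda>j. 2 * ?e j) g \<partial>std_gaussian d)"
  fix v assume "v \<in> unit_sphere d"
  note v = unit_sphereD[OF this]
  interpret prob_space "sample v" using sample_prob_algebra[OF v(1)] by (simp add: space_prob_algebra)
  have le: "\<bar>y\<bar> \<le> 1 + y\<^sup>2" for y :: real
    using sum_squares_bound[of "\<bar>y\<bar>" 1] by simp
  have "(\<integral>y. \<bar>mon d e y\<bar> \<partial>sample v) \<le> (\<integral>y. 1 + mon d ?e y \<partial>sample v)"
  proof (rule integral_mono[OF integrable_abs[OF sample_mon(1)[OF v]]])
    show "integrable (sample v) (\<lambda>y. 1 + mon d ?e y)" using sample_mon(1)[OF v] by simp
    show "\<bar>mon d e y\<bar> \<le> 1 + mon d ?e y" for y unfolding mon_power2[symmetric] by (rule le)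
  qed
  also have "\<dots> = 1 + (\<integral>y. mon d ?e y \<partial>sample v)"
    using sample_mon(1)[OF v] by (subst Bochner_Integration.integral_add) (auto simp: prob_space)
  also have "(\<integral>y. mon d ?e y \<partial>sample v) = (\<Sum>k\<le>?N. hermite_moment k / fact k
      * (\<integral>g. mon d ?e g * hermite k (v \<bullet> g) \<partial>std_gaussian d))"
    by (rule sample_mon(2)[OF v order_refl])
  also have "\<dots> \<le> (\<Sum>k\<le>?N. \<bar>hermite_moment k / fact k\<bar> * (?M * sqrt (fact k)))"
  proof (rule sum_mono)
    fix k
    let ?I = "\<integral>g. mon d ?e g * hermite k (v \<bullet> g) \<partial>std_gaussian d"
    have "hermite_moment k / fact k * ?I \<le> \<bar>hermite_moment k / fact k\<bar> * \<bar>?I\<bar>"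
      using abs_ge_self[of "hermite_moment k / fact k * ?I"] by (simp only: abs_mult)
    also have "\<dots> \<le> \<bar>hermite_moment k / fact k\<bar> * (?M * sqrt (fact k))"
      by (rule mult_left_mono[OF integral_mon_hermite_le[OF v]]) simp
    finally show "hermite_moment k / fact k * ?I \<le> \<bar>hermite_moment k / fact k\<bar> * (?M * sqrt (fact k))" .
  qed
  finally show "(\<integral>y. \<bar>mon d e y\<bar> \<partial>sample v)
    \<le> 1 + (\<Sum>k\<le>?N. \<bar>hermite_moment k / fact k\<bar> * (?M * sqrt (fact k)))" by simp
qed

section \<open>Independent samples and the truncated likelihood ratio\<close>

abbreviation samples :: "nat \<Rightarrow> real vec \<Rightarrow> (nat \<Rightarrow> real vec) measure" where
  "samples n v \<equiv> PiM {..<n} (\<lambda>_. sample v)"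

definition mons :: "nat \<Rightarrow> (nat \<Rightarrow> nat \<Rightarrow> nat) \<Rightarrow> (nat \<Rightarrow> real vec) \<Rightarrow> real" where
  "mons n e y = (\<Prod>i<n. mon d (e i) (y i))"

text \<open>Degree vectors are extensional functions, so two of them coincide as soon as they agree
  below n.\<close>

definition degrees :: "nat \<Rightarrow> nat \<Rightarrow> (nat \<Rightarrow> nat) set" where
  "degrees n D = {k \<in> PiE {..<n} (\<lambda>_. {..D}). (\<Sum>i<n. k i) \<le> D}"

text \<open>For one fixed direction \<open>v\<close>, the part of degree at most D of the Hermite
  series of the likelihood ratio, written through its coefficients. Averaging over \<open>v\<close>
  is left to \<open>kernel_integral_bound\<close>.\<close>

definition low_degree_ratio :: "nat \<Rightarrow> nat \<Rightarrow> real vec \<Rightarrow> (nat \<Rightarrow> real vec) \<Rightarrow> real" where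
  "low_degree_ratio n D v y = (\<Sum>k\<in>degrees n D. \<Prod>i<n. hermite_moment (k i) / fact (k i) * hermite (k i) (v \<bullet> y i))"

lemma finite_degrees: "finite (degrees n D)"
  unfolding degrees_def by (rule finite_subset[of _ "PiE {..<n} (\<lambda>_. {..D})"]) (auto intro: finite_PiE)

lemma std_gaussian_samples:
  fixes h :: "nat \<Rightarrow> real vec \<Rightarrow> real"
  assumes "\<And>i. i < n \<Longrightarrow> integrable (std_gaussian d) (h i)"
  shows "integrable (null_law n d) (\<lambda>y. \<Prod>i<n. h i (y i))"
    and "(\<integral>y. (\<Prod>i<n. h i (y i)) \<partial>null_law n d) = (\<Prod>i<n. \<integral>g. h i g \<partial>std_gaussian d)"
proof -
  interpret product_prob_space "\<lambda>_. std_gaussian d" "{..<n}"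
    by (intro product_prob_spaceI prob_space_std_gaussian)
  show "integrable (null_law n d) (\<lambda>y. \<Prod>i<n. h i (y i))"
    unfolding null_law_def using assms by (intro product_integrable_prod) auto
  show "(\<integral>y. (\<Prod>i<n. h i (y i)) \<partial>null_law n d) = (\<Prod>i<n. \<integral>g. h i g \<partial>std_gaussian d)"
    unfolding null_law_def using assms by (intro product_integral_prod) auto
qed

lemma samples_mons:
  assumes v: "v \<in> unit_sphere d"
  shows "integrable (samples n v) (mons n e)"
    and "(\<integral>y. mons n e y \<partial>samples n v) = (\<Prod>i<n. \<integral>y. mon d (e i) y \<partial>sample v)"
    and "(\<integral>y. \<bar>mons n e y\<bar> \<partial>samples n v) = (\<Prod>i<n. \<integral>y. \<bar>mon d (e i) y\<bar> \<partial>sample v)"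
proof -
  note v' = unit_sphereD[OF v]
  interpret product_prob_space "\<lambda>_. sample v" "{..<n}"
    using sample_prob_algebra[OF v'(1)] by (intro product_prob_spaceI) (auto simp: space_prob_algebra)
  show "integrable (samples n v) (mons n e)"
    unfolding mons_def[abs_def] by (intro product_integrable_prod sample_mon(1)[OF v']) auto
  show "(\<integral>y. mons n e y \<partial>samples n v) = (\<Prod>i<n. \<integral>y. mon d (e i) y \<partial>sample v)"
    unfolding mons_def[abs_def] by (intro product_integral_prod sample_mon(1)[OF v']) auto
  show "(\<integral>y. \<bar>mons n e y\<bar> \<partial>samples n v) = (\<Prod>i<n. \<integral>y. \<bar>mon d (e i) y\<bar> \<partial>sample v)"
    unfolding mons_def[abs_def] abs_prod
    by (intro product_integral_prod integrable_abs sample_mon(1)[OF v']) auto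
qed

lemma integrable_mons_low_degree_ratio:
  "integrable (null_law n d) (\<lambda>y. mons n e y * low_degree_ratio n D v y)"
  unfolding low_degree_ratio_def mons_def sum_distrib_left prod.distrib[symmetric]
  by (intro Bochner_Integration.integrable_sum std_gaussian_samples(1))
     (simp only: mult.left_commute[of "mon _ _ _"], intro integrable_mult_right integrable_mon_hermite)

text \<open>Expanding the product of the one-sample expansions gives all vectors with entries at
  most D. If their total exceeds D, some entry exceeds the degree of the monomial in that sample,
  and the corresponding factor vanishes.\<close>

lemma integral_samples_mons:
  assumes v: "v \<in> unit_sphere d" and e: "(\<Sum>i<n. \<Sum>j<d. e i j) \<le> D"
  shows "(\<integral>y. mons n e y \<partial>samples n v) = (\<integral>y. mons n e y * low_degree_ratio n D v y \<partial>null_law n d)"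
proof -
  note v' = unit_sphereD[OF v]
  let ?I = "\<lambda>i k. \<integral>g. mon d (e i) g * hermite k (v \<bullet> g) \<partial>std_gaussian d"
  let ?a = "\<lambda>k. hermite_moment k / fact k"
  have le: "(\<Sum>j<d. e i j) \<le> D" if "i < n" for i
  proof -
    have "(\<Sum>j<d. e i j) \<le> (\<Sum>i<n. \<Sum>j<d. e i j)"
      using that by (intro member_le_sum[where f = "\<lambda>i. \<Sum>j<d. e i j"]) auto
    then show ?thesis using e by simp
  qed
  have "(\<integral>y. mons n e y \<partial>samples n v) = (\<Prod>i<n. \<Sum>k\<le>D. ?a k * ?I i k)"
    unfolding samples_mons(2)[OF v] by (intro prod.cong refl sample_mon(2)[OF v'] le) simp
  also have "\<dots> = (\<Sum>k\<in>PiE {..<n} (\<lambda>_. {..D}). \<Prod>i<n. ?a (k i) * ?I i (k i))"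
    by (intro prod_sum_PiE) auto
  also have "\<dots> = (\<Sum>k\<in>degrees n D. \<Prod>i<n. ?a (k i) * ?I i (k i))"
  proof (intro sum.mono_neutral_right ballI)
    show "finite (PiE {..<n} (\<lambda>_. {..D}))" by (intro finite_PiE) auto
    fix k assume k: "k \<in> PiE {..<n} (\<lambda>_. {..D}) - degrees n D"
    then have "\<not> (\<Sum>i<n. k i) \<le> D" unfolding degrees_def by blast
    then have "D < (\<Sum>i<n. k i)" by linarith
    have "\<exists>i<n. (\<Sum>j<d. e i j) < k i"
    proof (rule ccontr)
      assume "\<not> ?thesis"
      then have "(\<Sum>i<n. k i) \<le> (\<Sum>i<n. \<Sum>j<d. e i j)" by (intro sum_mono) (metis lessThan_iff not_less)
      then show False using e \<open>D < (\<Sum>i<n. k i)\<close> by linarith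
    qed
    then obtain i where "i < n" "?I i (k i) = 0"
      using integral_mon_hermite_eq_0[OF v'] by blast
    then show "(\<Prod>i<n. ?a (k i) * ?I i (k i)) = 0" by (intro prod_zero) auto
  qed (auto simp: degrees_def)
  also have "\<dots> = (\<Sum>k\<in>degrees n D. \<integral>y. (\<Prod>i<n. ?a (k i) * (mon d (e i) (y i) * hermite (k i) (v \<bullet> y i))) \<partial>null_law n d)"
    by (intro sum.cong refl, subst std_gaussian_samples(2))
       (intro integrable_mult_right integrable_mon_hermite, simp)
  also have "\<dots> = (\<integral>y. (\<Sum>k\<in>degrees n D. \<Prod>i<n. ?a (k i) * (mon d (e i) (y i) * hermite (k i) (v \<bullet> y i))) \<partial>null_law n d)"
    by (intro Bochner_Integration.integral_sum[symmetric] std_gaussian_samples(1) integrable_mult_right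
        integrable_mon_hermite)
  also have "\<dots> = (\<integral>y. mons n e y * low_degree_ratio n D v y \<partial>null_law n d)"
    unfolding low_degree_ratio_def mons_def sum_distrib_left prod.distrib[symmetric]
    by (simp only: mult.left_commute)
  finally show ?thesis .
qed

lemma integrable_hermite_hermite:
  "integrable (std_gaussian d) (\<lambda>g. hermite k (v \<bullet> g) * hermite l (w \<bullet> g))"
  by (rule poly_grad_integrable[OF poly_grad_mult[OF poly_grad_hermite poly_grad_hermite]])

text \<open>Sample by sample, orthogonality kills every pair of distinct degree vectors, so only the
  diagonal of the double sum survives, with one factor k! against two divisions by k!.\<close>

lemma low_degree_ratio_inner:
  assumes v: "v \<in> unit_sphere d" and w: "w \<in> unit_sphere d"
  shows "integrable (null_law n d) (\<lambda>y. low_degree_ratio n D v y * low_degree_ratio n D w y)"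
    and "(\<integral>y. low_degree_ratio n D v y * low_degree_ratio n D w y \<partial>null_law n d)
      = (\<Sum>k\<in>degrees n D. \<Prod>i<n. (hermite_moment (k i))\<^sup>2 / fact (k i) * (v \<bullet> w) ^ k i)"
proof -
  note v' = unit_sphereD[OF v] and w' = unit_sphereD[OF w]
  let ?a = "\<lambda>k. hermite_moment k / fact k"
  let ?t = "\<lambda>k l (y :: nat \<Rightarrow> real vec). \<Prod>i<n. (?a (k i) * ?a (l i)) * (hermite (k i) (v \<bullet> y i) * hermite (l i) (w \<bullet> y i))"
  have eq: "low_degree_ratio n D v y * low_degree_ratio n D w y = (\<Sum>k\<in>degrees n D. \<Sum>l\<in>degrees n D. ?t k l y)" for y
    unfolding low_degree_ratio_def sum_product prod.distrib[symmetric] by (simp only: mult_ac)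
  have i: "integrable (null_law n d) (?t k l)" for k l
    by (intro std_gaussian_samples(1) integrable_mult_right integrable_hermite_hermite)
  show "integrable (null_law n d) (\<lambda>y. low_degree_ratio n D v y * low_degree_ratio n D w y)"
    unfolding eq by (intro Bochner_Integration.integrable_sum i)
  have I: "(\<integral>y. ?t k l y \<partial>null_law n d)
     = (if k = l then \<Prod>i<n. (hermite_moment (k i))\<^sup>2 / fact (k i) * (v \<bullet> w) ^ k i else 0)"
    if kl: "k \<in> degrees n D" "l \<in> degrees n D" for k l
  proof -
    have "(\<integral>y. ?t k l y \<partial>null_law n d)
      = (\<Prod>i<n. ?a (k i) * ?a (l i) * (if l i = k i then fact (l i) * (w \<bullet> v) ^ l i else 0))"
      by (subst std_gaussian_samples(2))
         (intro integrable_mult_right integrable_hermite_hermite, simp add: hermite_orthogonal[OF w' v'])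
    also have "\<dots> = (if k = l then \<Prod>i<n. (hermite_moment (k i))\<^sup>2 / fact (k i) * (v \<bullet> w) ^ k i else 0)"
    proof (cases "k = l")
      case True
      then show ?thesis
        using comm_scalar_prod[OF v'(1) w'(1)] by (simp add: power2_eq_square field_simps)
    next
      case False
      then obtain i where "i < n" "k i \<noteq> l i"
        using kl PiE_ext[of k "{..<n}" "\<lambda>_. {..D}" l] by (auto simp: degrees_def)
      then show ?thesis using False by (auto intro!: prod_zero)
    qed
    finally show ?thesis .
  qed
  have "(\<integral>y. low_degree_ratio n D v y * low_degree_ratio n D w y \<partial>null_law n d)
    = (\<Sum>k\<in>degrees n D. \<integral>y. (\<Sum>l\<in>degrees n D. ?t k l y) \<partial>null_law n d)"
    unfolding eq by (rule Bochner_Integration.integral_sum) (intro Bochner_Integration.integrable_sum i)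
  also have "\<dots> = (\<Sum>k\<in>degrees n D. \<Sum>l\<in>degrees n D. \<integral>y. ?t k l y \<partial>null_law n d)"
    by (intro sum.cong refl Bochner_Integration.integral_sum i)
  also have "\<dots> = (\<Sum>k\<in>degrees n D. \<Prod>i<n. (hermite_moment (k i))\<^sup>2 / fact (k i) * (v \<bullet> w) ^ k i)"
  proof (intro sum.cong refl)
    fix k assume k: "k \<in> degrees n D"
    have "(\<Sum>l\<in>degrees n D. \<integral>y. ?t k l y \<partial>null_law n d)
      = (\<Sum>l\<in>degrees n D. if k = l then \<Prod>i<n. (hermite_moment (k i))\<^sup>2 / fact (k i) * (v \<bullet> w) ^ k i else 0)"
      by (intro sum.cong refl I k)
    also have "\<dots> = (\<Prod>i<n. (hermite_moment (k i))\<^sup>2 / fact (k i) * (v \<bullet> w) ^ k i)"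
      using finite_degrees k by simp
    finally show "(\<Sum>l\<in>degrees n D. \<integral>y. ?t k l y \<partial>null_law n d)
      = (\<Prod>i<n. (hermite_moment (k i))\<^sup>2 / fact (k i) * (v \<bullet> w) ^ k i)" .
  qed
  finally show "(\<integral>y. low_degree_ratio n D v y * low_degree_ratio n D w y \<partial>null_law n d)
      = (\<Sum>k\<in>degrees n D. \<Prod>i<n. (hermite_moment (k i))\<^sup>2 / fact (k i) * (v \<bullet> w) ^ k i)" .
qed

lemma measurable_hermite: "hermite k \<in> borel_measurable borel"
  by (induction k rule: induct_nat_012) (simp_all add: hermite_Suc)

lemma measurable_low_degree_ratio:
  "(\<lambda>(v, y). low_degree_ratio n D v y) \<in> borel_measurable (uniform_sphere d \<Otimes>\<^sub>M null_law n d)"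
proof -
  let ?M = "uniform_sphere d \<Otimes>\<^sub>M null_law n d"
  have v: "fst \<in> ?M \<rightarrow>\<^sub>M Rd d"
    by (rule measurable_compose[OF measurable_fst measurable_uniform_sphere]) simp
  have y: "(\<lambda>z. snd z i) \<in> ?M \<rightarrow>\<^sub>M Rd d" if "i < n" for i
  proof -
    have "(\<lambda>y. y i) \<in> null_law n d \<rightarrow>\<^sub>M std_gaussian d"
      unfolding null_law_def using that by (intro measurable_component_singleton) auto
    then have "(\<lambda>y. y i) \<in> null_law n d \<rightarrow>\<^sub>M Rd d" by (simp cong: measurable_cong_sets)
    then show ?thesis by (rule measurable_compose[OF measurable_snd])
  qed
  show ?thesis
    unfolding low_degree_ratio_def case_prod_unfold
    by (intro borel_measurable_sum borel_measurable_prod borel_measurable_times borel_measurable_const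
        measurable_compose[OF measurable_scalar_prod[OF v y] measurable_hermite]) auto
qed

section \<open>Polynomials under the planted law and the bound on the advantage\<close>

lemma poly_funs_mons:
  assumes "f \<in> poly_funs n d D"
  obtains c where "f = (\<lambda>y. \<Sum>e\<in>exponents n d D. c e * mons n e y)"
  using assms by (auto simp: poly_funs_def mons_def mon_def)

lemma integrable_null_mons_mons: "integrable (null_law n d) (\<lambda>y. mons n e y * mons n e' y)"
  unfolding mons_def prod.distrib[symmetric]
  by (intro std_gaussian_samples(1)) (rule poly_grad_integrable[OF poly_grad_mult[OF poly_grad_mon poly_grad_mon]])

lemma integrable_null_mons: "integrable (null_law n d) (mons n e)"
  unfolding mons_def[abs_def] by (intro std_gaussian_samples(1) integrable_mon)

lemma planted_law_eq:
  "planted_law n d \<eta> spike_mean spike_cov spike_noise = uniform_sphere d \<bind> samples n"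
  unfolding planted_law_def
  by (intro bind_cong refl) (simp add: sample_law_eq)

text \<open>The integrability half gives the advantage its meaning, the Bochner integral being 0 by
  default. The other half needs only linearity, because the truncated ratio reproduces the
  expectation of every monomial for each fixed \<open>v\<close>.\<close>

lemma planted_poly_funs:
  assumes d: "d \<ge> 1" and f: "f \<in> poly_funs n d D"
  shows "integrable (planted_law n d \<eta> spike_mean spike_cov spike_noise) f"
    and "(\<integral>y. f y \<partial>planted_law n d \<eta> spike_mean spike_cov spike_noise)
      = (\<integral>v. (\<integral>y. f y * low_degree_ratio n D v y \<partial>null_law n d) \<partial>uniform_sphere d)"
proof -
  interpret U: subprob_space "uniform_sphere d" by (rule subprob_space_uniform_sphere[OF d])
  obtain c where f: "f = (\<lambda>y. \<Sum>e\<in>exponents n d D. c e * mons n e y)"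
    using poly_funs_mons[OF f] by blast
  have "\<forall>a. \<exists>B. \<forall>v\<in>unit_sphere d. (\<integral>y. \<bar>mon d a y\<bar> \<partial>sample v) \<le> B"
  proof
    fix a
    obtain B where "\<And>v. v \<in> unit_sphere d \<Longrightarrow> (\<integral>y. \<bar>mon d a y\<bar> \<partial>sample v) \<le> B"
      using sample_abs_mon_bounded[where e = a] by blast
    then show "\<exists>B. \<forall>v\<in>unit_sphere d. (\<integral>y. \<bar>mon d a y\<bar> \<partial>sample v) \<le> B" by blast
  qed
  from choice[OF this] obtain B
    where B: "\<And>a v. v \<in> unit_sphere d \<Longrightarrow> (\<integral>y. \<bar>mon d a y\<bar> \<partial>sample v) \<le> B a"
    by blast
  have K: "samples n \<in> uniform_sphere d \<rightarrow>\<^sub>M subprob_algebra (PiM {..<n} (\<lambda>_. Rd d))"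
    by (intro measurable_prob_algebraD measurable_PiM_prob_algebra measurable_uniform_sphere measurable_sample) auto
  have mm: "mons n e \<in> borel_measurable (PiM {..<n} (\<lambda>_. Rd d))" for e
    unfolding mons_def[abs_def]
  proof (intro borel_measurable_prod)
    fix i assume "i \<in> {..<n}"
    then show "(\<lambda>y. mon d (e i) (y i)) \<in> borel_measurable (PiM {..<n} (\<lambda>_. Rd d))"
      by (rule measurable_compose[OF measurable_component_singleton[of i "{..<n}" "\<lambda>_. Rd d"] measurable_mon])
  qed
  have fm: "f \<in> borel_measurable (PiM {..<n} (\<lambda>_. Rd d))"
    unfolding f by (intro borel_measurable_sum borel_measurable_times borel_measurable_const mm)
  have fi: "integrable (samples n v) f" if "v \<in> space (uniform_sphere d)" for v
    unfolding f using that by (intro Bochner_Integration.integrable_sum integrable_mult_right samples_mons(1)) simp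
  have fB: "(\<integral>y. \<bar>f y\<bar> \<partial>samples n v) \<le> (\<Sum>e\<in>exponents n d D. \<bar>c e\<bar> * (\<Prod>i<n. B (e i)))"
    if "v \<in> space (uniform_sphere d)" for v
  proof -
    have v: "v \<in> unit_sphere d" using that by simp
    have "(\<integral>y. \<bar>f y\<bar> \<partial>samples n v) \<le> (\<integral>y. (\<Sum>e\<in>exponents n d D. \<bar>c e\<bar> * \<bar>mons n e y\<bar>) \<partial>samples n v)"
    proof (rule integral_mono[OF integrable_abs[OF fi[OF that]]])
      show "integrable (samples n v) (\<lambda>y. \<Sum>e\<in>exponents n d D. \<bar>c e\<bar> * \<bar>mons n e y\<bar>)"
        by (intro Bochner_Integration.integrable_sum integrable_mult_right integrable_abs samples_mons(1)[OF v])
      show "\<bar>f y\<bar> \<le> (\<Sum>e\<in>exponents n d D. \<bar>c e\<bar> * \<bar>mons n e y\<bar>)" for y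
        unfolding f abs_mult[symmetric] by (rule sum_abs)
    qed
    also have "\<dots> = (\<Sum>e\<in>exponents n d D. \<bar>c e\<bar> * (\<integral>y. \<bar>mons n e y\<bar> \<partial>samples n v))"
      by (subst Bochner_Integration.integral_sum)
         (intro integrable_mult_right integrable_abs samples_mons(1)[OF v], simp)
    also have "\<dots> \<le> (\<Sum>e\<in>exponents n d D. \<bar>c e\<bar> * (\<Prod>i<n. B (e i)))"
      unfolding samples_mons(3)[OF v]
      by (intro sum_mono mult_left_mono prod_mono conjI B v integral_nonneg_AE) auto
    finally show ?thesis .
  qed
  note bind = bind_integral[OF U.finite_measure_axioms U.subprob_not_empty K fm fi fB]
  show "integrable (planted_law n d \<eta> spike_mean spike_cov spike_noise) f"
    unfolding planted_law_eq by (rule bind)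
  have "(\<integral>y. f y \<partial>planted_law n d \<eta> spike_mean spike_cov spike_noise)
     = (\<integral>v. (\<integral>y. f y \<partial>samples n v) \<partial>uniform_sphere d)"
    unfolding planted_law_eq by (rule bind)
  also have "\<dots> = (\<integral>v. (\<integral>y. f y * low_degree_ratio n D v y \<partial>null_law n d) \<partial>uniform_sphere d)"
  proof (rule Bochner_Integration.integral_cong[OF refl])
    fix v assume "v \<in> space (uniform_sphere d)"
    then have v: "v \<in> unit_sphere d" by simp
    have "(\<integral>y. f y \<partial>samples n v) = (\<Sum>e\<in>exponents n d D. c e * (\<integral>y. mons n e y \<partial>samples n v))"
      unfolding f by (subst Bochner_Integration.integral_sum)
         (intro integrable_mult_right samples_mons(1)[OF v], simp)
    also have "\<dots> = (\<Sum>e\<in>exponents n d D. c e * (\<integral>y. mons n e y * low_degree_ratio n D v y \<partial>null_law n d))"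
      by (intro sum.cong refl arg_cong[where f = "\<lambda>z. c _ * z"] integral_samples_mons[OF v]) (simp add: exponents_def)
    also have "\<dots> = (\<integral>y. (\<Sum>e\<in>exponents n d D. c e * (mons n e y * low_degree_ratio n D v y)) \<partial>null_law n d)"
      by (subst Bochner_Integration.integral_sum)
         (intro integrable_mult_right integrable_mons_low_degree_ratio, simp)
    finally show "(\<integral>y. f y \<partial>samples n v) = (\<integral>y. f y * low_degree_ratio n D v y \<partial>null_law n d)"
      unfolding f sum_distrib_right by (simp only: mult.assoc)
  qed
  finally show "(\<integral>y. f y \<partial>planted_law n d \<eta> spike_mean spike_cov spike_noise)
      = (\<integral>v. (\<integral>y. f y * low_degree_ratio n D v y \<partial>null_law n d) \<partial>uniform_sphere d)" .
qed

text \<open>The quotient of each admissible \<open>f\<close> is at most the norm of the averaged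
  truncated ratio; the hypothesis bounds the square of that norm, in the form computed by
  \<open>low_degree_ratio_inner\<close>.\<close>

lemma advantage_le:
  assumes d: "d \<ge> 1"
    and R: "(\<integral>v. (\<integral>w. (\<Sum>k\<in>degrees n D. \<Prod>i<n. (hermite_moment (k i))\<^sup>2 / fact (k i) * (v \<bullet> w) ^ k i)
      \<partial>uniform_sphere d) \<partial>uniform_sphere d) \<le> R"
  shows "advantage n d D (planted_law n d \<eta> spike_mean spike_cov spike_noise) (null_law n d) \<le> ereal (sqrt R)"
  unfolding advantage_def
proof (rule SUP_least)
  let ?P = "planted_law n d \<eta> spike_mean spike_cov spike_noise"
  let ?N = "null_law n d"
  let ?H = "low_degree_ratio n D"
  fix f assume "f \<in> {f \<in> poly_funs n d D. 0 < (\<integral>y. (f y)\<^sup>2 \<partial>?N)}"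
  then have f: "f \<in> poly_funs n d D" and pos: "0 < (\<integral>y. (f y)\<^sup>2 \<partial>?N)" by auto
  obtain c where fc: "f = (\<lambda>y. \<Sum>e\<in>exponents n d D. c e * mons n e y)"
    using poly_funs_mons[OF f] by blast
  have "(f y)\<^sup>2 = (\<Sum>e\<in>exponents n d D. \<Sum>e'\<in>exponents n d D. (c e * c e') * (mons n e y * mons n e' y))" for y
    unfolding fc power2_eq_square sum_product by (simp only: mult_ac)
  then have f2: "integrable ?N (\<lambda>y. (f y)\<^sup>2)"
    by (simp only:) (intro Bochner_Integration.integrable_sum integrable_mult_right integrable_null_mons_mons)
  have "integrable ?N f"
    unfolding fc by (intro Bochner_Integration.integrable_sum integrable_mult_right integrable_null_mons)
  then have fm: "f \<in> borel_measurable ?N" by (rule borel_measurable_integrable)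
  have N: "prob_space ?N"
    unfolding null_law_def by (intro prob_space_PiM prob_space_std_gaussian)
  have "(\<integral>v. (\<integral>y. f y * ?H v y \<partial>?N) \<partial>uniform_sphere d) \<le> sqrt R * sqrt (\<integral>y. (f y)\<^sup>2 \<partial>?N)"
  proof (rule kernel_integral_bound[OF subprob_space_uniform_sphere[OF d] N measurable_low_degree_ratio _ _ _ fm f2,
        where B = "\<Sum>k\<in>degrees n D. \<Prod>i<n. (hermite_moment (k i))\<^sup>2 / fact (k i)"])
    fix v assume "v \<in> space (uniform_sphere d)"
    then have v: "v \<in> unit_sphere d" by simp
    show "integrable ?N (\<lambda>y. (?H v y)\<^sup>2)"
      unfolding power2_eq_square by (rule low_degree_ratio_inner[OF v v])
    show "(\<integral>y. (?H v y)\<^sup>2 \<partial>?N) \<le> (\<Sum>k\<in>degrees n D. \<Prod>i<n. (hermite_moment (k i))\<^sup>2 / fact (k i))"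
      using low_degree_ratio_inner(2)[OF v v, of n D] unit_sphereD(2)[OF v] by (simp add: power2_eq_square)
  next
    have "(\<integral>v. (\<integral>w. (\<integral>y. ?H v y * ?H w y \<partial>?N) \<partial>uniform_sphere d) \<partial>uniform_sphere d)
      = (\<integral>v. (\<integral>w. (\<Sum>k\<in>degrees n D. \<Prod>i<n. (hermite_moment (k i))\<^sup>2 / fact (k i) * (v \<bullet> w) ^ k i)
          \<partial>uniform_sphere d) \<partial>uniform_sphere d)"
      by (intro Bochner_Integration.integral_cong refl) (simp add: low_degree_ratio_inner(2))
    then show "(\<integral>v. (\<integral>w. (\<integral>y. ?H v y * ?H w y \<partial>?N) \<partial>uniform_sphere d) \<partial>uniform_sphere d) \<le> R"
      using R by simp
  qed
  then have "(\<integral>y. f y \<partial>?P) \<le> sqrt R * sqrt (\<integral>y. (f y)\<^sup>2 \<partial>?N)"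
    unfolding planted_poly_funs(2)[OF d f] .
  then show "ereal ((\<integral>y. f y \<partial>?P) / sqrt (\<integral>y. (f y)\<^sup>2 \<partial>?N)) \<le> ereal (sqrt R)"
    using pos by (simp add: divide_le_eq)
qed

text \<open>Splitting \<open>r^|k|\<close> over the samples turns the sum over degree vectors into an \<open>n\<close>-th power.\<close>

lemma second_moment_le:
  fixes n D :: nat
  assumes d: "d \<ge> 1"
  defines "r \<equiv> sqrt (8 * real D / real d)"
  shows "(\<integral>v. (\<integral>w. (\<Sum>k\<in>degrees n D. \<Prod>i<n. (hermite_moment (k i))\<^sup>2 / fact (k i) * (v \<bullet> w) ^ k i)
      \<partial>uniform_sphere d) \<partial>uniform_sphere d) \<le> 2 * (\<Sum>k\<le>D. (hermite_moment k)\<^sup>2 / fact k * r ^ k) ^ n"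
proof -
  interpret U: subprob_space "uniform_sphere d" by (rule subprob_space_uniform_sphere[OF d])
  let ?a = "\<lambda>k. (hermite_moment k)\<^sup>2 / fact k"
  let ?R = "2 * (\<Sum>k\<le>D. ?a k * r ^ k) ^ n"
  have a0: "0 \<le> ?a k" for k by simp
  have r0: "0 \<le> r" by (simp add: r_def)
  have R0: "0 \<le> ?R" using a0 r0 by (intro mult_nonneg_nonneg zero_le_power sum_nonneg) auto
  have inner: "(\<integral>w. (\<Sum>k\<in>degrees n D. \<Prod>i<n. ?a (k i) * (v \<bullet> w) ^ k i) \<partial>uniform_sphere d) \<le> ?R"
    if v: "v \<in> unit_sphere d" for v
  proof -
    note v' = unit_sphereD[OF v]
    have m: "(\<lambda>w. (v \<bullet> w) ^ k) \<in> borel_measurable (uniform_sphere d)" for k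
      using v' by (intro borel_measurable_power measurable_scalar_prod[of _ _ d] measurable_uniform_sphere) auto
    have i: "integrable (uniform_sphere d) (\<lambda>w. (v \<bullet> w) ^ k)" for k
      using inner_unit_abs_le[OF v] m
      by (intro U.integrable_const_bound[where B = 1]) (auto simp: power_abs intro!: power_le_one)
    have "(\<integral>w. (\<Sum>k\<in>degrees n D. \<Prod>i<n. ?a (k i) * (v \<bullet> w) ^ k i) \<partial>uniform_sphere d)
      = (\<integral>w. (\<Sum>k\<in>degrees n D. (\<Prod>i<n. ?a (k i)) * (v \<bullet> w) ^ (\<Sum>i<n. k i)) \<partial>uniform_sphere d)"
      by (simp only: prod.distrib power_sum)
    also have "\<dots> = (\<Sum>k\<in>degrees n D. (\<Prod>i<n. ?a (k i)) * (\<integral>w. (v \<bullet> w) ^ (\<Sum>i<n. k i) \<partial>uniform_sphere d))"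
      by (subst Bochner_Integration.integral_sum) (intro integrable_mult_right i, simp only: integral_mult_right_zero)
    also have "\<dots> \<le> (\<Sum>k\<in>degrees n D. (\<Prod>i<n. ?a (k i)) * (2 * r ^ (\<Sum>i<n. k i)))"
    proof (intro sum_mono mult_left_mono prod_nonneg a0 ballI)
      fix k assume "k \<in> degrees n D"
      then have k: "(\<Sum>i<n. k i) \<le> D" by (simp add: degrees_def)
      have "(\<integral>w. (v \<bullet> w) ^ (\<Sum>i<n. k i) \<partial>uniform_sphere d) = (\<integral>w. (w \<bullet> v) ^ (\<Sum>i<n. k i) \<partial>uniform_sphere d)"
      proof (rule Bochner_Integration.integral_cong[OF refl])
        fix w assume "w \<in> space (uniform_sphere d)"
        then show "(v \<bullet> w) ^ (\<Sum>i<n. k i) = (w \<bullet> v) ^ (\<Sum>i<n. k i)"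
          using comm_scalar_prod[OF v'(1) unit_sphereD(1)] by simp
      qed
      also have "\<dots> \<le> 2 * r ^ (\<Sum>i<n. k i)" unfolding r_def by (rule sphere_moment_le[OF v d k])
      finally show "(\<integral>w. (v \<bullet> w) ^ (\<Sum>i<n. k i) \<partial>uniform_sphere d) \<le> 2 * r ^ (\<Sum>i<n. k i)" .
    qed
    also have "\<dots> = 2 * (\<Sum>k\<in>degrees n D. \<Prod>i<n. ?a (k i) * r ^ k i)"
      unfolding sum_distrib_left prod.distrib power_sum by (simp only: mult.left_commute)
    also have "\<dots> \<le> 2 * (\<Sum>k\<in>PiE {..<n} (\<lambda>_. {..D}). \<Prod>i<n. ?a (k i) * r ^ k i)"
      using a0 r0 by (intro mult_left_mono sum_mono2 finite_PiE prod_nonneg) (auto simp: degrees_def)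
    also have "\<dots> = 2 * (\<Prod>i<n. \<Sum>k\<le>D. ?a k * r ^ k)"
      by (subst prod_sum_PiE) auto
    finally show ?thesis by simp
  qed
  have "(\<integral>v. (\<integral>w. (\<Sum>k\<in>degrees n D. \<Prod>i<n. ?a (k i) * (v \<bullet> w) ^ k i) \<partial>uniform_sphere d) \<partial>uniform_sphere d)
    \<le> (\<integral>v. ?R \<partial>uniform_sphere d)"
    using inner R0 by (intro integral_mono') auto
  also have "\<dots> \<le> ?R"
    using R0 U.subprob_measure_le_1 mult_right_mono[of "measure (uniform_sphere d) (unit_sphere d)" 1 ?R] by simp
  finally show ?thesis .
qed

end

section \<open>Matching three moments\<close>

text \<open>sqrt(k!) is the scale that the recurrence preserves: (k + 1) sqrt(k!) = sqrt(k + 1)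
  sqrt((k + 1)!) \<le> sqrt((k + 2)!). Since |s^2 - 1| \<le> 1, one factor \<rho> pays for |m| + 1.
  Squaring then cancels the k! in \<lambda>_k^2/k!.\<close>

lemma hermite_coeff_abs_le:
  assumes s: "0 \<le> s" "s \<le> 1" and \<rho>: "\<bar>m\<bar> + 1 \<le> \<rho>"
  shows "\<bar>hermite_coeff m s k\<bar> \<le> sqrt (fact k) * \<rho> ^ k"
proof (induction k rule: induct_nat_012)
  case (ge2 k)
  have \<rho>0: "0 \<le> \<rho>" using \<rho> by linarith
  have s2: "\<bar>s\<^sup>2 - 1\<bar> \<le> 1" using s power_le_one[of s 2] by simp
  let ?F = "sqrt (fact (Suc (Suc k))) :: real"
  have F: "?F = sqrt (real (k + 2)) * sqrt (fact (Suc k))"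
    by (simp add: real_sqrt_mult[symmetric])
  have F1: "sqrt (fact (Suc k)) \<le> ?F" by (simp add: fact_mono)
  have F2: "real (Suc k) * sqrt (fact k) \<le> ?F"
  proof -
    have "real (Suc k) * sqrt (fact k) = sqrt (real (Suc k)) * sqrt (fact (Suc k))"
      by (simp add: real_sqrt_mult)
    also have "\<dots> \<le> ?F" unfolding F by (intro mult_right_mono) auto
    finally show ?thesis .
  qed
  have "\<bar>hermite_coeff m s (Suc (Suc k))\<bar>
     \<le> \<bar>m\<bar> * \<bar>hermite_coeff m s (Suc k)\<bar> + \<bar>s\<^sup>2 - 1\<bar> * (real (Suc k) * \<bar>hermite_coeff m s k\<bar>)"
    using abs_triangle_ineq[of "m * hermite_coeff m s (Suc k)" "(s\<^sup>2 - 1) * real (Suc k) * hermite_coeff m s k"]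
    by (simp only: hermite_coeff.simps abs_mult abs_of_nat mult.assoc)
  also have "\<dots> \<le> \<bar>m\<bar> * (sqrt (fact (Suc k)) * \<rho> ^ Suc k) + 1 * (real (Suc k) * (sqrt (fact k) * \<rho> ^ k))"
    using ge2 s2 by (intro add_mono mult_mono) auto
  also have "\<dots> = \<bar>m\<bar> * (sqrt (fact (Suc k)) * \<rho> ^ Suc k) + (real (Suc k) * sqrt (fact k)) * \<rho> ^ k"
    by simp
  also have "\<dots> \<le> \<bar>m\<bar> * (?F * \<rho> ^ Suc k) + ?F * \<rho> ^ k"
    using F1 F2 \<rho>0 by (intro add_mono mult_left_mono mult_right_mono) auto
  also have "\<dots> \<le> \<bar>m\<bar> * (?F * \<rho> ^ Suc k) + ?F * \<rho> ^ Suc k"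
  proof -
    have "\<rho> ^ k \<le> \<rho> ^ Suc k" using \<rho> by (intro power_increasing) auto
    then show ?thesis by (intro add_left_mono mult_left_mono) auto
  qed
  also have "\<dots> = ?F * \<rho> ^ Suc k * (\<bar>m\<bar> + 1)" by (simp add: algebra_simps)
  also have "\<dots> \<le> ?F * \<rho> ^ Suc k * \<rho>"
    using \<rho> \<rho>0 by (intro mult_left_mono) auto
  finally show ?case by (simp only: power_Suc mult_ac)
qed (use \<rho> in auto)

text \<open>A noise node satisfies |x| + 1 \<le> 3/sqrt \<eta>, so the noise contributes \<eta>
  (3/sqrt \<eta>)^k. The Gaussian part 2^k is no larger, as \<eta> (1/sqrt \<eta>)^k >= 1 from k = 2
  on. Squaring twice the noise term yields 4 and 9.\<close>

lemma (in spiked_mixture) hermite_moment_sq_le: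
  assumes m: "\<bar>m\<bar> \<le> 1" and x: "\<And>j. \<bar>x j\<bar> \<le> 2 / sqrt \<eta>" and k: "k \<ge> 2"
  shows "(hermite_moment k)\<^sup>2 / fact k \<le> 4 * \<eta>\<^sup>2 * (9 / \<eta>) ^ k"
proof -
  let ?q = "sqrt (fact k) :: real"
  have t: "0 < sqrt \<eta>" "sqrt \<eta> \<le> 1" using \<eta> by auto
  let ?X = "3 / sqrt \<eta>"
  have 1: "\<bar>hermite_coeff m s k\<bar> \<le> ?q * 2 ^ k"
    using m s by (intro hermite_coeff_abs_le) auto
  have 2: "\<bar>hermite_coeff (x j) 1 k\<bar> \<le> ?q * ?X ^ k" for j
  proof (rule hermite_coeff_abs_le)
    have "1 \<le> 1 / sqrt \<eta>" using t by simp
    then show "\<bar>x j\<bar> + 1 \<le> ?X" using x[of j] by (simp add: field_simps)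
  qed auto
  have "\<bar>\<Sum>j\<in>set_pmf J. pmf J j * hermite_coeff (x j) 1 k\<bar> \<le> (\<Sum>j\<in>set_pmf J. pmf J j * (?q * ?X ^ k))"
    using 2 by (intro order_trans[OF sum_abs] sum_mono) (auto simp: abs_mult intro!: mult_left_mono)
  also have "\<dots> = ?q * ?X ^ k"
    using sum_pmf_eq_1[OF J order_refl] by (simp add: sum_distrib_right[symmetric])
  finally have 3: "\<bar>\<Sum>j\<in>set_pmf J. pmf J j * hermite_coeff (x j) 1 k\<bar> \<le> ?q * ?X ^ k" .
  have "\<bar>hermite_moment k\<bar> \<le> (1 - \<eta>) * \<bar>hermite_coeff m s k\<bar>
      + \<eta> * \<bar>\<Sum>j\<in>set_pmf J. pmf J j * hermite_coeff (x j) 1 k\<bar>"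
    unfolding hermite_moment_def using \<eta>
    by (intro order_trans[OF abs_triangle_ineq]) (simp add: abs_mult)
  also have "\<dots> \<le> 1 * (?q * 2 ^ k) + \<eta> * (?q * ?X ^ k)"
    using \<eta> 1 3 by (intro add_mono mult_mono) auto
  also have "\<dots> \<le> 2 * \<eta> * ?q * ?X ^ k"
  proof -
    have "2 ^ k * 1 \<le> 3 ^ k * (\<eta> * (1 / sqrt \<eta>) ^ k)"
    proof (rule mult_mono)
      have "(1 / sqrt \<eta>) ^ 2 \<le> (1 / sqrt \<eta>) ^ k" using t k by (intro power_increasing) auto
      then have "\<eta> * (1 / sqrt \<eta>) ^ 2 \<le> \<eta> * (1 / sqrt \<eta>) ^ k" using \<eta> by (intro mult_left_mono) auto
      then show "1 \<le> \<eta> * (1 / sqrt \<eta>) ^ k" using \<eta> by (simp add: power_divide)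
    qed (auto intro: power_mono)
    then have "2 ^ k \<le> \<eta> * ?X ^ k" by (simp add: power_divide mult_ac)
    then have "?q * 2 ^ k \<le> ?q * (\<eta> * ?X ^ k)" by (intro mult_left_mono) auto
    then show ?thesis by (simp add: mult_ac)
  qed
  finally have "(hermite_moment k)\<^sup>2 \<le> (2 * \<eta> * ?q * ?X ^ k)\<^sup>2"
    using \<eta> by (subst abs_le_square_iff[symmetric]) simp
  also have "\<dots> = 4 * \<eta>\<^sup>2 * fact k * (9 / \<eta>) ^ k"
  proof -
    have "(?X ^ k)\<^sup>2 = (?X\<^sup>2) ^ k" by (simp only: power_mult[symmetric] mult.commute)
    also have "?X\<^sup>2 = 9 / \<eta>" using \<eta> by (simp add: power_divide)
    finally have *: "(?X ^ k)\<^sup>2 = (9 / \<eta>) ^ k" .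
    have "?q\<^sup>2 = fact k" by simp
    then show ?thesis unfolding power_mult_distrib * by simp
  qed
  finally show ?thesis by (simp add: divide_le_eq mult_ac)
qed

text \<open>The induction carries the remainder 2 z^(D+1), the bound for the rest of the series; 2 z
  \<le> 1 lets it pay for the next term and the next remainder. Before the tail starts the whole
  budget 2 z^4 is kept.\<close>

lemma geometric_tail_le:
  fixes z :: real
  assumes z: "0 \<le> z" "z \<le> 1 / 2"
  shows "(\<Sum>k\<le>D. if 4 \<le> k then z ^ k else 0) \<le> 2 * z ^ 4"
proof -
  have "(\<Sum>k\<le>D. if 4 \<le> k then z ^ k else 0) + (if 3 \<le> D then 2 * z ^ Suc D else 2 * z ^ 4) \<le> 2 * z ^ 4"
  proof (induction D)
    case (Suc D)
    have le: "2 * z ^ Suc (Suc D) \<le> z ^ Suc D"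
      using mult_right_mono[OF z(2), of "z ^ Suc D"] z(1) by simp
    consider "3 \<le> D" | "D = 2" | "D < 2" by linarith
    then show ?case
    proof cases
      assume "3 \<le> D"
      then show ?thesis using Suc le by (simp del: power_Suc)
    next
      assume D: "D = 2"
      have "(\<Sum>k\<le>Suc 2. if 4 \<le> k then z ^ k else 0) = (\<Sum>k\<le>Suc 2. 0)" by (intro sum.cong) auto
      then show ?thesis unfolding D by simp
    next
      assume D: "D < 2"
      then have "(\<Sum>k\<le>Suc D. if 4 \<le> k then z ^ k else 0) = (\<Sum>k\<le>Suc D. 0)" by (intro sum.cong) auto
      then show ?thesis using D by simp
    qed
  qed simp
  moreover have "0 \<le> (if 3 \<le> D then 2 * z ^ Suc D else 2 * z ^ 4)" using z by simp
  ultimately show ?thesis by linarith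
qed

lemma (in spiked_mixture) hermite_moment_sum_le:
  assumes m: "\<bar>m\<bar> \<le> 1" and x: "\<And>j. \<bar>x j\<bar> \<le> 2 / sqrt \<eta>"
    and match: "hermite_moment 1 = 0" "hermite_moment 2 = 0" "hermite_moment 3 = 0"
    and r: "0 \<le> r" "9 * r / \<eta> \<le> 1 / 2"
  shows "(\<Sum>k\<le>D. (hermite_moment k)\<^sup>2 / fact k * r ^ k) \<le> 1 + 8 * \<eta>\<^sup>2 * (9 * r / \<eta>) ^ 4"
proof -
  let ?z = "9 * r / \<eta>"
  have h0: "hermite_moment 0 = 1"
    using sum_pmf_eq_1[OF J order_refl] by (simp add: hermite_moment_def)
  have le: "(hermite_moment k)\<^sup>2 / fact k * r ^ k
      \<le> (if k = 0 then 1 else 0) + 4 * \<eta>\<^sup>2 * (if 4 \<le> k then ?z ^ k else 0)" for k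
  proof (cases "4 \<le> k")
    case True
    have "(hermite_moment k)\<^sup>2 / fact k * r ^ k \<le> (4 * \<eta>\<^sup>2 * (9 / \<eta>) ^ k) * r ^ k"
      using True r m x by (intro mult_right_mono hermite_moment_sq_le) auto
    also have "\<dots> = 4 * \<eta>\<^sup>2 * ?z ^ k" by (simp add: power_divide power_mult_distrib)
    finally show ?thesis using True by simp
  next
    case False
    then have "k = 0 \<or> k = 1 \<or> k = 2 \<or> k = 3" by auto
    then show ?thesis using match h0 by auto
  qed
  have "(\<Sum>k\<le>D. (hermite_moment k)\<^sup>2 / fact k * r ^ k)
     \<le> (\<Sum>k\<le>D. (if k = 0 then 1 else 0) + 4 * \<eta>\<^sup>2 * (if 4 \<le> k then ?z ^ k else 0))"
    by (intro sum_mono le)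
  also have "\<dots> = 1 + 4 * \<eta>\<^sup>2 * (\<Sum>k\<le>D. if 4 \<le> k then ?z ^ k else 0)"
    by (simp only: sum.distrib sum_distrib_left) simp
  also have "\<dots> \<le> 1 + 4 * \<eta>\<^sup>2 * (2 * ?z ^ 4)"
    using r \<eta> by (intro add_left_mono mult_left_mono geometric_tail_le) auto
  finally show ?thesis by simp
qed

text \<open>Writing z = 9 r / \<eta>, one has z^2 = 81 * 8 D / (d \<eta>^2) = 648 D / (d \<eta>^2),
  so the exponent 8 n \<eta>^2 z^4 equals 8 * 648^2 n D^2 / (d^2 \<eta>^2). As 8 * 648^2 = 3359232 <
  4000000, it is at most 1, and the squared advantage is at most 2 e < 9.\<close>

lemma (in spiked_mixture) advantage_le_3:
  fixes n D :: nat
  assumes d: "d \<ge> 1" and m: "\<bar>m\<bar> \<le> 1" and x: "\<And>j. \<bar>x j\<bar> \<le> 2 / sqrt \<eta>"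
    and match: "hermite_moment 1 = 0" "hermite_moment 2 = 0" "hermite_moment 3 = 0"
    and n: "4000000 * real d \<le> real n"
    and nD: "4000000 * real n \<le> (real d)\<^sup>2 * \<eta>\<^sup>2 / (1 + (real D)\<^sup>2)"
  shows "advantage n d D (planted_law n d \<eta> spike_mean spike_cov spike_noise) (null_law n d) \<le> ereal 3"
proof -
  define r where "r = sqrt (8 * real D / real d)"
  define w where "w = real d * \<eta>\<^sup>2"
  let ?z = "9 * r / \<eta>"
  have dp: "real d > 0" using d by simp
  have w0: "w > 0" using dp \<eta> by (simp add: w_def)
  have p0: "1 + (real D)\<^sup>2 > 0" by (simp add: add_pos_nonneg)
  have nD': "4000000 * real n * (1 + (real D)\<^sup>2) \<le> real d * w"
    using nD p0 by (simp add: pos_le_divide_eq w_def power2_eq_square mult_ac)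
  have "real d * (16000000000000 * (1 + (real D)\<^sup>2)) = 4000000 * (4000000 * real d) * (1 + (real D)\<^sup>2)" by simp
  also have "\<dots> \<le> 4000000 * real n * (1 + (real D)\<^sup>2)"
    using n p0 by (intro mult_right_mono mult_left_mono) auto
  also have "\<dots> \<le> real d * w" by (rule nD')
  \<comment> \<open>Chaining the lower and the upper condition on n eliminates it: d \<eta>^2
    dominates 1 + D^2, hence also D, which keeps z at most 1/2.\<close>
  finally have wD: "16000000000000 * (1 + (real D)\<^sup>2) \<le> w" using dp by simp
  have D2: "real D \<le> 1 + (real D)\<^sup>2"
    using sum_squares_bound[of "real D" 1] by (simp add: power2_eq_square)
  have z2: "?z\<^sup>2 = 648 * real D / w"
    using dp \<eta> by (simp add: r_def w_def power_divide power_mult_distrib)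
  also have "\<dots> \<le> (1 / 2)\<^sup>2" using wD D2 w0 by (simp add: divide_le_eq power2_eq_square)
  finally have z: "?z \<le> 1 / 2" by (rule power2_le_imp_le) simp
  have r0: "0 \<le> r" by (simp add: r_def)
  have "real n * (8 * \<eta>\<^sup>2 * ?z ^ 4) = real n * (8 * \<eta>\<^sup>2 * (?z\<^sup>2)\<^sup>2)" by simp
  also have "\<dots> = 3359232 * (real n * (real D)\<^sup>2) / (real d * w)"
    unfolding z2 using dp \<eta> by (simp add: w_def power2_eq_square field_simps)
  also have "\<dots> \<le> 1"
  proof -
    have "3359232 * (real n * (real D)\<^sup>2) \<le> 4000000 * real n * (1 + (real D)\<^sup>2)"
      by (simp add: algebra_simps)
    then show ?thesis using nD' dp w0 by (simp add: divide_le_eq)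
  qed
  finally have small: "real n * (8 * \<eta>\<^sup>2 * ?z ^ 4) \<le> 1" .
  have "(\<integral>v. (\<integral>w. (\<Sum>k\<in>degrees n D. \<Prod>i<n. (hermite_moment (k i))\<^sup>2 / fact (k i) * (v \<bullet> w) ^ k i)
      \<partial>uniform_sphere d) \<partial>uniform_sphere d) \<le> 2 * (\<Sum>k\<le>D. (hermite_moment k)\<^sup>2 / fact k * r ^ k) ^ n"
    unfolding r_def by (rule second_moment_le[OF d])
  also have "\<dots> \<le> 2 * (1 + 8 * \<eta>\<^sup>2 * ?z ^ 4) ^ n"
    using r0 by (intro mult_left_mono power_mono hermite_moment_sum_le[OF m x match r0 z] sum_nonneg) auto
  also have "\<dots> \<le> 2 * exp (8 * \<eta>\<^sup>2 * ?z ^ 4) ^ n"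
    using \<eta> r0 by (intro mult_left_mono power_mono exp_ge_add_one_self) auto
  also have "\<dots> = 2 * exp (real n * (8 * \<eta>\<^sup>2 * ?z ^ 4))" by (simp add: exp_of_nat_mult)
  also have "\<dots> \<le> 2 * exp 1" using small by simp
  also have "\<dots> \<le> 9" using exp_le by simp
  finally have "advantage n d D (planted_law n d \<eta> spike_mean spike_cov spike_noise) (null_law n d) \<le> ereal (sqrt 9)"
    by (rule advantage_le[OF d])
  then show ?thesis by simp
qed

text \<open>The noise along the spike mixes \<open>N(x, 1)\<close> over \<open>x = 0, L, -L, 2L\<close> with \<open>L = 1/\<surd>\<eta>\<close>; the weights solve the
  linear system for the first three Hermite moments, a component at \<open>0\<close> contributing nothing.\<close>

lemma moment_matching_weights:
  fixes \<eta> m s :: real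
  assumes \<eta>: "0 < \<eta>" "\<eta> < 1 / 2" and s: "0 < s" "s\<^sup>2 \<le> 1 / 200" and m: "0 < m" "m \<le> sqrt \<eta> / 10"
  obtains J :: "nat pmf" and x :: "nat \<Rightarrow> real" where
    "finite (set_pmf J)" "\<And>j. \<bar>x j\<bar> \<le> 2 / sqrt \<eta>"
    "(1 - \<eta>) * m + \<eta> * (\<Sum>j\<in>set_pmf J. pmf J j * x j) = 0"
    "(1 - \<eta>) * (m\<^sup>2 + (s\<^sup>2 - 1)) + \<eta> * (\<Sum>j\<in>set_pmf J. pmf J j * (x j)\<^sup>2) = 0"
    "(1 - \<eta>) * (m ^ 3 + 3 * m * (s\<^sup>2 - 1)) + \<eta> * (\<Sum>j\<in>set_pmf J. pmf J j * (x j) ^ 3) = 0"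
proof -
  define t where "t = sqrt \<eta>"
  have t: "0 < t" "t * t = \<eta>" using \<eta> by (auto simp: t_def)
  \<comment> \<open>In units of L = 1/t, the noise nodes must have first three moments -\<beta>, V
    and \<beta> \<eta> \<kappa>. The first and third have opposite signs, whereas on 0, L, -L they
    coincide; the node 2L breaks this, and X = 6 q3 is the third moment minus the first.\<close>
  define \<beta> where "\<beta> = (1 - \<eta>) * m / t"
  define V where "V = (1 - \<eta>) * (1 - s\<^sup>2 - m\<^sup>2)"
  define \<kappa> where "\<kappa> = 3 - 3 * s\<^sup>2 - m\<^sup>2"
  define X where "X = \<beta> * (1 + \<eta> * \<kappa>)"
  define q1 where "q1 = (V - \<beta> - X) / 2"
  define q2 where "q2 = (V + \<beta> - X / 3) / 2"
  define q3 where "q3 = X / 6"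
  define q0 where "q0 = 1 - V + X / 2"
  have "m\<^sup>2 \<le> (t / 10)\<^sup>2" using m by (intro power_mono) (auto simp: t_def)
  then have m2: "m\<^sup>2 \<le> \<eta> / 100" using t by (simp add: power2_eq_square)
  then have m2': "m\<^sup>2 \<le> 1 / 200" using \<eta> by linarith
  have \<beta>0: "0 \<le> \<beta>" using \<eta> m t by (simp add: \<beta>_def)
  have "\<beta> \<le> 1 * (t / 10) / t"
    unfolding \<beta>_def using \<eta> m t by (intro divide_right_mono mult_mono) (auto simp: t_def)
  then have \<beta>1: "\<beta> \<le> 1 / 10" using t by simp
  have s0: "0 \<le> s\<^sup>2" "0 \<le> m\<^sup>2" by simp_all
  have \<kappa>: "0 \<le> \<kappa>" "\<kappa> \<le> 3" unfolding \<kappa>_def using s m2' s0 by linarith+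
  have "\<eta> * \<kappa> \<le> 1 / 2 * 3" using \<eta> \<kappa> by (intro mult_mono) auto
  then have "\<beta> * (1 + \<eta> * \<kappa>) \<le> 1 / 10 * (5 / 2)"
    using \<beta>0 \<beta>1 \<eta> \<kappa> by (intro mult_mono) auto
  then have X1: "X \<le> 1 / 4" by (simp add: X_def)
  have X0: "0 \<le> X" unfolding X_def using \<beta>0 \<eta> \<kappa> by (intro mult_nonneg_nonneg add_nonneg_nonneg) auto
  have "1 / 2 * (99 / 100) \<le> V" unfolding V_def using \<eta> s m2' by (intro mult_mono) auto
  then have V0: "99 / 200 \<le> V" by simp
  have "V \<le> 1 * 1" unfolding V_def using \<eta> s0 m2' s by (intro mult_mono) auto
  then have V1: "V \<le> 1" by simp
  \<comment> \<open>The tightest weight is q1, which needs V >= \<beta> + X: here V >= 99/200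
    against 1/10 + 1/4. The bound on \<beta> is where m \<le> sqrt \<eta> / 10 is spent.\<close>
  have q: "0 \<le> q0" "0 \<le> q1" "0 \<le> q2" "0 \<le> q3"
    using \<beta>0 \<beta>1 X0 X1 V0 V1 by (auto simp: q0_def q1_def q2_def q3_def)
  have q_sum: "q0 + q1 + q2 + q3 = 1" by (simp add: q0_def q1_def q2_def q3_def field_simps)
  define xs where "xs = [(0 :: nat, q0), (1, q1), (2, q2), (3, q3)]"
  have wf: "pmf_of_list_wf xs" using q q_sum by (auto simp: pmf_of_list_wf_def xs_def)
  define J where "J = pmf_of_list xs"
  define x where "x j = (if j = 1 then 1 / t else if j = 2 then - 1 / t else if j = 3 then 2 / t else 0)" for j :: nat
  have sub: "set_pmf J \<subseteq> {0, 1, 2, 3}"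
    using set_pmf_of_list[OF wf] by (auto simp: J_def xs_def)
  have pmf: "pmf J 0 = q0" "pmf J 1 = q1" "pmf J 2 = q2" "pmf J 3 = q3"
    unfolding J_def pmf_pmf_of_list[OF wf] by (simp_all add: xs_def)
  have expect: "(\<Sum>j\<in>set_pmf J. pmf J j * f j) = q0 * f 0 + q1 * f 1 + q2 * f 2 + q3 * f 3" for f :: "nat \<Rightarrow> real"
  proof -
    have "(\<Sum>j\<in>set_pmf J. pmf J j * f j) = (\<Sum>j\<in>{0, 1, 2, 3}. pmf J j * f j)"
      using sub by (intro sum.mono_neutral_left) (auto simp: set_pmf_iff)
    then show ?thesis using pmf by (simp add: add.assoc)
  qed
  have e1: "q1 - q2 + 2 * q3 = - \<beta>" and e2: "q1 + q2 + 4 * q3 = V" and e3: "q1 - q2 + 8 * q3 = \<beta> * (\<eta> * \<kappa>)"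
    by (simp_all add: q1_def q2_def q3_def X_def field_simps)
  have \<beta>t: "\<beta> * t = (1 - \<eta>) * m" using t by (simp add: \<beta>_def)
  have \<eta>t: "\<eta> / t = t" "\<eta> / t\<^sup>2 = 1" "\<eta> / t ^ 3 = 1 / t"
    using t by (auto simp: power2_eq_square power3_eq_cube field_simps)
  show thesis
  proof (rule that[of J x])
    show "finite (set_pmf J)" using sub by (rule finite_subset) simp
    show "\<bar>x j\<bar> \<le> 2 / sqrt \<eta>" for j using t by (auto simp: x_def t_def divide_right_mono)
    have "\<eta> * (\<Sum>j\<in>set_pmf J. pmf J j * x j) = \<eta> / t * (q1 - q2 + 2 * q3)"
      unfolding expect by (simp add: x_def add_divide_distrib diff_divide_distrib algebra_simps)
    then show "(1 - \<eta>) * m + \<eta> * (\<Sum>j\<in>set_pmf J. pmf J j * x j) = 0"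
      unfolding e1 \<eta>t using \<beta>t by (simp add: mult.commute)
    have "\<eta> * (\<Sum>j\<in>set_pmf J. pmf J j * (x j)\<^sup>2) = \<eta> / t\<^sup>2 * (q1 + q2 + 4 * q3)"
      unfolding expect by (simp add: x_def power_divide add_divide_distrib algebra_simps)
    then show "(1 - \<eta>) * (m\<^sup>2 + (s\<^sup>2 - 1)) + \<eta> * (\<Sum>j\<in>set_pmf J. pmf J j * (x j)\<^sup>2) = 0"
      unfolding e2 \<eta>t by (simp add: V_def algebra_simps)
    have "\<eta> * (\<Sum>j\<in>set_pmf J. pmf J j * (x j) ^ 3) = \<eta> / t ^ 3 * (q1 - q2 + 8 * q3)"
      unfolding expect by (simp add: x_def power_divide add_divide_distrib algebra_simps)
    also have "\<dots> = (\<beta> * t) * \<kappa>"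
      unfolding e3 t(2)[symmetric] using t(1) by (simp add: power3_eq_cube)
    finally show "(1 - \<eta>) * (m ^ 3 + 3 * m * (s\<^sup>2 - 1)) + \<eta> * (\<Sum>j\<in>set_pmf J. pmf J j * (x j) ^ 3) = 0"
      unfolding \<beta>t by (simp add: \<kappa>_def power2_eq_square power3_eq_cube algebra_simps)
  qed
qed

theorem theorem7p9:
  shows "\<exists>(C::real) (k::nat) (p::real poly) (c::real) (K::real).
    C > 0 \<and> c > 0 \<and> (\<forall>D::nat. poly p (real D) > 0) \<and>
    (\<forall>(d::nat) (\<eta>::real) (\<alpha>::real).
       d \<ge> 1 \<longrightarrow> 0 < \<eta> \<longrightarrow> \<eta> < 1/2 \<longrightarrow> \<alpha> > 0 \<longrightarrow> much_less C k d (1 / sqrt (real d)) \<eta> \<longrightarrow>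
       (\<exists>\<mu> \<Sigma> Q.
          valid_choice d \<eta> \<alpha> \<mu> \<Sigma> Q \<and>
          (\<forall>v\<in>unit_sphere d. min_eigenvalue (\<Sigma> v) \<ge> c * min (\<eta> / \<alpha>\<^sup>2) (1/2)) \<and>
          (\<forall>(n::nat) (D::nat).
             much_less C k d (real d) (real n) \<longrightarrow>
             much_less C k d (real n) ((real d)\<^sup>2 * \<eta>\<^sup>2 / poly p (real D)) \<longrightarrow>
             (\<forall>f\<in>poly_funs n d D. integrable (planted_law n d \<eta> \<mu> \<Sigma> Q) f) \<and>
             advantage n d D (planted_law n d \<eta> \<mu> \<Sigma> Q) (null_law n d) \<le> ereal K)))"
proof (rule exI[of _ 4000000], rule exI[of _ 0], rule exI[of _ "[:1, 0, 1:]"],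
    rule exI[of _ "1 / 100"], rule exI[of _ 3], intro conjI allI impI)
  \<comment> \<open>The witnesses: 4000000 rounds up 8 * 648^2, exponent 0 means that no logarithm
    is lost, 1 + D^2 stays positive at D = 0, 1/100 is the ratio of s^2 to the minimum below, and 3
    is sqrt 9.\<close>
  show "(4000000 :: real) > 0" "(1 / 100 :: real) > 0" by simp_all
  show "poly [:1, 0, 1:] (real D) > 0" for D :: nat by (simp add: add_pos_nonneg)
  fix d :: nat and \<eta> \<alpha> :: real
  assume d: "d \<ge> 1" and \<eta>: "0 < \<eta>" "\<eta> < 1 / 2" and \<alpha>: "\<alpha> > 0"
  \<comment> \<open>The variance along \<open>v\<close> is s^2 = u/100, which is also the least
    eigenvalue, and m/s = \<alpha>. Dividing by 100 gives m \<le> sqrt \<eta> / 10, and u \<le> 1/2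
    gives s^2 \<le> 1/200, the margins under which the noise weights are nonnegative.\<close>
  define u where "u = min (\<eta> / \<alpha>\<^sup>2) (1 / 2)"
  define s where "s = sqrt (u / 100)"
  define m where "m = \<alpha> * s"
  have u: "u \<le> 1 / 2" "u \<le> \<eta> / \<alpha>\<^sup>2" "0 < u"
    unfolding u_def by (rule min.cobounded2, rule min.cobounded1) (use \<eta> \<alpha> in simp)
  have s: "0 < s" and s2: "s\<^sup>2 = u / 100" using u by (simp_all add: s_def)
  have s200: "s\<^sup>2 \<le> 1 / 200" using s2 u by simp
  then have s1: "s \<le> 1" using power2_le_imp_le[of s 1] by simp
  have m0: "0 < m" using \<alpha> s by (simp add: m_def)
  have "m\<^sup>2 \<le> (sqrt \<eta> / 10)\<^sup>2"
    using u(2) \<alpha> \<eta> by (simp add: m_def power_mult_distrib s2 power_divide le_divide_eq mult.commute)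
  then have m1: "m \<le> sqrt \<eta> / 10" using \<eta> by (intro power2_le_imp_le[of m]) auto
  have m_le: "\<bar>m\<bar> \<le> 1" using m0 m1 \<eta> real_sqrt_le_1_iff[of \<eta>] by linarith
  obtain J :: "nat pmf" and x :: "nat \<Rightarrow> real" where J: "finite (set_pmf J)" and x: "\<And>j. \<bar>x j\<bar> \<le> 2 / sqrt \<eta>"
    and match: "(1 - \<eta>) * m + \<eta> * (\<Sum>j\<in>set_pmf J. pmf J j * x j) = 0"
      "(1 - \<eta>) * (m\<^sup>2 + (s\<^sup>2 - 1)) + \<eta> * (\<Sum>j\<in>set_pmf J. pmf J j * (x j)\<^sup>2) = 0"
      "(1 - \<eta>) * (m ^ 3 + 3 * m * (s\<^sup>2 - 1)) + \<eta> * (\<Sum>j\<in>set_pmf J. pmf J j * (x j) ^ 3) = 0"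
    using moment_matching_weights[OF \<eta> s s200 m0 m1] by blast
  interpret spiked_mixture d \<eta> m s J x
    using \<eta> s s1 J by unfold_locales auto
  have c: "hermite_coeff a b 1 = a" "hermite_coeff a b 2 = a\<^sup>2 + (b\<^sup>2 - 1)"
    "hermite_coeff a b 3 = a ^ 3 + 3 * a * (b\<^sup>2 - 1)" for a b
    by (simp_all add: numeral_2_eq_2 numeral_3_eq_3 algebra_simps)
  have hm: "hermite_moment 1 = 0" "hermite_moment 2 = 0" "hermite_moment 3 = 0"
    unfolding hermite_moment_def c using match by simp_all
  show "\<exists>\<mu> \<Sigma> Q. valid_choice d \<eta> \<alpha> \<mu> \<Sigma> Q \<and>
          (\<forall>v\<in>unit_sphere d. min_eigenvalue (\<Sigma> v) \<ge> 1 / 100 * min (\<eta> / \<alpha>\<^sup>2) (1/2)) \<and>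
          (\<forall>(n::nat) (D::nat).
             much_less 4000000 0 d (real d) (real n) \<longrightarrow>
             much_less 4000000 0 d (real n) ((real d)\<^sup>2 * \<eta>\<^sup>2 / poly [:1, 0, 1:] (real D)) \<longrightarrow>
             (\<forall>f\<in>poly_funs n d D. integrable (planted_law n d \<eta> \<mu> \<Sigma> Q) f) \<and>
             advantage n d D (planted_law n d \<eta> \<mu> \<Sigma> Q) (null_law n d) \<le> ereal 3)"
  proof (intro exI conjI ballI allI impI)
    show "valid_choice d \<eta> \<alpha> spike_mean spike_cov spike_noise"
      using \<alpha> by (intro valid_choice_spiked) (simp_all add: m_def)
    show "1 / 100 * min (\<eta> / \<alpha>\<^sup>2) (1/2) \<le> min_eigenvalue (spike_cov v)" if "v \<in> unit_sphere d" for v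
      unfolding spike_cov_def using unit_sphereD[OF that] s200 s2
      by (subst min_eigenvalue_rank_one) (auto simp: u_def)
    fix n D :: nat
    show "integrable (planted_law n d \<eta> spike_mean spike_cov spike_noise) f" if "f \<in> poly_funs n d D" for f
      using d that by (rule planted_poly_funs)
    assume "much_less 4000000 0 d (real d) (real n)"
      and "much_less 4000000 0 d (real n) ((real d)\<^sup>2 * \<eta>\<^sup>2 / poly [:1, 0, 1:] (real D))"
    then show "advantage n d D (planted_law n d \<eta> spike_mean spike_cov spike_noise) (null_law n d) \<le> ereal 3"
      by (intro advantage_le_3[OF d m_le x hm]) (simp_all add: much_less_def power2_eq_square)
  qed
qed

end
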